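(* Let $k\geqslant 2$ be an integer. (a) If $k\equiv 3\pmod 4$, then $H_1(\mathcal{J}_k(\mathbb{Z}))\cong \mathbb{Z}^k\oplus(\mathbb{Z}/2\mathbb{Z})^{\frac{k+1}{2}}$. (b) If $k\equiv 2\pmod 4$, then $H_1(\mathcal{J}_k(\mathbb{Z}))\cong \mathbb{Z}^k\oplus(\mathbb{Z}/2\mathbb{Z})^{\frac{k+2}{2}}$. (c) If $k\equiv 1\pmod 4$, then $H_1(\mathcal{J}_k(\mathbb{Z}))\cong \mathbb{Z}^k\oplus\mathbb{Z}/4\mathbb{Z}\oplus(\mathbb{Z}/2\mathbb{Z})^{\frac{k-3}{2}}$. (d) If $k\equiv 0\pmod 4$, then $H_1(\mathcal{J}_k(\mathbb{Z}))\cong \mathbb{Z}^k\oplus\mathbb{Z}/4\mathbb{Z}\oplus(\mathbb{Z}/2\mathbb{Z})^{\frac{k-2}{2}}$. (Isomorphisms of groups.)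
   Context: For $k\geqslant 2$, $\mathcal{J}_k(\mathbb{Z})$ is the group, under composition of formal power series, of all $f\in\mathbb{Z}[[x]]$ of the form $f=x+\sum_{i\geqslant k}\alpha_i x^i$. Identifying $\mathbb{Z}[[x]]$ with $\mathbb{Z}^{\mathbb{N}}$ (product topology, $\mathbb{Z}$ discrete) makes it a topological group with the subspace topology. $[\mathcal{J}_k(\mathbb{Z}),\mathcal{J}_k(\mathbb{Z})]$ denotes the closure of the subgroup generated by all commutators $[f,g]=f\circ g\circ f^{-1}\circ g^{-1}$ with $f,g\in\mathcal{J}_k(\mathbb{Z})$, and $H_1(\mathcal{J}_k(\mathbb{Z})):=\mathcal{J}_k(\mathbb{Z})/[\mathcal{J}_k(\mathbb{Z}),\mathcal{J}_k(\mathbb{Z})]$ is the abelianization. *)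

theory Defs
  imports
    "HOL-Analysis.Function_Topology"
    "HOL-Computational_Algebra.Formal_Power_Series"
    "HOL-Algebra.Generated_Groups"
    "HOL-Algebra.Product_Groups"
    "HOL-Algebra.Elementary_Groups"
begin

definition J_group :: "nat \<Rightarrow> int fps monoid" where
  "J_group k =
    \<lparr>carrier = {fps_X + Abs_fps (\<lambda>i. if i \<ge> k then \<alpha> i else 0) | \<alpha>. True},
     monoid.mult = fps_compose,
     one = fps_X\<rparr>"

text \<open>The product topology on integer sequences, carried over to power series by reading
  off the coefficients, and its restriction to the group.\<close>

definition fps_product_topology :: "int fps topology" where
  "fps_product_topology =
    pullback_topology UNIV fps_nth (product_topology (\<lambda>_. discrete_topology UNIV) UNIV)"

definition J_topology :: "nat \<Rightarrow> int fps topology" where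
  "J_topology k = subtopology fps_product_topology (carrier (J_group k))"

text \<open>The library's \<^const>\<open>derived\<close> is the abstract subgroup generated by the commutators,
  with the convention \<open>f \<circ> g \<circ> f\<inverse> \<circ> g\<inverse>\<close>; here it is closed up topologically.\<close>

definition J_commutator :: "nat \<Rightarrow> int fps set" where
  "J_commutator k = J_topology k closure_of derived (J_group k) (carrier (J_group k))"

definition J_H1 :: "nat \<Rightarrow> int fps set monoid" where
  "J_H1 k = J_group k Mod J_commutator k"

definition power_group :: "('a, 'b) monoid_scheme \<Rightarrow> nat \<Rightarrow> (nat \<Rightarrow> 'a) monoid" where
  "power_group G n = product_group {..<n} (\<lambda>_. G)"

end

theory Submission
  imports Defs
begin

text \<open>Put \<open>d = k - 1\<close> and say that \<open>x + a x\<^sup>n\<^sup>+\<^sup>1 + \<dots>\<close> has depth \<open>n\<close>. A commutator of series of depths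
  \<open>m \<noteq> n\<close> has depth \<open>m + n\<close> and leading coefficient \<open>\<plusminus>(m - n) a b\<close>. So the coefficients of depth
  \<open>d, \<dots>, 2 d\<close> survive in the abelianization and give \<open>\<int>\<^sup>k\<close>, every odd depth above \<open>2 d\<close> is
  killed, and every even depth above \<open>2 d\<close> is killed at least up to a factor 2.

  Modulo 2 the derivative is \<open>f' = u\<^sub>f(x\<^sup>2)\<close>, and the chain rule \<open>u\<^bsub>f \<circ> g\<^esub> = u\<^sub>f(g) u\<^sub>g\<close> makes \<open>u\<close>
  multiplicative up to depth about \<open>3 d\<close>; at the last few depths the failure of \<open>u\<close> to be
  symmetric in \<open>f\<close> and \<open>g\<close> is compensated by another coefficient of \<open>f\<close>, which for
  \<open>k \<equiv> 0, 1\<close> modulo 4 has to be taken modulo 4. The resulting function \<open>\<theta>\<close> satisfies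
  \<open>\<theta>(f \<circ> g) = \<theta>(g \<circ> f)\<close>, hence is trivial on commutators, and it detects the torsion. Conversely,
  at all other even depths a product of two or three commutators, chosen so that their
  leading terms cancel, has an odd leading coefficient.\<close>


unbundle fps_syntax

section \<open>Substitution of truncated power series\<close>

text \<open>Why the critical depth is about \<open>3 d\<close>: the only asymmetry of
  \<open>u_f(g) u_g\<close> comes from \<open>g\<close> inside \<open>u_f\<close>, and there
  \<open>g\<close> is a series in \<open>y = x^2\<close>, so its depth counts twice; the first
  asymmetric term has depth at least \<open>d + 2 d\<close>. On the other side, a leading
  coefficient \<open>m - n\<close> at an even depth \<open>m + n\<close> is even, and the odd
  coefficients are taken from the second term of a commutator, at depth
  \<open>m + 2 n > 3 d\<close>. The function \<open>\<theta>\<close> is not a homomorphism on the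
  whole group, so its symmetry alone is not enough. A commutator \<open>h\<close> is used only
  through \<open>h \<circ> (g \<circ> f) = f \<circ> g\<close>, and from
  \<open>\<theta>(h \<circ> v) = \<theta>(v)\<close> one has to get \<open>\<theta>(h) = 1\<close>.
  This works because \<open>h\<close> has depth above \<open>2 d\<close>: the few cross terms left
  contain a coefficient of \<open>h\<close> that other coordinates show to be even. The summand Z/4
  arises because exchanging \<open>f\<close> and \<open>g\<close> moves an early coefficient by
  \<open>-2 z\<close> modulo 4 and a late one by \<open>z\<close> modulo 2, with the same
  \<open>z\<close>: the early one plus twice the late one is invariant modulo 4.\<close>

definition agree :: "nat \<Rightarrow> 'a fps \<Rightarrow> 'a fps \<Rightarrow> bool" where
  "agree n f g \<longleftrightarrow> (\<forall>i<n. f $ i = g $ i)"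

lemma agree_refl [simp]: "agree n f f"
  and agree_sym: "agree n f g \<Longrightarrow> agree n g f"
  and agree_trans: "agree n f g \<Longrightarrow> agree n g h \<Longrightarrow> agree n f h"
  and agree_mono: "agree n f g \<Longrightarrow> m \<le> n \<Longrightarrow> agree m f g"
  by (auto simp: agree_def)

lemma agree_mult:
  fixes f g f' g' :: "'a::comm_ring_1 fps"
  assumes "agree n f f'" "agree n g g'"
  shows "agree n (f * g) (f' * g')"
  using assms by (auto simp: agree_def fps_mult_nth intro!: sum.cong)

lemma agree_power:
  fixes f f' :: "'a::comm_ring_1 fps"
  assumes "agree n f f'"
  shows "agree n (f ^ i) (f' ^ i)"
  by (induction i) (auto intro: agree_mult assms)

lemma agree_compose:
  fixes f g f' g' :: "'a::comm_ring_1 fps"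
  assumes "agree n f f'" "agree n g g'"
  shows "agree n (f oo g) (f' oo g')"
  unfolding agree_def
proof (intro allI impI)
  fix m assume "m < n"
  then show "(f oo g) $ m = (f' oo g') $ m"
    using assms(1) agree_power[OF assms(2)]
    by (auto simp: agree_def fps_compose_nth intro!: sum.cong)
qed

lemma agree_iff_dvd:
  fixes f g :: "'a::comm_ring_1 fps"
  shows "agree n f g \<longleftrightarrow> fps_X ^ n dvd f - g"
proof
  assume ag: "agree n f g"
  have "f - g = fps_X ^ n * fps_shift n (f - g)"
    by (rule fps_ext) (use ag in \<open>auto simp: agree_def fps_X_power_mult_nth\<close>)
  then show "fps_X ^ n dvd f - g" by (metis dvd_triv_left)
next
  assume "fps_X ^ n dvd f - g"
  then obtain q where "f - g = fps_X ^ n * q" by (elim dvdE)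
  then have "(f - g) $ i = 0" if "i < n" for i
    using that by (simp add: fps_X_power_mult_nth)
  then show "agree n f g" by (simp add: agree_def)
qed

section \<open>The group of series tangent to the identity, filtered by depth\<close>

definition tangent :: "nat \<Rightarrow> int fps set" where
  "tangent d = {f. agree (Suc d) f fps_X}"

lemma tangent_nth: "f \<in> tangent d \<longleftrightarrow> (\<forall>i\<le>d. f $ i = (if i = 1 then 1 else 0))"
  by (auto simp: tangent_def agree_def less_Suc_eq_le)

lemma tangent_mono: "f \<in> tangent e \<Longrightarrow> d \<le> e \<Longrightarrow> f \<in> tangent d"
  by (auto simp: tangent_nth)

lemma tangent_0: "f \<in> tangent d \<Longrightarrow> f $ 0 = 0"
  by (simp add: tangent_nth)

lemma tangent_1: "f \<in> tangent d \<Longrightarrow> d > 0 \<Longrightarrow> f $ 1 = 1"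
  by (simp add: tangent_nth)

lemma fps_X_in_tangent [simp]: "fps_X \<in> tangent d"
  by (simp add: tangent_nth)

lemma X_plus_power_in_tangent [simp]: "fps_X + fps_const a * fps_X ^ Suc n \<in> tangent n"
  by (auto simp: tangent_nth fps_X_power_nth simp del: power_Suc)

lemma carrier_J_group: "carrier (J_group (Suc d)) = tangent d"
proof (rule Set.set_eqI)
  fix f :: "int fps"
  have "f \<in> carrier (J_group (Suc d)) \<longleftrightarrow>
      (\<exists>\<alpha>. f = fps_X + Abs_fps (\<lambda>i. if i \<ge> Suc d then \<alpha> i else 0))"
    by (simp add: J_group_def)
  also have "\<dots> \<longleftrightarrow> f \<in> tangent d"
  proof
    assume "f \<in> tangent d"
    then have "f = fps_X + Abs_fps (\<lambda>i. if i \<ge> Suc d then (f - fps_X) $ i else 0)"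
      by (intro fps_ext) (auto simp: tangent_nth)
    then show "\<exists>\<alpha>. f = fps_X + Abs_fps (\<lambda>i. if i \<ge> Suc d then \<alpha> i else 0)"
      by (intro exI)
  qed (auto simp: tangent_nth)
  finally show "f \<in> carrier (J_group (Suc d)) \<longleftrightarrow> f \<in> tangent d" .
qed

lemma mult_J_group [simp]: "monoid.mult (J_group k) = fps_compose"
  and one_J_group [simp]: "\<one>\<^bsub>J_group k\<^esub> = fps_X"
  by (simp_all add: J_group_def)

lemma tangent_compose:
  assumes "f \<in> tangent d" "g \<in> tangent d"
  shows "f oo g \<in> tangent d"
proof -
  have "agree (Suc d) (f oo g) (fps_X oo fps_X)"
    by (rule agree_compose) (use assms in \<open>auto simp: tangent_def\<close>)
  then show ?thesis by (simp add: tangent_def)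
qed

lemma nth_power_tangent:
  assumes "g \<in> tangent d" "d > 0"
  shows "(g ^ n) $ n = 1" "m < n \<Longrightarrow> (g ^ n) $ m = 0"
proof -
  have "g $ 0 = 0" "g $ 1 = 1" using assms by (simp_all only: tangent_0 tangent_1)
  then show "(g ^ n) $ n = 1" "m < n \<Longrightarrow> (g ^ n) $ m = 0"
    by (auto simp: startsby_zero_power_nth_same startsby_zero_power_prefix)
qed

text \<open>Solves \<open>g oo f = fps_X\<close> for one coefficient of \<open>g\<close> after the
  other. The unknown of index \<open>n\<close> is multiplied by \<open>(f ^ n) $ n\<close>, which is
  1 for a tangent series, so no division occurs and the inverse stays integral.\<close>

function left_inverse_nth :: "'a::comm_ring_1 fps \<Rightarrow> nat \<Rightarrow> 'a" where
  "left_inverse_nth f n =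
     (if n = 1 then 1 else 0) - (\<Sum>i<n. left_inverse_nth f i * (f ^ i) $ n)"
  by auto
termination by (relation "measure snd") auto

declare left_inverse_nth.simps [simp del]

lemma left_inverse_compose:
  assumes "f \<in> tangent d" "d > 0"
  shows "Abs_fps (left_inverse_nth f) oo f = fps_X"
proof (rule fps_ext)
  fix n
  have "(Abs_fps (left_inverse_nth f) oo f) $ n =
      (\<Sum>i<n. left_inverse_nth f i * (f ^ i) $ n) + left_inverse_nth f n * (f ^ n) $ n"
    by (simp add: fps_compose_nth atLeast0AtMost lessThan_Suc_atMost[symmetric])
  also have "\<dots> = fps_X $ n"
    by (subst (2) left_inverse_nth.simps) (simp add: nth_power_tangent[OF assms])
  finally show "(Abs_fps (left_inverse_nth f) oo f) $ n = fps_X $ n" .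
qed

lemma left_inverse_tangent:
  assumes "f \<in> tangent d" "d > 0"
  shows "Abs_fps (left_inverse_nth f) \<in> tangent d"
proof -
  let ?g = "Abs_fps (left_inverse_nth f)"
  have "agree (Suc d) (?g oo f) (?g oo fps_X)"
    by (rule agree_compose) (use assms in \<open>auto simp: tangent_def\<close>)
  then show ?thesis
    using left_inverse_compose[OF assms] by (auto simp: tangent_def intro: agree_sym)
qed

lemma group_J_group:
  assumes "d > 0"
  shows "group (J_group (Suc d))"
proof (rule groupI)
  fix f assume f: "f \<in> carrier (J_group (Suc d))"
  then show "\<exists>g\<in>carrier (J_group (Suc d)). g \<otimes>\<^bsub>J_group (Suc d)\<^esub> f = \<one>\<^bsub>J_group (Suc d)\<^esub>"
    using left_inverse_compose[of f d] left_inverse_tangent[of f d] assms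
    by (intro bexI[of _ "Abs_fps (left_inverse_nth f)"]) (simp_all add: carrier_J_group)
qed (auto simp: carrier_J_group tangent_compose fps_compose_assoc tangent_0)

lemma subgroup_tangent:
  assumes "d > 0" "d \<le> e"
  shows "subgroup (tangent e) (J_group (Suc d))"
proof -
  interpret group "J_group (Suc d)" by (rule group_J_group) fact
  show ?thesis
  proof (rule subgroupI)
    fix f assume f: "f \<in> tangent e"
    have "inv\<^bsub>J_group (Suc d)\<^esub> f = Abs_fps (left_inverse_nth f)"
      using assms tangent_mono[OF f] tangent_mono[OF left_inverse_tangent[OF f]]
        left_inverse_compose[OF f]
      by (intro inv_equality) (auto simp: carrier_J_group)
    then show "inv\<^bsub>J_group (Suc d)\<^esub> f \<in> tangent e"
      using left_inverse_tangent[OF f] assms by simp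
  qed (use assms in \<open>auto simp: carrier_J_group tangent_compose intro: tangent_mono fps_X_in_tangent\<close>)
qed

section \<open>Binomial expansions and the first two terms of a commutator\<close>

lemma dvd_one_plus_power:
  fixes z :: "'a::comm_ring_1"
  shows "z\<^sup>2 dvd (1 + z) ^ r - (1 + of_nat r * z)"
    and "z ^ 3 dvd (1 + z) ^ r - (1 + of_nat r * z + of_nat (r choose 2) * z\<^sup>2)"
proof -
  show *: "z\<^sup>2 dvd (1 + z) ^ r - (1 + of_nat r * z)" for r
  proof (induction r)
    case (Suc r)
    have "(1 + z) ^ Suc r - (1 + of_nat (Suc r) * z) =
        (1 + z) * ((1 + z) ^ r - (1 + of_nat r * z)) + of_nat r * z\<^sup>2"
      by (simp add: algebra_simps power2_eq_square)
    then show ?case using Suc by simp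
  qed simp
  show "z ^ 3 dvd (1 + z) ^ r - (1 + of_nat r * z + of_nat (r choose 2) * z\<^sup>2)"
  proof (induction r)
    case (Suc r)
    have "Suc r choose 2 = (r choose 2) + r"
      by (simp add: numeral_2_eq_2)
    then have "(1 + z) ^ Suc r - (1 + of_nat (Suc r) * z + of_nat (Suc r choose 2) * z\<^sup>2) =
        (1 + z) * ((1 + z) ^ r - (1 + of_nat r * z + of_nat (r choose 2) * z\<^sup>2))
        + of_nat (r choose 2) * z ^ 3"
      by (simp add: algebra_simps power2_eq_square power3_eq_cube)
    then show ?case using Suc by simp
  qed (simp add: numeral_2_eq_2)
qed


lemma agree_compose_cancel:
  assumes "agree n (f oo v) (g oo v)" "v \<in> tangent d" "d > 0"
  shows "agree n f g"
proof -
  interpret group "J_group (Suc d)" by (rule group_J_group) fact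
  let ?w = "inv\<^bsub>J_group (Suc d)\<^esub> v"
  have w: "?w \<in> tangent d" "v oo ?w = fps_X"
    using inv_closed[of v] r_inv[of v] assms by (auto simp: carrier_J_group)
  have "agree n ((f oo v) oo ?w) ((g oo v) oo ?w)"
    by (intro agree_compose assms agree_refl)
  then show ?thesis
    using w assms by (simp add: tangent_0 flip: fps_compose_assoc)
qed

lemma monomial_compose:
  fixes g :: "int fps"
  assumes "g $ 0 = 0"
  shows "(fps_const a * fps_X ^ n) oo g = fps_const a * g ^ n"
  using assms by (simp add: fps_compose_mult_distrib flip: fps_compose_power)

text \<open>Checked by substitution instead of inverting series: the candidate and
  \<open>f oo g\<close> are compared after composition with \<open>v = g oo f\<close>, and
  \<open>v\<close> is then cancelled. The neglected terms start at depth \<open>m + 3 * n\<close>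
  (cubic in \<open>b\<close>) and \<open>2 * m + n\<close> (quadratic in \<open>a\<close>), whence
  the minimum. As \<open>0 < n < m\<close>, the term with \<open>q\<close> is still inside the
  precision.\<close>

lemma commutator_expansion:
  fixes a b :: int and m n :: nat and h :: "int fps"
  defines "p \<equiv> a * b * (int m - int n)"
  defines "q \<equiv> a * b\<^sup>2 * int (Suc m choose 2) - p * int (m + n + 1) * b"
  defines "f \<equiv> fps_X + fps_const a * fps_X ^ Suc m"
  defines "g \<equiv> fps_X + fps_const b * fps_X ^ Suc n"
  assumes mn: "0 < n" "n < m"
  assumes h: "h oo (g oo f) = f oo g"
  shows "agree (Suc (m + n + min (2 * n) m)) h
           (fps_X + fps_const p * fps_X ^ Suc (m + n) + fps_const q * fps_X ^ Suc (m + 2 * n))"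
proof -
  define A B P Q :: "int fps"
    where AB: "A = fps_const a" "B = fps_const b" "P = fps_const p" "Q = fps_const q"
  define x u w M :: "int fps"
    where xuw: "x = fps_X" "u = fps_X ^ n" "w = fps_X ^ m" "M = fps_X ^ min (2 * n) m"
  have Mu: "M dvd u\<^sup>2" and Mw: "M dvd w" and uw: "u dvd w"
    using mn by (auto simp: xuw power_mult[symmetric] mult.commute intro!: le_imp_power_dvd)
  have P_eq: "P = A * B * (of_nat m - of_nat n)"
    by (simp add: AB p_def fps_of_nat flip: fps_const_mult fps_const_sub)
  have Q_eq: "Q = A * B\<^sup>2 * of_nat (Suc m choose 2) - P * of_nat (m + n + 1) * B"
    by (simp add: AB q_def fps_of_nat power2_eq_square flip: fps_const_mult fps_const_sub fps_const_add)
  have f: "f = x + A * (x * w)" and g: "g = x + B * (x * u)"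
    by (simp_all add: f_def g_def AB xuw)
  have fm: "f \<in> tangent m" and gn: "g \<in> tangent n"
    unfolding f_def g_def by (rule X_plus_power_in_tangent)+
  have f1: "f \<in> tangent 1" and g1: "g \<in> tangent 1"
    using mn by (auto intro: tangent_mono[OF fm] tangent_mono[OF gn])
  define v where "v = g oo f"
  have v1: "v \<in> tangent 1" unfolding v_def by (rule tangent_compose[OF g1 f1])
  define h0 where "h0 = fps_X + P * fps_X ^ Suc (m + n) + Q * fps_X ^ Suc (m + 2 * n)"
  have fg: "f oo g = x * (1 + B * u) + A * (x * w) * (1 + B * u) ^ Suc m"
  proof -
    have "f oo g = g + A * g ^ Suc m"
      unfolding f_def AB using g1
      by (simp only: fps_compose_add_distrib monomial_compose tangent_0 fps_X_fps_compose_startby0)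
    moreover have g': "g = x * (1 + B * u)" by (simp add: g algebra_simps)
    moreover have "g ^ Suc m = x * w * (1 + B * u) ^ Suc m"
      unfolding g' power_mult_distrib by (simp add: xuw)
    ultimately show ?thesis by (metis mult.assoc)
  qed
  define y where "y = A * w + B * u * (1 + A * w) ^ Suc n"
  have v: "v = x * (1 + y)"
  proof -
    have "v = f + B * f ^ Suc n"
      unfolding v_def g_def AB using f1
      by (simp only: fps_compose_add_distrib monomial_compose tangent_0 fps_X_fps_compose_startby0)
    moreover have f': "f = x * (1 + A * w)" by (simp add: f algebra_simps)
    moreover have "f ^ Suc n = x * u * (1 + A * w) ^ Suc n"
      unfolding f' power_mult_distrib by (simp add: xuw)
    ultimately have "v = x * (1 + A * w) + B * (x * u * (1 + A * w) ^ Suc n)" by metis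
    then show ?thesis by (simp add: y_def algebra_simps)
  qed
  have h0v: "h0 oo v = v + P * (x * w * u) * (1 + y) ^ Suc (m + n)
      + Q * (x * w * u\<^sup>2) * (1 + y) ^ Suc (m + 2 * n)"
  proof -
    have "h0 oo v = v + P * v ^ Suc (m + n) + Q * v ^ Suc (m + 2 * n)"
      unfolding h0_def AB using v1
      by (simp only: fps_compose_add_distrib monomial_compose tangent_0 fps_X_fps_compose_startby0)
    moreover have "v ^ Suc (m + n) = x * w * u * (1 + y) ^ Suc (m + n)"
      unfolding v power_mult_distrib by (simp add: xuw power_add)
    moreover have "v ^ Suc (m + 2 * n) = x * w * u\<^sup>2 * (1 + y) ^ Suc (m + 2 * n)"
      unfolding v power_mult_distrib
      by (simp add: xuw power_add power_mult[symmetric] mult.commute[of 2 n])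
    ultimately show ?thesis by (simp add: mult.assoc)
  qed
  \<comment> \<open>Computation modulo \<open>E\<close>: \<open>R1\<close> to \<open>R4\<close> are
    binomial remainders, and each occurs with a prefactor that turns it into a multiple of
    \<open>E\<close>.\<close>
  define E where "E = x * w * u * M"
  define R1 where "R1 = (1 + B * u) ^ Suc m
      - (1 + of_nat (Suc m) * (B * u) + of_nat (Suc m choose 2) * (B * u)\<^sup>2)"
  define R2 where "R2 = (1 + A * w) ^ Suc n - (1 + of_nat (Suc n) * (A * w))"
  define R3 where "R3 = (1 + y) ^ Suc (m + n) - (1 + of_nat (Suc (m + n)) * (B * u))"
  define R4 where "R4 = (1 + y) ^ Suc (m + 2 * n) - 1"
  have E1: "E dvd x * w * R1"
  proof -
    have "(B * u) ^ 3 dvd R1" unfolding R1_def by (rule dvd_one_plus_power)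
    then have "u * u\<^sup>2 dvd R1" by (auto simp: power_mult_distrib power2_eq_square power3_eq_cube
          intro: dvd_trans[rotated])
    then have "u * M dvd R1" using Mu by (meson dvd_trans mult_dvd_mono dvd_refl)
    then show ?thesis by (simp add: E_def mult.assoc mult_dvd_mono)
  qed
  have E2: "E dvd x * u * R2"
  proof -
    have "(A * w)\<^sup>2 dvd R2" unfolding R2_def by (rule dvd_one_plus_power)
    then have "w * w dvd R2" by (auto simp: power_mult_distrib power2_eq_square
          intro: dvd_trans[rotated])
    then have "w * M dvd R2" using Mw by (meson dvd_trans mult_dvd_mono dvd_refl)
    then have "x * u * (w * M) dvd x * u * R2" by (intro mult_dvd_mono dvd_refl)
    then show ?thesis by (simp add: E_def ac_simps)
  qed
  have yBu: "M dvd y - B * u"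
  proof -
    have "w dvd (1 + A * w) ^ Suc n - 1"
    proof -
      have "A * w dvd (1 + A * w) ^ Suc n - 1"
        using power_diff_1_eq[of "1 + A * w" "Suc n"] by simp
      then show ?thesis by (rule dvd_trans[rotated]) simp
    qed
    then have "w dvd A * w + B * u * ((1 + A * w) ^ Suc n - 1)" by simp
    also have "\<dots> = y - B * u" by (simp add: y_def algebra_simps)
    finally show ?thesis using Mw dvd_trans by blast
  qed
  have uy: "u dvd y" unfolding y_def using uw by (auto intro!: dvd_add intro: dvd_mult dvd_mult2)
  have E3: "E dvd x * w * u * R3"
  proof -
    have "y\<^sup>2 dvd (1 + y) ^ Suc (m + n) - (1 + of_nat (Suc (m + n)) * y)"
      by (rule dvd_one_plus_power)
    moreover have "M dvd y\<^sup>2"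
      using Mu uy by (meson dvd_trans dvd_power_same)
    ultimately have "M dvd (1 + y) ^ Suc (m + n) - (1 + of_nat (Suc (m + n)) * y)"
      using dvd_trans by blast
    moreover have "M dvd of_nat (Suc (m + n)) * (y - B * u)" using yBu by simp
    ultimately have "M dvd (1 + y) ^ Suc (m + n) - (1 + of_nat (Suc (m + n)) * y)
        + of_nat (Suc (m + n)) * (y - B * u)" by (rule dvd_add)
    also have "\<dots> = R3" unfolding R3_def by (simp only: algebra_simps)
    finally show ?thesis by (simp add: E_def mult_dvd_mono)
  qed
  have E4: "E dvd x * w * u\<^sup>2 * R4"
  proof -
    have "y dvd R4"
      using power_diff_1_eq[of "1 + y" "Suc (m + 2 * n)"] by (simp add: R4_def)
    then have "x * w * u\<^sup>2 * u dvd x * w * u\<^sup>2 * R4"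
      using uy by (intro mult_dvd_mono) (auto intro: dvd_trans)
    moreover have "E dvd x * w * u\<^sup>2 * u"
      using mult_dvd_mono[OF dvd_refl Mu, of "x * w * u"] by (simp add: E_def ac_simps)
    ultimately show ?thesis using dvd_trans by blast
  qed
  have e1: "(1 + B * u) ^ Suc m
      = 1 + of_nat (Suc m) * (B * u) + of_nat (Suc m choose 2) * (B * u)\<^sup>2 + R1"
    and e3: "(1 + y) ^ Suc (m + n) = 1 + of_nat (Suc (m + n)) * (B * u) + R3"
    and e4: "(1 + y) ^ Suc (m + 2 * n) = 1 + R4"
    by (simp_all add: R1_def R3_def R4_def)
  have ey: "v = x * (1 + (A * w + B * u * (1 + of_nat (Suc n) * (A * w) + R2)))"
    by (simp add: v y_def R2_def)
  \<comment> \<open>The values of \<open>p\<close> and \<open>q\<close> are forced by this line: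
    with them everything outside the remainders cancels.\<close>
  have "(f oo g) - (h0 oo v) = A * (x * w * R1) - B * (x * u * R2) - P * (x * w * u * R3)
      - Q * (x * w * u\<^sup>2 * R4)"
    unfolding fg h0v unfolding e1 e3 e4 ey Q_eq P_eq
    by (simp add: algebra_simps power2_eq_square)
  also have "E dvd \<dots>" by (intro dvd_diff dvd_mult[OF E1] dvd_mult[OF E2] dvd_mult[OF E3] dvd_mult[OF E4])
  finally have "agree (Suc (m + n + min (2 * n) m)) (f oo g) (h0 oo v)"
    by (simp add: agree_iff_dvd E_def xuw power_add mult.assoc mult.left_commute)
  then have "agree (Suc (m + n + min (2 * n) m)) (h oo v) (h0 oo v)"
    by (simp only: v_def h)
  then have "agree (Suc (m + n + min (2 * n) m)) h h0"
    using v1 by (rule agree_compose_cancel) simp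
  then show ?thesis by (simp only: h0_def AB)
qed


section \<open>Coefficients of powers and composites to low order\<close>

lemma tangent_factor:
  assumes "g \<in> tangent d" "d > 0"
  obtains z where "g = fps_X * (1 + z)" "fps_X ^ d dvd z" "\<And>e. e > 0 \<Longrightarrow> z $ e = g $ Suc e"
proof
  let ?z = "fps_shift 1 g - 1"
  show "g = fps_X * (1 + ?z)"
    using assms by (intro fps_ext) (auto simp: fps_X_mult_nth tangent_0)
  have "agree d ?z 0"
    using assms by (auto simp: agree_def tangent_nth)
  then show "fps_X ^ d dvd ?z" by (simp add: agree_iff_dvd)
  show "?z $ e = g $ Suc e" if "e > 0" for e using that by simp
qed

text \<open>In \<open>g = x (1 + z)\<close> the square of \<open>z\<close> has order at least
  \<open>2 * d\<close>, so only the linear term of the binomial expansion reaches depth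
  \<open>e\<close>.\<close>

lemma nth_power_first_order:
  assumes "g \<in> tangent d" "0 < e" "e < 2 * d"
  shows "(g ^ i) $ (i + e) = int i * g $ Suc e"
proof -
  have "d > 0" using assms by simp
  obtain z where z: "g = fps_X * (1 + z)" "fps_X ^ d dvd z" "\<And>e. e > 0 \<Longrightarrow> z $ e = g $ Suc e"
    using tangent_factor[OF assms(1) \<open>d > 0\<close>] by metis
  have "fps_X ^ (2 * d) dvd (1 + z) ^ i - (1 + of_nat i * z)"
    using dvd_trans[OF dvd_power_same[OF z(2), of 2] dvd_one_plus_power(1)]
    by (simp add: power_mult mult.commute flip: power_mult)
  then have "((1 + z) ^ i) $ e = (1 + of_nat i * z) $ e"
    using assms by (simp add: agree_def flip: agree_iff_dvd)
  moreover have "(g ^ i) $ (i + e) = ((1 + z) ^ i) $ e"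
    by (simp add: z(1) power_mult_distrib fps_X_power_mult_nth)
  ultimately show ?thesis using z(3) assms by (simp add: fps_of_nat[symmetric])
qed

lemma nth_power_second_order:
  assumes "g \<in> tangent d" "0 < e" "e < 3 * d"
  shows "(g ^ i) $ (i + e) = int i * g $ Suc e
      + int (i choose 2) * (\<Sum>j=d..e-d. g $ Suc j * g $ Suc (e - j))"
proof -
  have "d > 0" using assms by simp
  obtain z where z: "g = fps_X * (1 + z)" "fps_X ^ d dvd z" "\<And>e. e > 0 \<Longrightarrow> z $ e = g $ Suc e"
    using tangent_factor[OF assms(1) \<open>d > 0\<close>] by metis
  have z0: "z $ j = 0" if "j < d" for j
    using z(2) that agree_iff_dvd[of d z 0] by (simp add: agree_def)
  have "fps_X ^ (3 * d) dvd (1 + z) ^ i - (1 + of_nat i * z + of_nat (i choose 2) * z\<^sup>2)"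
    using dvd_trans[OF dvd_power_same[OF z(2), of 3] dvd_one_plus_power(2)]
    by (simp add: power_mult mult.commute flip: power_mult)
  then have "((1 + z) ^ i) $ e = (1 + of_nat i * z + of_nat (i choose 2) * z\<^sup>2) $ e"
    using assms by (simp add: agree_def flip: agree_iff_dvd)
  moreover have "(g ^ i) $ (i + e) = ((1 + z) ^ i) $ e"
    by (simp add: z(1) power_mult_distrib fps_X_power_mult_nth)
  moreover have "(z\<^sup>2) $ e = (\<Sum>j=d..e-d. g $ Suc j * g $ Suc (e - j))"
  proof -
    have "(z\<^sup>2) $ e = (\<Sum>j=0..e. z $ j * z $ (e - j))"
      by (simp add: power2_eq_square fps_mult_nth)
    also have "\<dots> = (\<Sum>j=d..e-d. g $ Suc j * g $ Suc (e - j))"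
      using z0 \<open>d > 0\<close> assms(2)
      by (intro sum.mono_neutral_cong_right) (auto simp: z(3))
    finally show ?thesis .
  qed
  ultimately show ?thesis using z(3) assms by (simp add: fps_of_nat[symmetric])
qed

lemma nth_compose_tangent:
  assumes "f \<in> tangent d" "g \<in> tangent d" "d > 0" "N > 0"
  shows "(f oo g) $ Suc N = f $ Suc N + g $ Suc N
      + (\<Sum>i=d..N-1. f $ Suc i * (g ^ Suc i) $ Suc N)"
proof -
  let ?T = "\<lambda>i. f $ Suc i * (g ^ Suc i) $ Suc N"
  have "(f oo g) $ Suc N = (\<Sum>i=0..N. ?T i)"
    using assms by (subst fps_compose_nth, subst sum.atLeast0_atMost_Suc_shift)
      (simp add: tangent_0 del: power_Suc)
  also have "\<dots> = ?T 0 + (\<Sum>i=1..N-1. ?T i) + ?T N"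
  proof -
    have "{0..N} = insert 0 (insert N {1..N-1})" using assms by auto
    then show ?thesis using assms by simp
  qed
  also have "(\<Sum>i=1..N-1. ?T i) = (\<Sum>i=d..N-1. ?T i)"
    using assms by (intro sum.mono_neutral_right) (auto simp: tangent_nth)
  also have "?T 0 = g $ Suc N" using tangent_1[OF assms(1,3)] by simp
  also have "?T N = f $ Suc N" using nth_power_tangent(1)[OF assms(2,3), of "Suc N"] by simp
  finally show ?thesis by simp
qed

text \<open>Below depth \<open>3 * d\<close> composition is addition plus a bilinear term: a
  coefficient of \<open>f\<close> beyond the first uses up depth at least \<open>d\<close>, which
  leaves less than \<open>2 * d\<close> for the power of \<open>g\<close>, so only its first order
  is visible.\<close>

lemma nth_compose_quadratic:
  assumes "f \<in> tangent d" "g \<in> tangent d" "0 < N" "N < 3 * d"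
  shows "(f oo g) $ Suc N = f $ Suc N + g $ Suc N
      + (\<Sum>i=d..N-d. int (Suc i) * f $ Suc i * g $ Suc (N - i))"
proof -
  have d: "d > 0" using assms by simp
  have *: "(g ^ Suc i) $ Suc N = int (Suc i) * g $ Suc (N - i)" if "d \<le> i" "i < N" for i
    using nth_power_first_order[OF assms(2), of "N - i" "Suc i"] that assms by simp
  have "(\<Sum>i=d..N-1. f $ Suc i * (g ^ Suc i) $ Suc N)
      = (\<Sum>i=d..N-d. int (Suc i) * f $ Suc i * g $ Suc (N - i))"
  proof (rule sum.mono_neutral_cong_right)
    show "\<forall>i\<in>{d..N-1} - {d..N-d}. f $ Suc i * (g ^ Suc i) $ Suc N = 0"
    proof
      fix i assume i: "i \<in> {d..N-1} - {d..N-d}"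
      then have "i < N" "d \<le> i" "Suc (N - i) \<le> d" using assms d by auto
      then have "g $ Suc (N - i) = 0" using assms by (simp add: tangent_nth)
      then show "f $ Suc i * (g ^ Suc i) $ Suc N = 0"
        using * \<open>i < N\<close> \<open>d \<le> i\<close> by simp
    qed
  qed (use d assms in \<open>auto simp: * simp del: power_Suc\<close>)
  then show ?thesis using nth_compose_tangent[OF assms(1,2) d assms(3)] by simp
qed

lemma nth_compose_additive:
  assumes "f \<in> tangent d" "g \<in> tangent d" "0 < N" "N < 2 * d"
  shows "(f oo g) $ Suc N = f $ Suc N + g $ Suc N"
  using nth_compose_quadratic[OF assms(1-3)] assms(4) by simp


section \<open>Leading coefficients of products of commutators\<close>

abbreviation J_derived :: "nat \<Rightarrow> int fps set" where
  "J_derived d \<equiv> derived (J_group (Suc d)) (carrier (J_group (Suc d)))"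

lemma J_derived_subset:
  assumes "d > 0"
  shows "J_derived d \<subseteq> tangent d"
  using group.derived_in_carrier[OF group_J_group[OF assms] order_refl]
  by (simp add: carrier_J_group)

lemma J_derived_compose:
  assumes "d > 0" "f \<in> J_derived d" "g \<in> J_derived d"
  shows "f oo g \<in> J_derived d"
  using subgroup.m_closed[OF group.derived_is_subgroup[OF group_J_group[OF assms(1)] order_refl]] assms
  by simp

lemma (in group) commutator_mult:
  assumes "f \<in> carrier G" "g \<in> carrier G"
  shows "f \<otimes> g \<otimes> inv f \<otimes> inv g \<otimes> (g \<otimes> f) = f \<otimes> g"
proof -
  have "f \<otimes> g \<otimes> inv f \<otimes> inv g \<otimes> (g \<otimes> f) = f \<otimes> g \<otimes> (inv f \<otimes> (inv g \<otimes> g) \<otimes> f)"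
    using assms by (simp only: m_assoc m_closed inv_closed)
  then show ?thesis using assms by (simp only: l_inv r_one m_closed inv_closed)
qed

text \<open>Recording a commutator by this equation keeps inverse series out of all coefficient
  computations.\<close>

lemma J_commutator_of:
  assumes "d > 0" "f \<in> tangent d" "g \<in> tangent d"
  obtains h where "h \<in> J_derived d" "h oo (g oo f) = f oo g"
proof
  interpret group "J_group (Suc d)" by (rule group_J_group) fact
  let ?G = "J_group (Suc d)"
  let ?h = "f \<otimes>\<^bsub>?G\<^esub> g \<otimes>\<^bsub>?G\<^esub> inv\<^bsub>?G\<^esub> f \<otimes>\<^bsub>?G\<^esub> inv\<^bsub>?G\<^esub> g"
  have fg: "f \<in> carrier ?G" "g \<in> carrier ?G" using assms by (simp_all add: carrier_J_group)
  then show "?h \<in> J_derived d"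
    unfolding derived_def by (intro generate.incl) blast
  show "?h oo (g oo f) = f oo g" using commutator_mult[OF fg] by simp
qed

text \<open>One free parameter suffices, as the leading coefficient is linear in \<open>a\<close>.
  The coefficient at depth \<open>m + 2 * n\<close> is recorded too: for even \<open>m + n\<close>
  it can be odd although the leading one is always even.\<close>

lemma commutator_nth:
  fixes a :: int
  defines "p m n \<equiv> a * (int m - int n)"
  assumes "0 < d" "d \<le> n" "n < m"
  obtains h where "h \<in> J_derived d" "h \<in> tangent (m + n)" "h $ Suc (m + n) = p m n"
    "h $ Suc (m + 2 * n) = a * int (Suc m choose 2) - p m n * int (m + n + 1)"
    "\<And>e. m + n < e \<Longrightarrow> e < m + n + min (2 * n) m \<Longrightarrow> e \<noteq> m + 2 * n \<Longrightarrow> h $ Suc e = 0"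
proof -
  let ?f = "fps_X + fps_const a * fps_X ^ Suc m" and ?g = "fps_X + fps_const 1 * fps_X ^ Suc n"
  have fg: "?f \<in> tangent d" "?g \<in> tangent d"
    using assms by (auto intro: tangent_mono[OF X_plus_power_in_tangent] simp del: power_Suc fps_const_1_eq_1)
  obtain h where h: "h \<in> J_derived d" "h oo (?g oo ?f) = ?f oo ?g"
    using J_commutator_of[OF assms(2) fg] by metis
  define q where "q = a * int (Suc m choose 2) - p m n * int (m + n + 1)"
  have ag: "agree (Suc (m + n + min (2 * n) m)) h
      (fps_X + fps_const (p m n) * fps_X ^ Suc (m + n) + fps_const q * fps_X ^ Suc (m + 2 * n))"
    using commutator_expansion[OF _ _ h(2)] assms by (simp add: p_def q_def)
  have nth: "h $ i = (if i = 1 then 1 else 0) + (if i = Suc (m + n) then p m n else 0)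
      + (if i = Suc (m + 2 * n) then q else 0)" if "i < Suc (m + n + min (2 * n) m)" for i
    using ag that by (auto simp: agree_def fps_X_power_nth simp del: power_Suc)
  show thesis
  proof (rule that[OF h(1)])
    show "h \<in> tangent (m + n)" using assms by (auto simp: tangent_nth nth)
  qed (use assms in \<open>auto simp: nth q_def\<close>)
qed

lemma tangentI:
  assumes "f \<in> tangent d" "0 < d" "\<And>e. 0 < e \<Longrightarrow> e < N \<Longrightarrow> f $ Suc e = 0"
  shows "f \<in> tangent N"
  unfolding tangent_nth
proof (intro allI impI)
  fix i assume "i \<le> N"
  then show "f $ i = (if i = 1 then 1 else 0)"
    using assms tangent_0[OF assms(1)] tangent_1[OF assms(1,2)]
    by (cases i; cases "i - 1") auto
qed

text \<open>Depths differing by 1 give an arbitrary leading coefficient. The vanishing up to the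
  second term, at depth \<open>3 * n + 1\<close>, lets such an element cancel one coefficient and
  leave the following ones alone.\<close>

lemma derived_leading_odd:
  assumes "0 < d" "d \<le> n"
  obtains h where "h \<in> J_derived d" "h \<in> tangent (2 * n + 1)" "h $ Suc (2 * n + 1) = c"
    "\<And>e. 2 * n + 1 < e \<Longrightarrow> e < 3 * n + 1 \<Longrightarrow> h $ Suc e = 0"
proof -
  have n: "n < n + 1" by simp
  have idx: "n + 1 + n = 2 * n + 1" by simp
  obtain h where h: "h \<in> J_derived d" "h \<in> tangent (n + 1 + n)"
    "h $ Suc (n + 1 + n) = c * (int (n + 1) - int n)"
    "h $ Suc (n + 1 + 2 * n) = c * int (Suc (n + 1) choose 2)
       - c * (int (n + 1) - int n) * int (n + 1 + n + 1)"
    "\<And>e. n + 1 + n < e \<Longrightarrow> e < n + 1 + n + min (2 * n) (n + 1) \<Longrightarrow> e \<noteq> n + 1 + 2 * n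
      \<Longrightarrow> h $ Suc e = 0"
    using commutator_nth[OF assms n, of c] by blast
  show thesis
  proof (rule that[OF h(1)])
    show "h $ Suc e = 0" if "2 * n + 1 < e" "e < 3 * n + 1" for e
      by (rule h(5)) (use that in auto)
  qed (use h(2,3)[unfolded idx] in simp_all)
qed

text \<open>The depths \<open>n + 2\<close> and \<open>n\<close> multiply the parameter by 2, the
  smallest factor possible at an even total depth; hence the parameter
  \<open>c div 2\<close>.\<close>

lemma derived_leading_even:
  assumes "0 < d" "d \<le> n" "even c"
  obtains h where "h \<in> J_derived d" "h \<in> tangent (2 * n + 2)" "h $ Suc (2 * n + 2) = c"
    "\<And>e. 2 * n + 2 < e \<Longrightarrow> e < 3 * n + 2 \<Longrightarrow> e < 4 * n + 2 \<Longrightarrow> h $ Suc e = 0"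
proof -
  have n: "n < n + 2" by simp
  have idx: "n + 2 + n = 2 * n + 2" by simp
  obtain h where h: "h \<in> J_derived d" "h \<in> tangent (n + 2 + n)"
    "h $ Suc (n + 2 + n) = c div 2 * (int (n + 2) - int n)"
    "h $ Suc (n + 2 + 2 * n) = c div 2 * int (Suc (n + 2) choose 2)
       - c div 2 * (int (n + 2) - int n) * int (n + 2 + n + 1)"
    "\<And>e. n + 2 + n < e \<Longrightarrow> e < n + 2 + n + min (2 * n) (n + 2) \<Longrightarrow> e \<noteq> n + 2 + 2 * n
      \<Longrightarrow> h $ Suc e = 0"
    using commutator_nth[OF assms(1,2) n, of "c div 2"] by blast
  show thesis
  proof (rule that[OF h(1)])
    show "h $ Suc e = 0" if "2 * n + 2 < e" "e < 3 * n + 2" "e < 4 * n + 2" for e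
      by (rule h(5)) (use that in auto)
  qed (use h(2,3)[unfolded idx] assms(3) in simp_all)
qed

lemma derived_leading_any:
  assumes "0 < d" "d \<le> n" "N = 2 * n + 2"
    and "\<exists>h\<in>J_derived d. h \<in> tangent N \<and> odd (h $ Suc N)"
  shows "\<exists>h\<in>J_derived d. h \<in> tangent N \<and> h $ Suc N = c"
proof (cases "even c")
  case True
  then show ?thesis using derived_leading_even[OF assms(1,2)] assms(3) by metis
next
  case False
  obtain h where h: "h \<in> J_derived d" "h \<in> tangent N" "odd (h $ Suc N)" using assms by blast
  then have "even (c - h $ Suc N)" using False by simp
  then obtain g where g: "g \<in> J_derived d" "g \<in> tangent N" "g $ Suc N = c - h $ Suc N"
    using derived_leading_even[OF assms(1,2)] assms(3) by metis
  have "(h oo g) $ Suc N = c" using nth_compose_additive[OF h(2) g(2), of N] g assms by simp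
  then show ?thesis
    using J_derived_compose[OF assms(1) h(1) g(1)] tangent_compose[OF h(2) g(2)] by blast
qed

lemma odd_choose_two: "int (Suc (2 * l) choose 2) = int l * (2 * int l + 1)"
  by (induction l) (simp_all add: numeral_2_eq_2 algebra_simps)

text \<open>Take depths \<open>2 * l\<close> and \<open>2 * i\<close>. The leading term is even, so
  \<open>derived_leading_even\<close> removes it; what appears is the second coefficient, at depth
  \<open>2 * l + 4 * i = N\<close>, which is \<open>l\<close> modulo 2. The condition
  \<open>i + 2 \<le> l\<close> pushes the second term of the correcting element beyond
  \<open>N\<close>.\<close>

lemma derived_odd_at_2_mod_4:
  assumes "0 < d" "d \<le> 2 * i" "odd l" "i + 2 \<le> l" "N = 4 * i + 2 * l"
  shows "\<exists>h\<in>J_derived d. h \<in> tangent N \<and> odd (h $ Suc N)"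
proof -
  have i: "0 < i" using assms by simp
  have c1: "2 * i < 2 * l" using assms by simp
  obtain f where f: "f \<in> J_derived d" "f \<in> tangent (2 * l + 2 * i)"
    "f $ Suc (2 * l + 2 * i) = 1 * (int (2 * l) - int (2 * i))"
    "f $ Suc (2 * l + 2 * (2 * i)) = 1 * int (Suc (2 * l) choose 2)
       - 1 * (int (2 * l) - int (2 * i)) * int (2 * l + 2 * i + 1)"
    "\<And>e. 2 * l + 2 * i < e \<Longrightarrow> e < 2 * l + 2 * i + min (2 * (2 * i)) (2 * l)
       \<Longrightarrow> e \<noteq> 2 * l + 2 * (2 * i) \<Longrightarrow> f $ Suc e = 0"
    using commutator_nth[OF assms(1,2) c1, of 1] by blast
  have c2: "d \<le> l + i - 1" "even (- 2 * (int l - int i))" using assms by auto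
  obtain g where g: "g \<in> J_derived d" "g \<in> tangent (2 * (l + i - 1) + 2)"
    "g $ Suc (2 * (l + i - 1) + 2) = - 2 * (int l - int i)"
    "\<And>e. 2 * (l + i - 1) + 2 < e \<Longrightarrow> e < 3 * (l + i - 1) + 2 \<Longrightarrow> e < 4 * (l + i - 1) + 2
      \<Longrightarrow> g $ Suc e = 0"
    using derived_leading_even[OF assms(1) c2] by blast
  have idx: "2 * (l + i - 1) + 2 = 2 * l + 2 * i" using i by simp
  note f' = f(2) and g' = g(2)[unfolded idx]
  have add: "(f oo g) $ Suc e = f $ Suc e + g $ Suc e" if "0 < e" "e \<le> N" for e
    using nth_compose_additive[OF f' g' that(1)] that(2) assms by simp
  have z: "f $ Suc e + g $ Suc e = 0" if "0 < e" "e < N" for e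
  proof -
    consider "e < 2 * l + 2 * i" | "e = 2 * l + 2 * i" | "2 * l + 2 * i < e" by linarith
    then show ?thesis
    proof cases
      case 1 then show ?thesis using f' g' that by (simp add: tangent_nth)
    next
      case 2 then show ?thesis using f(3) g(3)[unfolded idx] by simp
    next
      case 3
      have "f $ Suc e = 0" by (rule f(5)) (use 3 that assms(4,5) i in auto)
      moreover have "g $ Suc e = 0" by (rule g(4)) (use 3 that assms(4,5) i in auto)
      ultimately show ?thesis by simp
    qed
  qed
  have "f oo g \<in> tangent N"
    using tangentI[OF tangent_compose[OF f' g']] add z i by simp
  moreover have "odd ((f oo g) $ Suc N)"
  proof -
    have "g $ Suc N = 0" by (rule g(4)) (use assms(4,5) i in auto)
    moreover have "2 * l + 2 * (2 * i) = N" using assms by simp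
    then have "f $ Suc N = int l * (2 * int l + 1)
        - (2 * int l - 2 * int i) * (2 * int l + 2 * int i + 1)"
      using f(4)[unfolded odd_choose_two] by simp
    then have "odd (f $ Suc N)" using assms(3) by simp
    ultimately show ?thesis using add[of N] assms i by simp
  qed
  ultimately show ?thesis using J_derived_compose[OF assms(1) f(1) g(1)] by blast
qed

text \<open>The same device with depths \<open>2 * i\<close> and \<open>2 * s + 1\<close>: the
  leading term now has odd depth and can be removed whatever its coefficient. The second coefficient
  is \<open>i\<close> modulo 2 because the factor \<open>m + n + 1\<close> is even here.\<close>

lemma derived_odd_at_0_mod_4:
  assumes "0 < d" "d \<le> 2 * s + 1" "odd i" "s + 2 \<le> i" "N = 2 * i + 4 * s + 2"
  shows "\<exists>h\<in>J_derived d. h \<in> tangent N \<and> odd (h $ Suc N)"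
proof -
  have c1: "2 * s + 1 < 2 * i" using assms by simp
  obtain f where f: "f \<in> J_derived d" "f \<in> tangent (2 * i + (2 * s + 1))"
    "f $ Suc (2 * i + (2 * s + 1)) = 1 * (int (2 * i) - int (2 * s + 1))"
    "f $ Suc (2 * i + 2 * (2 * s + 1)) = 1 * int (Suc (2 * i) choose 2)
       - 1 * (int (2 * i) - int (2 * s + 1)) * int (2 * i + (2 * s + 1) + 1)"
    "\<And>e. 2 * i + (2 * s + 1) < e \<Longrightarrow> e < 2 * i + (2 * s + 1) + min (2 * (2 * s + 1)) (2 * i)
       \<Longrightarrow> e \<noteq> 2 * i + 2 * (2 * s + 1) \<Longrightarrow> f $ Suc e = 0"
    using commutator_nth[OF assms(1,2) c1, of 1] by blast
  have c2: "d \<le> i + s" using assms by auto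
  obtain g where g: "g \<in> J_derived d" "g \<in> tangent (2 * (i + s) + 1)"
    "g $ Suc (2 * (i + s) + 1) = - (2 * int i - 2 * int s - 1)"
    "\<And>e. 2 * (i + s) + 1 < e \<Longrightarrow> e < 3 * (i + s) + 1 \<Longrightarrow> g $ Suc e = 0"
    using derived_leading_odd[OF assms(1) c2] by blast
  have idx: "2 * (i + s) + 1 = 2 * i + (2 * s + 1)" by simp
  note f' = f(2) and g' = g(2)[unfolded idx]
  have add: "(f oo g) $ Suc e = f $ Suc e + g $ Suc e" if "0 < e" "e \<le> N" for e
    using nth_compose_additive[OF f' g' that(1)] that(2) assms by simp
  have z: "f $ Suc e + g $ Suc e = 0" if "0 < e" "e < N" for e
  proof -
    consider "e < 2 * i + (2 * s + 1)" | "e = 2 * i + (2 * s + 1)" | "2 * i + (2 * s + 1) < e"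
      by linarith
    then show ?thesis
    proof cases
      case 1 then show ?thesis using f' g' that by (simp add: tangent_nth)
    next
      case 2 then show ?thesis using f(3) g(3)[unfolded idx] by simp
    next
      case 3
      have "f $ Suc e = 0" by (rule f(5)) (use 3 that assms(4,5) in auto)
      moreover have "g $ Suc e = 0" by (rule g(4)) (use 3 that assms(4,5) in auto)
      ultimately show ?thesis by simp
    qed
  qed
  have "f oo g \<in> tangent N"
    using tangentI[OF tangent_compose[OF f' g']] add z by simp
  moreover have "odd ((f oo g) $ Suc N)"
  proof -
    have "g $ Suc N = 0" by (rule g(4)) (use assms(4,5) in auto)
    moreover have "2 * i + 2 * (2 * s + 1) = N" using assms by simp
    then have "f $ Suc N = int i * (2 * int i + 1)
        - (2 * int i - (1 + 2 * int s)) * (2 + (2 * int i + 2 * int s))"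
      using f(4)[unfolded odd_choose_two] by simp
    then have "odd (f $ Suc N)" using assms(3) by simp
    ultimately show ?thesis using add[of N] assms by simp
  qed
  ultimately show ?thesis using J_derived_compose[OF assms(1) f(1) g(1)] by blast
qed

text \<open>The two-term device would need the depths \<open>2 * j + 2\<close> and
  \<open>2 * j + 1\<close>, but a commutator of the same two depths used to cancel its leading term
  at \<open>4 * j + 3\<close> would undo the second term as well. So the pair
  \<open>2 * j + 3\<close>, \<open>2 * j\<close> does the cancelling; its leading factor is 3, which
  explains the parameter 3 of \<open>f\<close>.\<close>

lemma derived_odd_at_3d_plus_4:
  assumes "0 < j" "even j" "N = 6 * j + 4"
  shows "\<exists>h\<in>J_derived (2 * j). h \<in> tangent N \<and> odd (h $ Suc N)"
proof -
  have d: "0 < 2 * j" using assms by simp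
  have c1: "2 * j \<le> 2 * j + 1" "2 * j + 1 < 2 * j + 2" by auto
  obtain f where f: "f \<in> J_derived (2 * j)" "f \<in> tangent ((2 * j + 2) + (2 * j + 1))"
    "f $ Suc ((2 * j + 2) + (2 * j + 1)) = 3 * (int (2 * j + 2) - int (2 * j + 1))"
    "f $ Suc ((2 * j + 2) + 2 * (2 * j + 1)) = 3 * int (Suc (2 * j + 2) choose 2)
       - 3 * (int (2 * j + 2) - int (2 * j + 1)) * int ((2 * j + 2) + (2 * j + 1) + 1)"
    "\<And>e. (2 * j + 2) + (2 * j + 1) < e
       \<Longrightarrow> e < (2 * j + 2) + (2 * j + 1) + min (2 * (2 * j + 1)) (2 * j + 2)
       \<Longrightarrow> e \<noteq> (2 * j + 2) + 2 * (2 * j + 1) \<Longrightarrow> f $ Suc e = 0"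
    using commutator_nth[OF d c1, of 3] by blast
  have c2: "2 * j \<le> 2 * j" "2 * j < 2 * j + 3" by auto
  obtain g where g: "g \<in> J_derived (2 * j)" "g \<in> tangent ((2 * j + 3) + 2 * j)"
    "g $ Suc ((2 * j + 3) + 2 * j) = -1 * (int (2 * j + 3) - int (2 * j))"
    "g $ Suc ((2 * j + 3) + 2 * (2 * j)) = -1 * int (Suc (2 * j + 3) choose 2)
       - -1 * (int (2 * j + 3) - int (2 * j)) * int ((2 * j + 3) + 2 * j + 1)"
    "\<And>e. (2 * j + 3) + 2 * j < e \<Longrightarrow> e < (2 * j + 3) + 2 * j + min (2 * (2 * j)) (2 * j + 3)
       \<Longrightarrow> e \<noteq> (2 * j + 3) + 2 * (2 * j) \<Longrightarrow> g $ Suc e = 0"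
    using commutator_nth[OF d c2, of "-1"] by blast
  have c3: "2 * j \<le> 3 * j + 1" by simp
  \<comment> \<open>The second term of \<open>g\<close> lies at depth
    \<open>6 * j + 3 = N - 1\<close>, just below the target. That depth is odd, so any coefficient
    there can be removed.\<close>
  obtain h where h: "h \<in> J_derived (2 * j)" "h \<in> tangent (2 * (3 * j + 1) + 1)"
    "h $ Suc (2 * (3 * j + 1) + 1) = - g $ Suc (N - 1)"
    "\<And>e. 2 * (3 * j + 1) + 1 < e \<Longrightarrow> e < 3 * (3 * j + 1) + 1 \<Longrightarrow> h $ Suc e = 0"
    using derived_leading_odd[OF d c3] by blast
  have j: "j \<ge> 2" using assms by presburger
  have idx: "(2 * j + 2) + (2 * j + 1) = 4 * j + 3" "(2 * j + 3) + 2 * j = 4 * j + 3"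
    by auto
  have f': "f \<in> tangent (4 * j + 3)" and g': "g \<in> tangent (4 * j + 3)"
    and h': "h \<in> tangent (4 * j + 3)"
    using f(2) g(2) unfolding idx by (auto intro: tangent_mono[OF h(2)])
  have add: "(f oo g oo h) $ Suc e = f $ Suc e + g $ Suc e + h $ Suc e" if "0 < e" "e \<le> N" for e
  proof -
    have "e < 2 * (4 * j + 3)" using that(2) assms(3) by simp
    then show ?thesis
      using nth_compose_additive[OF tangent_compose[OF f' g'] h' that(1)]
        nth_compose_additive[OF f' g' that(1)] by simp
  qed
  have z: "f $ Suc e + g $ Suc e + h $ Suc e = 0" if "0 < e" "e < N" for e
  proof -
    consider "e < 4 * j + 3" | "e = 4 * j + 3" | "4 * j + 3 < e" "e \<noteq> N - 1" | "e = N - 1"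
      by (meson nat_neq_iff)
    then show ?thesis
    proof cases
      case 1 then show ?thesis using f' g' h' that by (simp add: tangent_nth)
    next
      case 2
      have "h $ Suc e = 0" using h(2) 2 j by (simp add: tangent_nth)
      then show ?thesis using f(3)[unfolded idx] g(3)[unfolded idx] 2 by simp
    next
      case 3
      have "f $ Suc e = 0" by (rule f(5)) (use 3 that assms(3) in auto)
      moreover have "g $ Suc e = 0" by (rule g(5)) (use 3 that assms(3) j in auto)
      moreover have "h $ Suc e = 0" using h(2) 3 that assms(3) by (simp add: tangent_nth)
      ultimately show ?thesis by simp
    next
      case 4
      have "f $ Suc e = 0" by (rule f(5)) (use 4 that assms(3) j in auto)
      moreover have "e = 2 * (3 * j + 1) + 1" using 4 assms(3) by simp
      ultimately show ?thesis using h(3) 4 by simp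
    qed
  qed
  have "f oo g oo h \<in> tangent N"
    using tangentI[OF tangent_compose[OF tangent_compose[OF f' g'] h']] add z by simp
  moreover have "odd ((f oo g oo h) $ Suc N)"
  proof -
    have "g $ Suc N = 0" by (rule g(5)) (use assms(3) j in auto)
    moreover have "h $ Suc N = 0" by (rule h(4)) (use assms(3) j in auto)
    moreover have "odd (f $ Suc N)"
    proof -
      have N: "(2 * j + 2) + 2 * (2 * j + 1) = N" using assms(3) by simp
      have "int (Suc (2 * j + 2) choose 2) = (int j + 1) * (2 * (int j + 1) + 1)"
        using odd_choose_two[of "j + 1"] by (simp add: ac_simps)
      then have "f $ Suc N = 3 * ((int j + 1) * (2 * (int j + 1) + 1))
          - 3 * (int (2 * j + 2) - int (2 * j + 1)) * (2 * (2 * int j + 2))"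
        using f(4) unfolding N by simp
      then show ?thesis using assms(2) by simp
    qed
    ultimately show ?thesis using add[of N] assms(3) by simp
  qed
  ultimately show ?thesis
    using J_derived_compose[OF d J_derived_compose[OF d f(1) g(1)] h(1)] by blast
qed


section \<open>Splitting off a free abelian quotient\<close>

text \<open>The splitting sends the standard basis of \<open>\<int>\<^sup>k\<close> to the classes of \<open>e 0, \<dots>, e (k - 1)\<close>.\<close>

lemma (in normal) FactGroup_iso_int_power_times:
  fixes T :: "('t, 'u) monoid_scheme" and p :: "nat \<Rightarrow> 'a \<Rightarrow> int"
  defines "\<Gamma> k \<equiv> {f \<in> carrier G. \<forall>i<k. p i f = 0}"
  assumes comm: "comm_group (G Mod H)" and T: "group T"
    and p: "\<And>i. i < k \<Longrightarrow> p i \<in> hom G integer_group"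
    and e: "\<And>i. i < k \<Longrightarrow> e i \<in> carrier G"
    and pe: "\<And>i j. i < k \<Longrightarrow> j < k \<Longrightarrow> p i (e j) = (if i = j then 1 else 0)"
    and \<theta>: "\<And>f g. f \<in> \<Gamma> k \<Longrightarrow> g \<in> \<Gamma> k \<Longrightarrow> \<theta> (f \<otimes> g) = \<theta> f \<otimes>\<^bsub>T\<^esub> \<theta> g"
    and \<theta>_surj: "\<theta> ` \<Gamma> k = carrier T"
    and H_eq: "H = {f \<in> \<Gamma> k. \<theta> f = \<one>\<^bsub>T\<^esub>}"
  shows "G Mod H \<cong> power_group integer_group k \<times>\<times> T"
proof -
  interpret T: group T by fact
  interpret Q: comm_group "G Mod H" by fact
  define q where "q f = H #> f" for f
  have q_carrier: "q f \<in> carrier (G Mod H)" if "f \<in> carrier G" for f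
    using that by (auto simp: q_def FactGroup_def RCOSETS_def)
  have q_mult: "q (f \<otimes> g) = q f \<otimes>\<^bsub>G Mod H\<^esub> q g" if "f \<in> carrier G" "g \<in> carrier G" for f g
    using that by (simp add: q_def FactGroup_def rcos_sum)
  have q_eqD: "\<exists>h\<in>H. f = h \<otimes> g" if "q f = q g" "f \<in> carrier G" for f g
    using rcos_self[OF that(2)] is_subgroup that(1) by (auto simp: q_def r_coset_def)
  have q_eqI: "q (h \<otimes> g) = q g" if "h \<in> H" "g \<in> carrier G" for h g
    using repr_independence[of "h \<otimes> g" H g] that is_subgroup by (auto simp: q_def r_coset_def)
  have hom: "group_hom G integer_group (p i)" if "i < k" for i
    using p[OF that] by (simp add: group_hom_def group_hom_axioms_def is_group)
  have p_mult: "p i (f \<otimes> g) = p i f + p i g" if "i < k" "f \<in> carrier G" "g \<in> carrier G" for i f g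
    using group_hom.hom_mult[OF hom[OF that(1)]] that by simp
  have p_inv: "p i (inv f) = - p i f" if "i < k" "f \<in> carrier G" for i f
    using group_hom.hom_inv[OF hom[OF that(1)]] that by simp
  have p_pow: "p i (f [^] (n::int)) = n * p i f" if "i < k" "f \<in> carrier G" for i f n
    using group_hom.hom_int_pow[OF hom[OF that(1)]] that by simp
  have \<Gamma>_carrier: "f \<in> carrier G" if "f \<in> \<Gamma> k" for f using that by (simp add: \<Gamma>_def)
  have \<Gamma>_mult: "f \<otimes> g \<in> \<Gamma> k" if "f \<in> \<Gamma> k" "g \<in> \<Gamma> k" for f g
    using that p_mult by (simp add: \<Gamma>_def)
  have \<Gamma>_inv: "inv f \<in> \<Gamma> k" if "f \<in> \<Gamma> k" for f
    using that p_inv by (simp add: \<Gamma>_def)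
  have H_\<Gamma>: "h \<in> \<Gamma> k" "\<theta> h = \<one>\<^bsub>T\<^esub>" if "h \<in> H" for h
    using that H_eq by blast+
  have H_p: "p i h = 0" "h \<in> carrier G" if "h \<in> H" "i < k" for h i
    using H_\<Gamma>(1)[OF that(1)] that(2) by (simp_all add: \<Gamma>_def)
  have \<theta>_carrier: "\<theta> f \<in> carrier T" if "f \<in> \<Gamma> k" for f using \<theta>_surj that by blast
  have q_\<theta>: "q f = q g" if "f \<in> \<Gamma> k" "g \<in> \<Gamma> k" "\<theta> f = \<theta> g" for f g
  proof -
    have fg: "f \<otimes> inv g \<in> \<Gamma> k" using that \<Gamma>_mult \<Gamma>_inv by blast
    have "(f \<otimes> inv g) \<otimes> g = f"
      using that \<Gamma>_carrier by (simp add: m_assoc)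
    then have "\<theta> (f \<otimes> inv g) \<otimes>\<^bsub>T\<^esub> \<theta> g = \<theta> g"
      using \<theta>[OF fg that(2)] that(3) by simp
    then have "\<theta> (f \<otimes> inv g) = \<one>\<^bsub>T\<^esub>"
      using \<theta>_carrier fg that(2) by (metis T.l_one T.one_closed T.right_cancel)
    then have "f \<otimes> inv g \<in> H" by (subst H_eq) (use fg in blast)
    then show ?thesis
      using q_eqI[of "f \<otimes> inv g" g] \<open>(f \<otimes> inv g) \<otimes> g = f\<close> that(2) \<Gamma>_carrier by simp
  qed
  \<comment> \<open>The ordered product of the powers of the \<open>e i\<close>. It need not be
    additive in \<open>z\<close> inside \<open>G\<close>, only modulo \<open>H\<close>, where the
    quotient is commutative.\<close>
  define s where "s z = rec_nat \<one> (\<lambda>n f. f \<otimes> e n [^] (z n :: int))" for z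
  have s_0: "s z 0 = \<one>" and s_Suc: "s z (Suc n) = s z n \<otimes> e n [^] z n" for z n
    by (simp_all add: s_def)
  have s_carrier: "s z n \<in> carrier G" if "n \<le> k" for z n
    using that by (induction n) (auto simp: s_0 s_Suc e)
  have s_p: "p i (s z n) = (if i < n then z i else 0)" if "n \<le> k" "i < k" for z n i
    using that
  proof (induction n)
    case 0
    then show ?case using group_hom.hom_one[OF hom[OF \<open>i < k\<close>]] by (simp add: s_0)
  next
    case (Suc n)
    then show ?case by (auto simp: s_Suc p_mult p_pow s_carrier e pe less_Suc_eq)
  qed
  have s_add: "q (s (\<lambda>i\<in>{..<k}. x i + y i) n) = q (s x n) \<otimes>\<^bsub>G Mod H\<^esub> q (s y n)"
    if "n \<le> k" for x y n
    using that
  proof (induction n)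
    case 0
    then show ?case using q_mult[OF one_closed one_closed] by (simp add: s_0)
  next
    case (Suc n)
    then have n: "n < k" by simp
    let ?a = "e n [^] x n" and ?b = "e n [^] y n"
    have c: "q (s x n) \<in> carrier (G Mod H)" "q (s y n) \<in> carrier (G Mod H)"
      "q ?a \<in> carrier (G Mod H)" "q ?b \<in> carrier (G Mod H)"
      using n by (auto intro!: q_carrier s_carrier e)
    have "q (s (\<lambda>i\<in>{..<k}. x i + y i) (Suc n)) =
        q (s (\<lambda>i\<in>{..<k}. x i + y i) n) \<otimes>\<^bsub>G Mod H\<^esub> (q ?a \<otimes>\<^bsub>G Mod H\<^esub> q ?b)"
      using n by (simp add: s_Suc q_mult s_carrier e int_pow_mult)
    also have "\<dots> = (q (s x n) \<otimes>\<^bsub>G Mod H\<^esub> q ?a) \<otimes>\<^bsub>G Mod H\<^esub> (q (s y n) \<otimes>\<^bsub>G Mod H\<^esub> q ?b)"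
      unfolding Suc.IH[OF less_imp_le[OF n]] using c
      by (simp only: Q.m_ac Q.m_closed)
    also have "\<dots> = q (s x (Suc n)) \<otimes>\<^bsub>G Mod H\<^esub> q (s y (Suc n))"
      using n by (simp add: s_Suc q_mult s_carrier e)
    finally show ?case .
  qed
  \<comment> \<open>Any section of \<open>\<theta>\<close> will do: by \<open>q_\<theta>\<close> the
    class modulo \<open>H\<close> does not depend on the choice, so \<open>q\<close> after
    \<open>r\<close> is multiplicative even if \<open>r\<close> is not.\<close>
  define r where "r t = (SOME g. g \<in> \<Gamma> k \<and> \<theta> g = t)" for t
  have r: "r t \<in> \<Gamma> k" "\<theta> (r t) = t" if "t \<in> carrier T" for t
  proof -
    have "t \<in> \<theta> ` \<Gamma> k" using that by (simp only: \<theta>_surj)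
    then have "\<exists>g. g \<in> \<Gamma> k \<and> \<theta> g = t" by (auto simp: image_iff)
    then have "r t \<in> \<Gamma> k \<and> \<theta> (r t) = t" unfolding r_def by (rule someI_ex)
    then show "r t \<in> \<Gamma> k" "\<theta> (r t) = t" by auto
  qed
  define F where "F = (\<lambda>(z, t). q (s z k) \<otimes>\<^bsub>G Mod H\<^esub> q (r t))"
  let ?P = "power_group integer_group k \<times>\<times> T"
  have P: "carrier ?P = (\<Pi>\<^sub>E i\<in>{..<k}. UNIV) \<times> carrier T"
    by (simp add: power_group_def DirProd_def)
  have sr: "s z k \<otimes> r t \<in> carrier G" "F (z, t) = q (s z k \<otimes> r t)" if "t \<in> carrier T" for z t
    using r(1)[OF that] s_carrier[of k z] by (auto simp: F_def q_mult \<Gamma>_carrier)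
  have "F \<in> iso ?P (G Mod H)"
  proof (rule isoI)
    show "F \<in> hom ?P (G Mod H)"
    proof (rule homI)
      fix a assume "a \<in> carrier ?P"
      then show "F a \<in> carrier (G Mod H)" using sr q_carrier unfolding P by fastforce
    next
      fix a b assume ab: "a \<in> carrier ?P" "b \<in> carrier ?P"
      obtain x t y u where eq: "a = (x, t)" "b = (y, u)" by (metis surj_pair)
      have tu: "t \<in> carrier T" "u \<in> carrier T" using ab unfolding P eq by auto
      have "q (r (t \<otimes>\<^bsub>T\<^esub> u)) = q (r t \<otimes> r u)"
        using tu by (intro q_\<theta>) (auto simp: r \<theta> \<Gamma>_mult)
      also have "\<dots> = q (r t) \<otimes>\<^bsub>G Mod H\<^esub> q (r u)"
        using tu r \<Gamma>_carrier by (intro q_mult) auto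
      finally have "F (a \<otimes>\<^bsub>?P\<^esub> b) = (q (s x k) \<otimes>\<^bsub>G Mod H\<^esub> q (s y k)) \<otimes>\<^bsub>G Mod H\<^esub>
          (q (r t) \<otimes>\<^bsub>G Mod H\<^esub> q (r u))"
        by (simp add: eq F_def power_group_def DirProd_def s_add)
      moreover have "q (s x k) \<in> carrier (G Mod H)" "q (s y k) \<in> carrier (G Mod H)"
        "q (r t) \<in> carrier (G Mod H)" "q (r u) \<in> carrier (G Mod H)"
        using tu r \<Gamma>_carrier by (auto intro!: q_carrier s_carrier)
      ultimately show "F (a \<otimes>\<^bsub>?P\<^esub> b) = F a \<otimes>\<^bsub>G Mod H\<^esub> F b"
        by (simp only: eq F_def prod.case Q.m_ac Q.m_closed)
    qed
    show "bij_betw F (carrier ?P) (carrier (G Mod H))"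
      unfolding bij_betw_def
    proof
      show "inj_on F (carrier ?P)"
      proof (rule inj_onI)
        fix a b assume ab: "a \<in> carrier ?P" "b \<in> carrier ?P" and Fab: "F a = F b"
        obtain x t y u where eq: "a = (x, t)" "b = (y, u)" by (metis surj_pair)
        have tu: "t \<in> carrier T" "u \<in> carrier T"
          and xy: "x \<in> extensional {..<k}" "y \<in> extensional {..<k}"
          using ab unfolding P eq by (auto simp: PiE_def)
        note ru = r[OF tu(1)] r[OF tu(2)]
        have "q (s x k \<otimes> r t) = q (s y k \<otimes> r u)" using Fab sr tu by (simp add: eq)
        then obtain h where h: "h \<in> H" "s x k \<otimes> r t = h \<otimes> (s y k \<otimes> r u)"
          using q_eqD sr(1)[OF tu(1)] by blast
        have "x i = y i" if "i < k" for i
        proof -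
          have "p i (s x k \<otimes> r t) = p i (h \<otimes> (s y k \<otimes> r u))" by (simp only: h)
          then show ?thesis
            using that ru h(1) H_p[OF h(1) that] by (simp add: p_mult s_carrier s_p \<Gamma>_def)
        qed
        then have "x = y" using xy by (intro extensionalityI) auto
        have "q (r t) = q (r u)"
        proof -
          have "q (s x k) \<otimes>\<^bsub>G Mod H\<^esub> q (r t) = q (s x k) \<otimes>\<^bsub>G Mod H\<^esub> q (r u)"
            using Fab by (simp add: eq F_def \<open>x = y\<close>)
          then show ?thesis
            using ru \<Gamma>_carrier q_carrier s_carrier[of k x] by (metis Q.m_comm Q.right_cancel order_refl)
        qed
        then obtain h where "h \<in> H" "r t = h \<otimes> r u" using q_eqD ru \<Gamma>_carrier by blast
        then have "t = u" using H_\<Gamma> \<theta> ru tu by (metis T.l_one)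
        then show "a = b" by (simp add: eq \<open>x = y\<close>)
      qed
      show "F ` carrier ?P = carrier (G Mod H)"
      proof (intro equalityI subsetI)
        fix c assume "c \<in> F ` carrier ?P"
        then show "c \<in> carrier (G Mod H)" using sr q_carrier unfolding P by fastforce
      next
        fix c assume "c \<in> carrier (G Mod H)"
        then obtain f where f: "f \<in> carrier G" "c = q f"
          by (auto simp: q_def FactGroup_def RCOSETS_def)
        \<comment> \<open>Dividing \<open>f\<close> by the product with the same free coordinates
          leaves an element of \<open>\<Gamma> k\<close>, where \<open>\<theta>\<close> determines
          the class.\<close>
        define z where "z = (\<lambda>i\<in>{..<k}. p i f)"
        define g where "g = inv (s z k) \<otimes> f"
        have sz: "s z k \<in> carrier G" using s_carrier by simp
        then have g: "g \<in> \<Gamma> k"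
          using f by (simp add: \<Gamma>_def g_def p_mult p_inv s_p z_def)
        have "q (r (\<theta> g)) = q g" using g r[OF \<theta>_carrier[OF g]] by (intro q_\<theta>) auto
        then have "F (z, \<theta> g) = q (s z k \<otimes> g)"
          using sz g \<Gamma>_carrier by (simp add: F_def q_mult)
        also have "s z k \<otimes> g = f" using sz f by (simp add: g_def flip: m_assoc)
        finally have "F (z, \<theta> g) = c" using f by simp
        moreover have "(z, \<theta> g) \<in> carrier ?P"
          unfolding P using \<theta>_carrier[OF g] by (auto simp: z_def)
        ultimately show "c \<in> F ` carrier ?P" by blast
      qed
    qed
  qed
  moreover have "group ?P"
    by (intro DirProd_group T) (simp add: power_group_def)
  ultimately show ?thesis
    using group.iso_sym by (auto simp: is_iso_def)
qed

section \<open>The closure of the commutator subgroup\<close>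

lemma openin_fps_product_topology_agree:
  "openin fps_product_topology {g. agree n g f}"
proof -
  let ?U = "\<Pi>\<^sub>E i\<in>UNIV. (if i < n then {f $ i} else UNIV)"
  have "openin (product_topology (\<lambda>_. discrete_topology UNIV) UNIV) ?U"
    by (rule product_topology_basis) (auto intro: finite_subset[of _ "{..<n}"])
  moreover have "{g. agree n g f} = fps_nth -` ?U \<inter> UNIV"
    by (auto simp: agree_def PiE_iff split: if_splits)
  ultimately show ?thesis
    unfolding fps_product_topology_def openin_pullback_topology by blast
qed

lemma openin_fps_product_topology_imp_agree:
  assumes "openin fps_product_topology V" "f \<in> V"
  obtains n where "\<And>g. agree n g f \<Longrightarrow> g \<in> V"
proof -
  obtain U where U: "openin (product_topology (\<lambda>_. discrete_topology (UNIV :: int set)) UNIV) U"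
    and V: "V = fps_nth -` U"
    using assms(1) unfolding fps_product_topology_def openin_pullback_topology by auto
  have "fps_nth f \<in> U" using assms(2) V by simp
  then obtain B where B: "finite {i. B i \<noteq> UNIV}" "fps_nth f \<in> Pi\<^sub>E UNIV B" "Pi\<^sub>E UNIV B \<subseteq> U"
    using U unfolding openin_product_topology_alt by auto
  obtain n where n: "{i. B i \<noteq> UNIV} \<subseteq> {..<n}"
    using B(1) finite_nat_iff_bounded by blast
  show thesis
  proof (rule that)
    fix g assume "agree n g f"
    moreover have "B i = UNIV" if "\<not> i < n" for i using n that by blast
    ultimately have "fps_nth g i \<in> B i" for i
      using B(2) by (cases "i < n") (auto simp: agree_def PiE_iff)
    then show "g \<in> V" using B(3) V by (auto simp: PiE_iff)
  qed
qed

text \<open>The sets of series sharing the first \<open>n\<close> coefficients are a neighbourhood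
  basis, so membership in the closure is approximation to every finite order.\<close>

lemma in_J_commutator_iff:
  assumes "d > 0"
  shows "f \<in> J_commutator (Suc d) \<longleftrightarrow> f \<in> tangent d \<and> (\<forall>n. \<exists>h\<in>J_derived d. agree n h f)"
proof -
  have top: "topspace (J_topology (Suc d)) = tangent d"
    by (simp add: J_topology_def carrier_J_group fps_product_topology_def
        topspace_pullback_topology topspace_subtopology)
  show ?thesis
  proof (intro iffI conjI allI)
    assume f: "f \<in> J_commutator (Suc d)"
    then show ft: "f \<in> tangent d"
      unfolding J_commutator_def in_closure_of top by blast
    fix n
    have "openin (J_topology (Suc d)) ({g. agree n g f} \<inter> tangent d)"
      unfolding J_topology_def carrier_J_group openin_subtopology
      using openin_fps_product_topology_agree by blast
    moreover have "f \<in> {g. agree n g f} \<inter> tangent d" using ft by simp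
    ultimately obtain h where "h \<in> J_derived d" "h \<in> {g. agree n g f} \<inter> tangent d"
      using f unfolding J_commutator_def in_closure_of by metis
    then show "\<exists>h\<in>J_derived d. agree n h f" by blast
  next
    assume f: "f \<in> tangent d \<and> (\<forall>n. \<exists>h\<in>J_derived d. agree n h f)"
    show "f \<in> J_commutator (Suc d)"
      unfolding J_commutator_def in_closure_of top
    proof (intro conjI allI impI)
      fix U assume U: "f \<in> U \<and> openin (J_topology (Suc d)) U"
      then obtain V where V: "openin fps_product_topology V" "U = V \<inter> tangent d"
        unfolding J_topology_def carrier_J_group openin_subtopology by blast
      then obtain n where n: "\<And>g. agree n g f \<Longrightarrow> g \<in> V"
        using openin_fps_product_topology_imp_agree U by blast
      obtain h where "h \<in> J_derived d" "agree n h f" using f by blast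
      then show "\<exists>y. y \<in> J_derived d \<and> y \<in> U"
        using n V J_derived_subset[OF assms] by blast
    qed (use f in blast)
  qed
qed


text \<open>The only bilinear term at depth \<open>2 * d\<close> is
  \<open>(d + 1) f_{d+1} g_{d+1}\<close>, which is symmetric; below that depth composition is
  additive.\<close>

lemma compose_agree_commute:
  assumes "d > 0" "f \<in> tangent d" "g \<in> tangent d"
  shows "agree (Suc (Suc (2 * d))) (f oo g) (g oo f)"
  unfolding agree_def
proof (intro allI impI)
  fix i assume i: "i < Suc (Suc (2 * d))"
  show "(f oo g) $ i = (g oo f) $ i"
  proof (cases i)
    case 0 then show ?thesis using assms by (simp add: tangent_0)
  next
    case (Suc N)
    then consider "N = 0" | "0 < N" "N < 2 * d" | "N = 2 * d" using i by fastforce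
    then show ?thesis
    proof cases
      case 1
      then show ?thesis
        using tangent_1[OF tangent_compose[OF assms(2,3)]] tangent_1[OF tangent_compose[OF assms(3,2)]]
          assms(1) Suc by simp
    next
      case 2
      then show ?thesis
        using nth_compose_additive[OF assms(2,3)] nth_compose_additive[OF assms(3,2)] Suc by simp
    next
      case 3
      then show ?thesis
        using nth_compose_quadratic[OF assms(2,3), of N] nth_compose_quadratic[OF assms(3,2), of N]
          assms(1) Suc by simp
    qed
  qed
qed

lemma commutator_in_tangent:
  assumes "d > 0" "f \<in> tangent d" "g \<in> tangent d" "h oo (g oo f) = f oo g"
  shows "h \<in> tangent (2 * d + 1)"
proof -
  have v: "g oo f \<in> tangent d" using assms by (simp add: tangent_compose)
  have "agree (Suc (Suc (2 * d))) (h oo (g oo f)) (fps_X oo (g oo f))"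
    using compose_agree_commute[OF assms(1-3)] assms(4) by (simp add: tangent_0[OF assms(3)])
  then show ?thesis
    using agree_compose_cancel[OF _ v assms(1)] by (simp add: tangent_def)
qed

section \<open>Coordinates of the free part and reduction to a torsion invariant\<close>

lemma triangular_add:
  fixes a b :: int
  shows "(a + b) * (a + b - 1) div 2 = a * (a - 1) div 2 + b * (b - 1) div 2 + a * b"
proof -
  have ev: "even (a * (a - 1))" "even (b * (b - 1))" by simp_all
  obtain x where x: "a * (a - 1) = 2 * x" using ev(1) by (elim dvdE)
  obtain y where y: "b * (b - 1) = 2 * y" using ev(2) by (elim dvdE)
  have "(a + b) * (a + b - 1) = a * (a - 1) + b * (b - 1) + 2 * (a * b)"
    by (simp add: algebra_simps)
  also have "\<dots> = 2 * (x + y + a * b)" by (simp add: x y)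
  finally show ?thesis by (simp add: x y)
qed

text \<open>The quadratic correction makes the coefficient at \<open>x\<^sup>2\<^sup>d\<^sup>+\<^sup>1\<close> additive under substitution.\<close>

definition free_coord :: "nat \<Rightarrow> nat \<Rightarrow> int fps \<Rightarrow> int" where
  "free_coord d i f =
     (if i < d then f $ Suc (d + i)
      else f $ Suc (2 * d) - int (Suc d) * (f $ Suc d * (f $ Suc d - 1) div 2))"

lemma free_coord_compose:
  assumes "d > 0" "f \<in> tangent d" "g \<in> tangent d"
  shows "free_coord d i (f oo g) = free_coord d i f + free_coord d i g"
proof (cases "i < d")
  case True
  then show ?thesis
    using nth_compose_additive[OF assms(2,3), of "d + i"] assms(1) by (simp add: free_coord_def)
next
  case False
  define t where "t x = x * (x - 1) div 2" for x :: int
  have t: "t (x + y) = t x + t y + x * y" for x y by (simp only: t_def triangular_add)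
  have coord: "free_coord d i h = h $ Suc (2 * d) - int (Suc d) * t (h $ Suc d)" for h
    using False by (simp only: free_coord_def t_def if_False)
  have "(f oo g) $ Suc d = f $ Suc d + g $ Suc d"
    using nth_compose_additive[OF assms(2,3), of d] assms(1) by simp
  moreover have "(f oo g) $ Suc (2 * d) = f $ Suc (2 * d) + g $ Suc (2 * d)
      + int (Suc d) * (f $ Suc d * g $ Suc d)"
    using nth_compose_quadratic[OF assms(2,3), of "2 * d"] assms(1) by (simp add: mult.assoc)
  ultimately show ?thesis by (simp only: coord t ring_distribs)
qed

lemma free_coord_eq_0_iff:
  assumes "d > 0" "f \<in> tangent d"
  shows "(\<forall>i<Suc d. free_coord d i f = 0) \<longleftrightarrow> f \<in> tangent (2 * d + 1)"
proof
  assume *: "\<forall>i<Suc d. free_coord d i f = 0"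
  have lo: "f $ Suc (d + i) = 0" if "i < d" for i
    using * that by (auto simp: free_coord_def split: if_splits)
  have hi: "f $ Suc (2 * d) = 0"
    using *[rule_format, of d] lo[of 0] assms(1) by (simp add: free_coord_def)
  show "f \<in> tangent (2 * d + 1)"
  proof (rule tangentI[OF assms(2,1)])
    fix e assume e: "0 < e" "e < 2 * d + 1"
    consider "e < d" | "d \<le> e" "e < 2 * d" | "e = 2 * d" using e by linarith
    then show "f $ Suc e = 0"
    proof cases
      case 1 then show ?thesis using assms e by (simp add: tangent_nth)
    next
      case 2 then show ?thesis using lo[of "e - d"] by simp
    next
      case 3 then show ?thesis using hi by simp
    qed
  qed
next
  assume "f \<in> tangent (2 * d + 1)"
  then show "\<forall>i<Suc d. free_coord d i f = 0"
    using assms(1) by (auto simp: free_coord_def tangent_nth)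
qed

text \<open>Here \<open>comm\<close> and \<open>cancel\<close> put every commutator into the kernel
  \<open>W\<close> of \<open>\<theta>\<close> on \<open>tangent (2 * d + 1)\<close>,
  \<open>local\<close> extends this to the closure, and \<open>lead\<close> gives the converse by
  matching one coefficient at a time. The hypothesis \<open>cancel\<close> is weaker than
  multiplicativity on \<open>h oo f\<close> with only \<open>h\<close> deep, which may fail because
  of cross terms.\<close>

lemma J_H1_iso:
  fixes T :: "('t, 'u) monoid_scheme" and \<theta> :: "int fps \<Rightarrow> 't"
  assumes d: "d > 0" and T: "group T"
    and comm: "\<And>f g. f \<in> tangent d \<Longrightarrow> g \<in> tangent d \<Longrightarrow> \<theta> (f oo g) = \<theta> (g oo f)"
    and cancel: "\<And>h f. h \<in> tangent (2 * d + 1) \<Longrightarrow> f \<in> tangent d \<Longrightarrow> \<theta> (h oo f) = \<theta> f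
      \<Longrightarrow> \<theta> h = \<one>\<^bsub>T\<^esub>"
    and mult: "\<And>f g. f \<in> tangent (2 * d + 1) \<Longrightarrow> g \<in> tangent (2 * d + 1)
      \<Longrightarrow> \<theta> (f oo g) = \<theta> f \<otimes>\<^bsub>T\<^esub> \<theta> g"
    and surj: "\<theta> ` tangent (2 * d + 1) = carrier T"
    and local: "\<And>f g. agree n f g \<Longrightarrow> \<theta> f = \<theta> g"
    and lead: "\<And>N w. 2 * d < N \<Longrightarrow> w \<in> tangent N \<Longrightarrow> \<theta> w = \<one>\<^bsub>T\<^esub>
      \<Longrightarrow> \<exists>h\<in>J_derived d. h \<in> tangent N \<and> h $ Suc N = w $ Suc N"
  shows "J_H1 (Suc d) \<cong> power_group integer_group (Suc d) \<times>\<times> T"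
proof -
  let ?G = "J_group (Suc d)" and ?\<Gamma> = "tangent (2 * d + 1)"
  interpret G: group ?G by (rule group_J_group[OF d])
  interpret T: group T by (rule T)
  define W where "W = {f \<in> ?\<Gamma>. \<theta> f = \<one>\<^bsub>T\<^esub>}"
  have \<theta>_carrier: "\<theta> f \<in> carrier T" if "f \<in> ?\<Gamma>" for f using surj that by blast
  have \<Gamma>: "subgroup ?\<Gamma> ?G" using d by (intro subgroup_tangent) auto
  have \<theta>_X: "\<theta> fps_X = \<one>\<^bsub>T\<^esub>"
    using mult[of fps_X fps_X] \<theta>_carrier[of fps_X] by simp
  have W: "subgroup W ?G"
  proof (rule G.subgroupI)
    show "W \<subseteq> carrier ?G" using subgroup.subset[OF \<Gamma>] by (auto simp: W_def)
    show "W \<noteq> {}" using \<theta>_X by (auto simp: W_def intro: fps_X_in_tangent)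
  next
    fix f assume f: "f \<in> W"
    then have f': "f \<in> ?\<Gamma>" "\<theta> f = \<one>\<^bsub>T\<^esub>" by (simp_all only: W_def mem_Collect_eq)
    have i: "inv\<^bsub>?G\<^esub> f \<in> ?\<Gamma>" by (rule subgroup.m_inv_closed[OF \<Gamma> f'(1)])
    have "inv\<^bsub>?G\<^esub> f oo f = fps_X"
      using G.l_inv[OF subgroup.mem_carrier[OF \<Gamma> f'(1)]] by simp
    then have "\<theta> (inv\<^bsub>?G\<^esub> f) = \<one>\<^bsub>T\<^esub>"
      using mult[OF i f'(1)] f'(2) \<theta>_X \<theta>_carrier[OF i] by simp
    then show "inv\<^bsub>?G\<^esub> f \<in> W" using i by (simp add: W_def)
  next
    fix f g assume "f \<in> W" "g \<in> W"
    then show "f \<otimes>\<^bsub>?G\<^esub> g \<in> W" using mult by (simp add: W_def tangent_compose)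
  qed
  have comm_W: "h \<in> W" if fg: "f \<in> tangent d" "g \<in> tangent d" and h: "h oo (g oo f) = f oo g"
    for f g h
  proof -
    have "h \<in> ?\<Gamma>" by (rule commutator_in_tangent[OF d fg h])
    moreover have "\<theta> (h oo (g oo f)) = \<theta> (g oo f)" using h comm fg by simp
    ultimately show ?thesis
      using cancel[of h "g oo f"] fg by (simp add: W_def tangent_compose)
  qed
  have commutator_W: "f \<otimes>\<^bsub>?G\<^esub> g \<otimes>\<^bsub>?G\<^esub> inv\<^bsub>?G\<^esub> f \<otimes>\<^bsub>?G\<^esub> inv\<^bsub>?G\<^esub> g \<in> W"
    if fg: "f \<in> carrier ?G" "g \<in> carrier ?G" for f g
  proof (rule comm_W)
    show "(f \<otimes>\<^bsub>?G\<^esub> g \<otimes>\<^bsub>?G\<^esub> inv\<^bsub>?G\<^esub> f \<otimes>\<^bsub>?G\<^esub> inv\<^bsub>?G\<^esub> g) oo (g oo f) = f oo g"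
      using G.commutator_mult[OF fg] by simp
  qed (use fg in \<open>simp_all only: carrier_J_group\<close>)
  have derived_W: "J_derived d \<subseteq> W"
    unfolding derived_def
  proof (rule G.generate_subgroup_incl[OF _ W])
    show "derived_set ?G (carrier ?G) \<subseteq> W" using commutator_W by blast
  qed
  \<comment> \<open>Leading coefficients are peeled off by division. The quotient stays in
    \<open>W\<close> because the divisor lies in the derived subgroup, hence in \<open>W\<close>; so
    \<open>lead\<close> applies again at the next depth.\<close>
  have step: "\<exists>h\<in>J_derived d. \<exists>w'\<in>W. w' \<in> tangent (2 * d + 1 + m) \<and> w = h oo w'"
    if w: "w \<in> W" for w m
  proof (induction m)
    case 0
    have "fps_X \<in> J_derived d"
      using subgroup.one_closed[OF G.derived_is_subgroup[OF order_refl]] by simp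
    moreover have "w \<in> ?\<Gamma>" using w by (simp add: W_def)
    moreover have "w = fps_X oo w"
      using calculation(2) by (simp add: tangent_0)
    ultimately show ?case using w by auto
  next
    case (Suc m)
    define N where "N = 2 * d + 1 + m"
    obtain h v where h: "h \<in> J_derived d" and v: "v \<in> W" "v \<in> tangent N" and w: "w = h oo v"
      using Suc N_def by blast
    obtain c where c: "c \<in> J_derived d" "c \<in> tangent N" "c $ Suc N = v $ Suc N"
      using lead[of N v] v by (auto simp: N_def W_def)
    have cW: "c \<in> W" using c derived_W by blast
    have cG: "c \<in> carrier ?G" using cW subgroup.mem_carrier[OF W] by blast
    let ?i = "inv\<^bsub>?G\<^esub> c"
    have i: "?i \<in> carrier ?G" using cG by simp
    have 0: "c $ 0 = 0" "?i $ 0 = 0" "v $ 0 = 0" "h $ 0 = 0"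
      using cG i v h J_derived_subset[OF d] by (auto simp: carrier_J_group tangent_0)
    have ci: "c oo ?i = fps_X" "?i oo c = fps_X"
      using G.r_inv[OF cG] G.l_inv[OF cG] by simp_all
    have ag: "agree (Suc (Suc N)) v c"
      using v(2) c by (auto simp: agree_def tangent_nth less_Suc_eq_le le_Suc_eq)
    have "agree (Suc (Suc N)) (?i oo v) fps_X"
      using agree_compose[OF agree_refl ag, of ?i] ci by simp
    then have "?i oo v \<in> tangent (2 * d + 1 + Suc m)" by (simp add: tangent_def N_def)
    moreover have "?i oo v \<in> W"
      using subgroup.m_closed[OF W subgroup.m_inv_closed[OF W cW] v(1)] by simp
    moreover have "w = (h oo c) oo (?i oo v)"
    proof -
      have "(h oo c) oo (?i oo v) = h oo ((c oo ?i) oo v)"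
        using 0 by (simp add: fps_compose_assoc)
      then show ?thesis using w 0 by (simp add: ci)
    qed
    moreover have "h oo c \<in> J_derived d" using J_derived_compose[OF d h c(1)] .
    ultimately show ?case by blast
  qed
  have W_eq: "J_commutator (Suc d) = W"
  proof (intro equalityI subsetI)
    fix f assume "f \<in> J_commutator (Suc d)"
    \<comment> \<open>The approximation is fine enough both to fix the value of
      \<open>\<theta>\<close> and to decide membership in
      \<open>tangent (2 * d + 1)\<close>.\<close>
    then obtain h where h: "h \<in> J_derived d" "agree (max n (2 * d + 2)) h f"
      using in_J_commutator_iff[OF d] by blast
    have hW: "h \<in> ?\<Gamma>" "\<theta> h = \<one>\<^bsub>T\<^esub>" using h derived_W by (auto simp: W_def)
    have "\<theta> h = \<theta> f" by (rule local[OF agree_mono[OF h(2)]]) simp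
    moreover have "f \<in> ?\<Gamma>"
      using hW(1) agree_sym[OF agree_mono[OF h(2), of "Suc (2 * d + 1)"]]
      by (auto simp: tangent_def intro: agree_trans)
    ultimately show "f \<in> W" using hW by (simp add: W_def)
  next
    fix w assume w: "w \<in> W"
    have "\<exists>h\<in>J_derived d. agree m h w" for m
    proof -
      obtain h v where h: "h \<in> J_derived d" and v: "v \<in> tangent (2 * d + 1 + m)" "w = h oo v"
        using step[OF w, of m] by blast
      have "agree m v fps_X"
        using v(1) unfolding tangent_def by (auto intro: agree_mono)
      then have "agree m (h oo v) (h oo fps_X)" by (intro agree_compose agree_refl)
      then show ?thesis using h v(2) by (auto intro: agree_sym)
    qed
    moreover have "w \<in> tangent d" using w by (auto simp: W_def intro: tangent_mono)
    ultimately show "w \<in> J_commutator (Suc d)" using in_J_commutator_iff[OF d] by blast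
  qed
  have normal: "W \<lhd> ?G"
    unfolding G.normal_inv_iff
  proof (intro conjI ballI)
    fix f w assume fw: "f \<in> carrier ?G" "w \<in> W"
    have w: "w \<in> carrier ?G" using fw subgroup.mem_carrier[OF W] by blast
    have "f \<otimes>\<^bsub>?G\<^esub> w \<otimes>\<^bsub>?G\<^esub> inv\<^bsub>?G\<^esub> f =
        (f \<otimes>\<^bsub>?G\<^esub> w \<otimes>\<^bsub>?G\<^esub> inv\<^bsub>?G\<^esub> f \<otimes>\<^bsub>?G\<^esub> inv\<^bsub>?G\<^esub> w) \<otimes>\<^bsub>?G\<^esub> w"
      using fw(1) w by (simp only: G.m_assoc G.m_closed G.inv_closed G.l_inv G.r_one)
    then show "f \<otimes>\<^bsub>?G\<^esub> w \<otimes>\<^bsub>?G\<^esub> inv\<^bsub>?G\<^esub> f \<in> W"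
      using subgroup.m_closed[OF W commutator_W[OF fw(1) w] fw(2)] by metis
  qed (rule W)
  interpret W: normal W ?G by (rule normal)
  have "comm_group (?G Mod W)"
  proof (rule group.group_comm_groupI[OF W.factorgroup_is_group])
    fix a b assume "a \<in> carrier (?G Mod W)" "b \<in> carrier (?G Mod W)"
    then obtain f g where f: "f \<in> carrier ?G" "a = W #>\<^bsub>?G\<^esub> f" and g: "g \<in> carrier ?G" "b = W #>\<^bsub>?G\<^esub> g"
      by (auto simp: FactGroup_def RCOSETS_def)
    obtain h where h: "h \<in> W" "f \<otimes>\<^bsub>?G\<^esub> g = h \<otimes>\<^bsub>?G\<^esub> (g \<otimes>\<^bsub>?G\<^esub> f)"
    proof
      show "f \<otimes>\<^bsub>?G\<^esub> g \<otimes>\<^bsub>?G\<^esub> inv\<^bsub>?G\<^esub> f \<otimes>\<^bsub>?G\<^esub> inv\<^bsub>?G\<^esub> g \<in> W"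
        by (rule commutator_W[OF f(1) g(1)])
      show "f \<otimes>\<^bsub>?G\<^esub> g =
          f \<otimes>\<^bsub>?G\<^esub> g \<otimes>\<^bsub>?G\<^esub> inv\<^bsub>?G\<^esub> f \<otimes>\<^bsub>?G\<^esub> inv\<^bsub>?G\<^esub> g \<otimes>\<^bsub>?G\<^esub> (g \<otimes>\<^bsub>?G\<^esub> f)"
        using G.commutator_mult[OF f(1) g(1)] by simp
    qed
    have "W #>\<^bsub>?G\<^esub> (f \<otimes>\<^bsub>?G\<^esub> g) = W #>\<^bsub>?G\<^esub> (g \<otimes>\<^bsub>?G\<^esub> f)"
      using G.repr_independence[of "f \<otimes>\<^bsub>?G\<^esub> g" W "g \<otimes>\<^bsub>?G\<^esub> f"] f(1) g(1) h W
      unfolding r_coset_def by (metis (no_types, lifting) G.m_closed UN_I singletonI)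
    then show "a \<otimes>\<^bsub>?G Mod W\<^esub> b = b \<otimes>\<^bsub>?G Mod W\<^esub> a"
      using f g by (simp only: mult_FactGroup W.rcos_sum)
  qed
  moreover have "{f \<in> carrier ?G. \<forall>i<Suc d. free_coord d i f = 0} = ?\<Gamma>"
  proof -
    have "f \<in> tangent d" if "f \<in> ?\<Gamma>" for f by (rule tangent_mono[OF that]) simp
    then show ?thesis unfolding carrier_J_group using free_coord_eq_0_iff[OF d] by blast
  qed
  ultimately have "?G Mod W \<cong> power_group integer_group (Suc d) \<times>\<times> T"
  \<comment> \<open>These series are dual to the coordinates: the quadratic correction in the last
    coordinate vanishes on them, their coefficient at \<open>x^(d+1)\<close> being 0 or 1.\<close>
  proof (intro W.FactGroup_iso_int_power_times[where p = "free_coord d" and \<theta> = \<theta>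
        and e = "\<lambda>i. fps_X + fps_const 1 * fps_X ^ Suc (d + i)"] T)
    fix i
    show "free_coord d i \<in> hom ?G integer_group"
      using free_coord_compose[OF d] by (intro homI) (auto simp: carrier_J_group)
    show "fps_X + fps_const 1 * fps_X ^ Suc (d + i) \<in> carrier ?G"
      unfolding carrier_J_group by (rule tangent_mono[OF X_plus_power_in_tangent]) simp
    fix j assume "i < Suc d" "j < Suc d"
    then show "free_coord d i (fps_X + fps_const 1 * fps_X ^ Suc (d + j)) = (if i = j then 1 else 0)"
      using d by (auto simp: free_coord_def fps_X_power_nth simp del: power_Suc)
  qed (use mult surj W_def in auto)
  then show ?thesis by (simp only: J_H1_def W_eq)
qed


section \<open>Coefficients of composites modulo 2\<close>

text \<open>This and the next lemma are the Frobenius congruence \<open>p^2 = p(x^2)\<close> modulo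
  2: off the diagonal the products pair up under \<open>i \<mapsto> n - i\<close>.\<close>

lemma square_nth_odd:
  fixes p :: "int fps"
  shows "even ((p\<^sup>2) $ (2 * m + 1))"
proof -
  have "(p\<^sup>2) $ (2 * m + 1) = (\<Sum>i=0..2*m+1. p $ i * p $ (2 * m + 1 - i))"
    by (simp add: power2_eq_square fps_mult_nth)
  also have "{0..2*m+1} = {0..m} \<union> {Suc m..2*m+1}" by auto
  also have "(\<Sum>i\<in>\<dots>. p $ i * p $ (2 * m + 1 - i)) =
      (\<Sum>i=0..m. p $ i * p $ (2 * m + 1 - i)) + (\<Sum>i=Suc m..2*m+1. p $ i * p $ (2 * m + 1 - i))"
    by (rule sum.union_disjoint) auto
  also have "(\<Sum>i=Suc m..2*m+1. p $ i * p $ (2 * m + 1 - i)) =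
      (\<Sum>i=0..m. p $ i * p $ (2 * m + 1 - i))"
    by (rule sum.reindex_bij_witness[of _ "\<lambda>i. 2 * m + 1 - i" "\<lambda>i. 2 * m + 1 - i"]) auto
  finally show ?thesis by simp
qed

lemma square_nth_even:
  fixes p :: "int fps"
  shows "even ((p\<^sup>2) $ (2 * m) - p $ m)"
proof -
  have "(p\<^sup>2) $ (2 * m) = (\<Sum>i=0..2*m. p $ i * p $ (2 * m - i))"
    by (simp add: power2_eq_square fps_mult_nth)
  also have "{0..2*m} = insert m ({0..<m} \<union> {Suc m..2*m})" by auto
  also have "(\<Sum>i\<in>\<dots>. p $ i * p $ (2 * m - i)) = p $ m * p $ m +
      ((\<Sum>i=0..<m. p $ i * p $ (2 * m - i)) + (\<Sum>i=Suc m..2*m. p $ i * p $ (2 * m - i)))"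
  proof -
    have "(\<Sum>i\<in>{0..<m} \<union> {Suc m..2*m}. p $ i * p $ (2 * m - i)) =
        (\<Sum>i=0..<m. p $ i * p $ (2 * m - i)) + (\<Sum>i=Suc m..2*m. p $ i * p $ (2 * m - i))"
      by (rule sum.union_disjoint) auto
    then show ?thesis by simp
  qed
  also have "(\<Sum>i=Suc m..2*m. p $ i * p $ (2 * m - i)) =
      (\<Sum>i=0..<m. p $ i * p $ (2 * m - i))"
    by (rule sum.reindex_bij_witness[of _ "\<lambda>i. 2 * m - i" "\<lambda>i. 2 * m - i"]) auto
  finally show ?thesis by simp
qed

lemma sum_even_odd_indices:
  fixes F :: "nat \<Rightarrow> int"
  shows "(\<Sum>n=0..2*m+1. F n) = (\<Sum>i=0..m. F (2 * i) + F (2 * i + 1))"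
  by (induction m) auto

lemma even_sum_diff:
  fixes F F' :: "'b \<Rightarrow> int"
  assumes "\<And>i. i \<in> A \<Longrightarrow> even (F i - F' i)"
  shows "even (sum F A - sum F' A)"
  using assms by (auto simp flip: sum_subtractf intro: dvd_sum)

text \<open>Modulo 2 the derivative of \<open>f\<close> is \<open>u\<^sub>f(x\<^sup>2)\<close> with \<open>u\<^sub>f = \<Sum>\<^sub>j c\<^sub>j y\<^sup>j\<close>, where \<open>c\<^sub>j\<close> is the
  coefficient of \<open>f\<close> at \<open>x\<^sup>2\<^sup>j\<^sup>+\<^sup>1\<close>. The chain rule becomes \<open>u\<^bsub>f \<circ> g\<^esub> = u\<^sub>f(g) u\<^sub>g\<close>.\<close>

lemma nth_compose_mod_2:
  fixes f g :: "int fps"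
  shows "even ((f oo g) $ (2 * J + 1) -
    (\<Sum>i=0..J. f $ (2 * i + 1) * (\<Sum>l=0..J. g $ (2 * l + 1) * (g ^ i) $ (J - l))))"
proof -
  have inner: "even ((g ^ (2 * i + 1)) $ (2 * J + 1)
      - (\<Sum>l=0..J. g $ (2 * l + 1) * (g ^ i) $ (J - l)))" for i
  proof -
    let ?q = "(g ^ i)\<^sup>2"
    \<comment> \<open>As \<open>?q\<close> is \<open>(g ^ i)(x^2)\<close> modulo 2, a coefficient of
      odd index in the product only involves coefficients of odd index of \<open>g\<close>.\<close>
    have "g ^ (2 * i + 1) = g * ?q" by (simp flip: power_mult add: mult.commute)
    then have "(g ^ (2 * i + 1)) $ (2 * J + 1) = (\<Sum>m=0..2*J+1. g $ m * ?q $ (2 * J + 1 - m))"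
      by (simp only: fps_mult_nth)
    also have "\<dots> = (\<Sum>l=0..J. g $ (2 * l) * ?q $ (2 * J + 1 - 2 * l)
        + g $ (2 * l + 1) * ?q $ (2 * J + 1 - (2 * l + 1)))"
      by (rule sum_even_odd_indices)
    finally have "(g ^ (2 * i + 1)) $ (2 * J + 1) = \<dots>" .
    moreover have "even ((\<Sum>l=0..J. g $ (2 * l) * ?q $ (2 * J + 1 - 2 * l)
        + g $ (2 * l + 1) * ?q $ (2 * J + 1 - (2 * l + 1)))
        - (\<Sum>l=0..J. g $ (2 * l + 1) * (g ^ i) $ (J - l)))"
    proof (rule even_sum_diff)
      fix l assume "l \<in> {0..J}"
      then have idx: "2 * J + 1 - 2 * l = 2 * (J - l) + 1" "2 * J + 1 - (2 * l + 1) = 2 * (J - l)"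
        by auto
      have "even (g $ (2 * l) * ?q $ (2 * (J - l) + 1)
          + g $ (2 * l + 1) * (?q $ (2 * (J - l)) - (g ^ i) $ (J - l)))"
        using square_nth_odd[of "g ^ i" "J - l"] square_nth_even[of "g ^ i" "J - l"]
        by (intro dvd_add dvd_mult)
      then show "even (g $ (2 * l) * ?q $ (2 * J + 1 - 2 * l)
          + g $ (2 * l + 1) * ?q $ (2 * J + 1 - (2 * l + 1)) - g $ (2 * l + 1) * (g ^ i) $ (J - l))"
        unfolding idx by (simp only: right_diff_distrib add_diff_eq)
    qed
    ultimately show ?thesis by simp
  qed
  have "(f oo g) $ (2 * J + 1) =
      (\<Sum>i=0..J. f $ (2 * i) * (g ^ (2 * i)) $ (2 * J + 1)
        + f $ (2 * i + 1) * (g ^ (2 * i + 1)) $ (2 * J + 1))"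
    unfolding fps_compose_nth by (rule sum_even_odd_indices)
  moreover have "even (\<dots> -
      (\<Sum>i=0..J. f $ (2 * i + 1) * (\<Sum>l=0..J. g $ (2 * l + 1) * (g ^ i) $ (J - l))))"
  proof (rule even_sum_diff)
    fix i
    have "even ((g ^ (2 * i)) $ (2 * J + 1))"
      using square_nth_odd[of "g ^ i" J] by (simp flip: power_mult add: mult.commute)
    then have "even (f $ (2 * i) * (g ^ (2 * i)) $ (2 * J + 1) + f $ (2 * i + 1) *
        ((g ^ (2 * i + 1)) $ (2 * J + 1) - (\<Sum>l=0..J. g $ (2 * l + 1) * (g ^ i) $ (J - l))))"
      using inner[of i] by (intro dvd_add dvd_mult)
    then show "even (f $ (2 * i) * (g ^ (2 * i)) $ (2 * J + 1)
        + f $ (2 * i + 1) * (g ^ (2 * i + 1)) $ (2 * J + 1)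
        - f $ (2 * i + 1) * (\<Sum>l=0..J. g $ (2 * l + 1) * (g ^ i) $ (J - l)))"
      by (simp only: right_diff_distrib add_diff_eq)
  qed
  ultimately show ?thesis by simp
qed

text \<open>The sum is the coefficient of \<open>y^J\<close> in \<open>g(y)^i u_g(y)\<close>. The
  terms \<open>l = 0\<close> (first order of the power) and \<open>l = J - i\<close> (its leading
  term) survive. Any other \<open>l\<close> needs \<open>l \<ge> j\<close> for a nonzero first
  factor; then only depth \<open>J - l - i \<le> j + 1\<close> is left for the power, which is below
  \<open>d\<close> unless \<open>d\<close> is 2 or 3.\<close>

lemma inner_sum_mod_2:
  fixes g :: "int fps"
  assumes g: "g \<in> tangent d" and d: "d = 2 * j \<or> d = 2 * j - 1" "2 \<le> d"
    and i: "j \<le> i" "i < J" and J: "J \<le> 3 * j + 1"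
  shows "even ((\<Sum>l=0..J. g $ (2 * l + 1) * (g ^ i) $ (J - l))
    - (int i * g $ Suc (J - i) + g $ (2 * (J - i) + 1)
        + (if d = 2 \<and> J = 4 \<and> i = 1 then g $ 3 else 0)))"
proof -
  have d0: "0 < d" and j: "j \<ge> 1" "d = 2 * j - 1 \<Longrightarrow> j \<ge> 2" using d by auto
  let ?T = "\<lambda>l. g $ (2 * l + 1) * (g ^ i) $ (J - l)"
  have first: "(g ^ i) $ (i + e) = int i * g $ Suc e" if "0 < e" "e \<le> J - j" for e
    by (rule nth_power_first_order[OF g]) (use that d J j in auto)
  have "(\<Sum>l=0..J. ?T l) = ?T 0 + (\<Sum>l\<in>{0..J} - {0}. ?T l)"
    by (rule sum.remove) auto
  moreover have "{0..J} - {0} = {1..J}" by auto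
  moreover have "(\<Sum>l=1..J. ?T l) = ?T (J - i) + (\<Sum>l\<in>{1..J} - {J - i}. ?T l)"
    by (rule sum.remove) (use i in auto)
  ultimately have total: "(\<Sum>l=0..J. ?T l) = ?T 0 + (?T (J - i) + (\<Sum>l\<in>{1..J} - {J - i}. ?T l))"
    by simp
  have T_0: "?T 0 = int i * g $ Suc (J - i)"
    using first[of "J - i"] i tangent_1[OF g d0] by simp
  have T_diff: "?T (J - i) = g $ (2 * (J - i) + 1)"
    using nth_power_tangent(1)[OF g d0, of i] i by simp
  have rest: "even ((\<Sum>l\<in>{1..J} - {J - i}. ?T l)
      - (if d = 2 \<and> J = 4 \<and> i = 1 then g $ 3 else 0))"
  proof -
    have zero: "even (?T l)" if l: "l \<in> {1..J} - {J - i}" and ex: "\<not> (d = 2 \<and> J = 4 \<and> i = 1 \<and> l = 1)"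
      for l
    proof -
      consider "l < j" | "j \<le> l" "J - l < i" | "j \<le> l" "i < J - l" using l i by fastforce
      then show ?thesis
      proof cases
        case 1
        then have "g $ (2 * l + 1) = 0" using g l d by (auto simp: tangent_nth)
        then show ?thesis by simp
      next
        case 2
        then show ?thesis using nth_power_tangent(2)[OF g d0] by simp
      next
        case 3
        define e where "e = J - l - i"
        have e: "0 < e" "J - l = i + e" "e + 2 * j \<le> J" using 3 i by (auto simp: e_def)
        have ge: "(g ^ i) $ (J - l) = int i * g $ Suc e"
          using first[of e] e by simp
        show ?thesis
        proof (cases "e < d")
          case True
          then have "g $ Suc e = 0" using g e by (simp add: tangent_nth)
          then show ?thesis by (simp add: ge)
        next
          case False
          \<comment> \<open>For \<open>d = 3\<close> all inequalities are tight and force the even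
            factor \<open>i = 2\<close>; for \<open>d = 2\<close> the only term left is the one
            excluded by \<open>ex\<close>.\<close>
          then have "j = 2 \<and> i = 2 \<or> d = 2 \<and> J = 4 \<and> i = 1 \<and> l = 1"
            using d J e 3 i j by auto
          then have "even (int i)" using ex by auto
          then show ?thesis by (simp add: ge)
        qed
      qed
    qed
    show ?thesis
    proof (cases "d = 2 \<and> J = 4 \<and> i = 1")
      case True
      have "{1..J} - {J - i} = insert 1 ({2..J} - {J - i})" using True by auto
      then have "(\<Sum>l\<in>{1..J} - {J - i}. ?T l) = ?T 1 + (\<Sum>l\<in>{2..J} - {J - i}. ?T l)" by simp
      moreover have "even (\<Sum>l\<in>{2..J} - {J - i}. ?T l)"
        by (rule dvd_sum, rule zero) auto
      moreover have "?T 1 = g $ 3 * g $ 3" using True by (simp add: numeral_3_eq_3)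
      ultimately show ?thesis using True by simp
    next
      case False
      have "even (\<Sum>l\<in>{1..J} - {J - i}. ?T l)"
        by (rule dvd_sum, rule zero) (use False in auto)
      then show ?thesis unfolding if_not_P[OF False] by simp
    qed
  qed
  have "even (z - w) \<Longrightarrow> even (x + (y + z) - (x + y + w))" for x y z w :: int by simp
  from this[OF rest] show ?thesis unfolding total T_0 T_diff .
qed

text \<open>The extra summand for \<open>d = 2\<close>, \<open>J = 4\<close> comes from \<open>c\<^sub>1 c\<^sub>1'\<close> times the first
  nontrivial coefficient of the inner series.\<close>

lemma nth_compose_mod_2_low:
  fixes f g :: "int fps"
  assumes f: "f \<in> tangent d" and g: "g \<in> tangent d" and d: "d = 2 * j \<or> d = 2 * j - 1" "2 \<le> d"
    and J: "0 < J" "J \<le> 3 * j + 1"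
  shows "even ((f oo g) $ (2 * J + 1) - (f $ (2 * J + 1) + g $ (2 * J + 1)
      + (\<Sum>i=1..<J. f $ (2 * i + 1) * g $ (2 * (J - i) + 1))
      + (\<Sum>i=1..<J. int i * f $ (2 * i + 1) * g $ Suc (J - i))
      + (if d = 2 \<and> J = 4 then f $ 3 * g $ 3 else 0)))"
proof -
  have d0: "0 < d" and j: "j \<ge> 1" using d by auto
  let ?I = "\<lambda>i. \<Sum>l=0..J. g $ (2 * l + 1) * (g ^ i) $ (J - l)"
  let ?L = "\<lambda>i. int i * g $ Suc (J - i) + g $ (2 * (J - i) + 1)
        + (if d = 2 \<and> J = 4 \<and> i = 1 then g $ 3 else 0)"
  have "{0..J} = insert 0 (insert J {1..<J})" using J by auto
  then have total: "(\<Sum>i=0..J. f $ (2 * i + 1) * ?I i)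
      = f $ 1 * ?I 0 + (f $ (2 * J + 1) * ?I J + (\<Sum>i=1..<J. f $ (2 * i + 1) * ?I i))"
    using J by simp
  have I_0: "f $ 1 * ?I 0 = g $ (2 * J + 1)"
  proof -
    have "?I 0 = (\<Sum>l=0..J. if l = J then g $ (2 * J + 1) else 0)"
      by (rule sum.cong) auto
    then show ?thesis using tangent_1[OF f d0] by simp
  qed
  have I_J: "?I J = 1"
  proof -
    have "?I J = (\<Sum>l=0..J. if l = 0 then 1 else 0)"
      by (rule sum.cong) (auto simp: nth_power_tangent[OF g d0] tangent_1[OF g d0, simplified])
    then show ?thesis by simp
  qed
  have rest: "even ((\<Sum>i=1..<J. f $ (2 * i + 1) * ?I i) - (\<Sum>i=1..<J. f $ (2 * i + 1) * ?L i))"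
  proof (rule even_sum_diff)
    fix i assume i: "i \<in> {1..<J}"
    show "even (f $ (2 * i + 1) * ?I i - f $ (2 * i + 1) * ?L i)"
    proof (cases "i < j")
      case True
      then have "f $ (2 * i + 1) = 0" using i f d by (auto simp: tangent_nth)
      then show ?thesis by simp
    next
      case False
      then have "even (f $ (2 * i + 1) * (?I i - ?L i))"
        using i inner_sum_mod_2[OF g d, of i J] J by (intro dvd_mult) auto
      then show ?thesis by (simp only: right_diff_distrib)
    qed
  qed
  have L: "(\<Sum>i=1..<J. f $ (2 * i + 1) * ?L i) =
      (\<Sum>i=1..<J. f $ (2 * i + 1) * g $ (2 * (J - i) + 1))
      + (\<Sum>i=1..<J. int i * f $ (2 * i + 1) * g $ Suc (J - i))
      + (if d = 2 \<and> J = 4 then f $ 3 * g $ 3 else 0)"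
  proof -
    have "(\<Sum>i=1..<J. f $ (2 * i + 1) * (if d = 2 \<and> J = 4 \<and> i = 1 then g $ 3 else 0))
        = (\<Sum>i=1..<J. if i = 1 then (if d = 2 \<and> J = 4 then f $ 3 * g $ 3 else 0) else 0)"
      by (rule sum.cong) (auto simp: numeral_3_eq_3)
    also have "\<dots> = (if d = 2 \<and> J = 4 then f $ 3 * g $ 3 else 0)" by auto
    finally show ?thesis
      by (simp add: distrib_left sum.distrib ac_simps)
  qed
  have "even (c - (u + (v * 1 + s))) \<Longrightarrow> even (s - (a + b + x)) \<Longrightarrow> even (c - (v + u + a + b + x))"
    for a b c s u v x :: int by presburger
  from this[OF nth_compose_mod_2[of f g J, unfolded total I_0 I_J] rest[unfolded L]]
  show ?thesis .
qed


lemma sum_first_order_terms: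
  fixes f g :: "int fps"
  assumes f: "f \<in> tangent d" and g: "g \<in> tangent d" and d: "d = 2 * j \<or> d = 2 * j - 1" "2 \<le> d"
  shows "(\<Sum>i=1..<J. int i * f $ (2 * i + 1) * g $ Suc (J - i))
    = (\<Sum>i=j..J-d. int i * f $ (2 * i + 1) * g $ Suc (J - i))"
proof (rule sum.mono_neutral_right)
  show "\<forall>i\<in>{1..<J} - {j..J-d}. int i * f $ (2 * i + 1) * g $ Suc (J - i) = 0"
  proof
    fix i assume i: "i \<in> {1..<J} - {j..J-d}"
    then consider "i < j" | "J - d < i" "i < J" by fastforce
    then show "int i * f $ (2 * i + 1) * g $ Suc (J - i) = 0"
    proof cases
      case 1
      then have "f $ (2 * i + 1) = 0" using i f d by (auto simp: tangent_nth)
      then show ?thesis by simp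
    next
      case 2
      then have "g $ Suc (J - i) = 0" using g d by (auto simp: tangent_nth)
      then show ?thesis by simp
    qed
  qed
qed (use d in auto)

text \<open>The convolution of the coefficients of odd index is symmetric and drops out, as does the
  extra summand for \<open>d = 2\<close>. What remains is the first-order change of
  \<open>u_f\<close> when \<open>y\<close> is replaced by \<open>g(y)\<close>.\<close>

lemma nth_commute_mod_2:
  fixes f g :: "int fps"
  assumes f: "f \<in> tangent d" and g: "g \<in> tangent d" and d: "d = 2 * j \<or> d = 2 * j - 1" "2 \<le> d"
    and J: "0 < J" "J \<le> 3 * j + 1"
  shows "even ((f oo g) $ (2 * J + 1) - (g oo f) $ (2 * J + 1)
    - ((\<Sum>i=j..J-d. int i * f $ (2 * i + 1) * g $ Suc (J - i))
       - (\<Sum>i=j..J-d. int i * g $ (2 * i + 1) * f $ Suc (J - i))))"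
proof -
  have S: "(\<Sum>i=1..<J. f $ (2 * i + 1) * g $ (2 * (J - i) + 1))
      = (\<Sum>i=1..<J. g $ (2 * i + 1) * f $ (2 * (J - i) + 1))"
    by (rule sum.reindex_bij_witness[of _ "\<lambda>i. J - i" "\<lambda>i. J - i"]) auto
  have X: "(if d = 2 \<and> J = 4 then f $ 3 * g $ 3 else 0) = (if d = 2 \<and> J = 4 then g $ 3 * f $ 3 else 0)"
    by simp
  have "even (c - (u + v + s + r + x)) \<Longrightarrow> even (c' - (v + u + s + r' + x)) \<Longrightarrow> even (c - c' - (r - r'))"
    for c c' u v s r r' x :: int by presburger
  from this[OF nth_compose_mod_2_low[OF f g d J, unfolded S X sum_first_order_terms[OF f g d]]
      nth_compose_mod_2_low[OF g f d J, unfolded sum_first_order_terms[OF g f d]]]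
  show ?thesis .
qed

text \<open>An asymmetric term needs \<open>i \<ge> j\<close> and a coefficient of depth at least
  \<open>d\<close>, hence \<open>J \<ge> j + d\<close>.\<close>

lemma nth_commute_mod_2_zero:
  fixes f g :: "int fps"
  assumes "f \<in> tangent d" "g \<in> tangent d" "d = 2 * j \<or> d = 2 * j - 1" "2 \<le> d"
    and "0 < J" "J < j + d"
  shows "even ((f oo g) $ (2 * J + 1) - (g oo f) $ (2 * J + 1))"
proof -
  have "{j..J-d} = {}" using assms by auto
  then show ?thesis using nth_commute_mod_2[OF assms(1-4), of J] assms(3-6) by auto
qed

text \<open>With \<open>h\<close> this deep the first-order sum is even, so only the convolution can
  spoil additivity; the hypothesis \<open>ev\<close> makes each of its critical cross terms
  even.\<close>

lemma nth_compose_deep_mod_2: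
  fixes f g :: "int fps"
  assumes h: "h \<in> tangent (2 * d + 1)" and g: "g \<in> tangent d"
    and d: "d = 2 * j \<or> d = 2 * j - 1" "2 \<le> d" and J: "0 < J" "J \<le> 3 * j + 1"
    and ev: "\<And>i. d < i \<Longrightarrow> i + j \<le> J \<Longrightarrow> even (h $ (2 * i + 1)) \<or> g $ (2 * (J - i) + 1) = 0"
  shows "even ((h oo g) $ (2 * J + 1) - h $ (2 * J + 1) - g $ (2 * J + 1))"
proof -
  have hd: "h \<in> tangent d" by (rule tangent_mono[OF h]) simp
  have "even (\<Sum>i=1..<J. h $ (2 * i + 1) * g $ (2 * (J - i) + 1))"
  proof (rule dvd_sum)
    fix i assume i: "i \<in> {1..<J}"
    consider "i \<le> d" | "d < i" "i + j \<le> J" | "J < i + j" by linarith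
    then show "even (h $ (2 * i + 1) * g $ (2 * (J - i) + 1))"
    proof cases
      case 1
      then have "h $ (2 * i + 1) = 0" using h i by (simp add: tangent_nth)
      then show ?thesis by simp
    next
      case 2
      then show ?thesis using ev[of i] by auto
    next
      case 3
      then have "g $ (2 * (J - i) + 1) = 0" using g i d by (auto simp: tangent_nth)
      then show ?thesis by simp
    qed
  qed
  moreover have "even (\<Sum>i=j..J-d. int i * h $ (2 * i + 1) * g $ Suc (J - i))"
  proof (rule dvd_sum)
    fix i assume i: "i \<in> {j..J-d}"
    show "even (int i * h $ (2 * i + 1) * g $ Suc (J - i))"
    proof (cases "i \<le> d")
      case True
      then have "h $ (2 * i + 1) = 0" using h i d by (auto simp: tangent_nth)
      then show ?thesis by simp
    next
      case False
      moreover have "j \<le> i" "i \<le> J - d" using i by auto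
      \<comment> \<open>The depths leave no room for such an \<open>i\<close> except when
        \<open>d = 3\<close> and \<open>i = 4\<close>, where the factor \<open>i\<close> is
        even.\<close>
      ultimately have di: "d + i \<le> 3 * j + 1" "d < i" using J d by auto
      show ?thesis
      proof (cases "d = 2 * j")
        case True
        then show ?thesis using di d(2) by simp
      next
        case False
        then have "d + 1 = 2 * j" using d by auto
        moreover from this have "2 \<le> j" using d(2) by presburger
        ultimately have "j = 2" using di by linarith
        then have "i = 4" using di \<open>d + 1 = 2 * j\<close> by simp
        then show ?thesis by simp
      qed
    qed
  qed
  moreover have "h $ 3 = 0" using h d by (simp add: tangent_nth)
  moreover have "even (c - (u + v + s + r + x)) \<Longrightarrow> even s \<Longrightarrow> even r \<Longrightarrow> x = 0 \<Longrightarrow> even (c - u - v)"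
    for c u v s r x :: int by presburger
  ultimately show ?thesis
    using nth_compose_mod_2_low[OF hd g d J, unfolded sum_first_order_terms[OF hd g d]] by auto
qed

lemma nth_compose_deep_mod_2':
  fixes f g :: "int fps"
  assumes h: "h \<in> tangent (2 * d + 1)" and g: "g \<in> tangent (2 * d + 1)"
    and d: "d = 2 * j \<or> d = 2 * j - 1" "2 \<le> d" and J: "0 < J" "J \<le> 3 * j + 1"
  shows "even ((h oo g) $ (2 * J + 1) - h $ (2 * J + 1) - g $ (2 * J + 1))"
proof (rule nth_compose_deep_mod_2[OF h _ d J])
  show "g \<in> tangent d" by (rule tangent_mono[OF g]) simp
  show "even (h $ (2 * i + 1)) \<or> g $ (2 * (J - i) + 1) = 0" if "d < i" "i + j \<le> J" for i
    using that g d J by (auto simp: tangent_nth)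
qed

text \<open>A cross term combines depth greater than \<open>2 * d\<close> in \<open>h\<close> with
  depth at least \<open>d\<close> in \<open>g\<close>, so it first appears beyond depth
  \<open>3 * d\<close>.\<close>

lemma nth_compose_deep:
  assumes h: "h \<in> tangent (2 * d + 1)" and g: "g \<in> tangent d" and N: "0 < N" "N \<le> 3 * d"
  shows "(h oo g) $ Suc N = h $ Suc N + g $ Suc N"
proof -
  have d: "0 < d" using N by simp
  have hd: "h \<in> tangent d" by (rule tangent_mono[OF h]) simp
  have "(\<Sum>i=d..N-1. h $ Suc i * (g ^ Suc i) $ Suc N) = 0"
  proof (rule sum.neutral, rule ballI)
    fix i assume i: "i \<in> {d..N-1}"
    show "h $ Suc i * (g ^ Suc i) $ Suc N = 0"
    proof (cases "i \<le> 2 * d")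
      case True
      then have "h $ Suc i = 0" using h i d by (simp add: tangent_nth)
      then show ?thesis by simp
    next
      case False
      then have e: "0 < N - i" "N - i < d" "Suc N = Suc i + (N - i)" using i N d by auto
      then have "(g ^ Suc i) $ Suc N = int (Suc i) * g $ Suc (N - i)"
        using nth_power_first_order[OF g, of "N - i" "Suc i"] by simp
      moreover have "g $ Suc (N - i) = 0" using g e by (simp add: tangent_nth)
      ultimately show ?thesis by simp
    qed
  qed
  then show ?thesis using nth_compose_tangent[OF hd g d N(1)] by simp
qed

lemma tangent_with_coefficients:
  fixes s :: "nat \<Rightarrow> int"
  obtains h where "h \<in> tangent e" "\<And>n. e < n \<Longrightarrow> h $ n = s n"
proof
  show "Abs_fps (\<lambda>n. if n \<le> e then fps_X $ n else s n) \<in> tangent e"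
    by (auto simp: tangent_nth)
qed auto

lemma derived_leading_exists:
  assumes "0 < d" "2 * d < N"
    and "even N \<Longrightarrow> even c \<or> (\<exists>h\<in>J_derived d. h \<in> tangent N \<and> odd (h $ Suc N))"
  shows "\<exists>h\<in>J_derived d. h \<in> tangent N \<and> h $ Suc N = c"
proof (cases "even N")
  case False
  then obtain n where n: "N = 2 * n + 1" by (elim oddE)
  then show ?thesis using derived_leading_odd[OF assms(1), of n c] assms(2) by auto
next
  case True
  then obtain m where "N = 2 * m" by (elim evenE)
  then obtain n where n: "N = 2 * n + 2" "d \<le> n"
    using assms(2) by (intro that[of "m - 1"]) auto
  show ?thesis
  proof (cases "even c")
    case True
    then show ?thesis using derived_leading_even[OF assms(1) n(2), of c] n by metis
  next
    case False
    then show ?thesis using derived_leading_any[OF assms(1) n(2,1)] assms(3) \<open>even N\<close> by blast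
  qed
qed

lemma group_power_group: "group G \<Longrightarrow> group (power_group G n)"
  by (simp add: power_group_def)

text \<open>The \<open>\<psi> i\<close> are integer lifts of the coordinates of
  \<open>\<theta>\<close>, which turns the conditions into parity statements. In
  \<open>cancel\<close> all coordinates are assumed at once, since one coordinate of
  \<open>h oo f\<close> may contain a multiple of another coordinate of \<open>h\<close>.\<close>

lemma J_H1_iso_mod_2:
  fixes \<psi> :: "nat \<Rightarrow> int fps \<Rightarrow> int"
  assumes d: "d > 0"
    and comm: "\<And>i f g. i < r \<Longrightarrow> f \<in> tangent d \<Longrightarrow> g \<in> tangent d
      \<Longrightarrow> even (\<psi> i (f oo g) - \<psi> i (g oo f))"
    and cancel: "\<And>h f i. h \<in> tangent (2 * d + 1) \<Longrightarrow> f \<in> tangent d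
      \<Longrightarrow> (\<And>i. i < r \<Longrightarrow> even (\<psi> i (h oo f) - \<psi> i f)) \<Longrightarrow> i < r \<Longrightarrow> even (\<psi> i h)"
    and mult: "\<And>i f g. i < r \<Longrightarrow> f \<in> tangent (2 * d + 1) \<Longrightarrow> g \<in> tangent (2 * d + 1)
      \<Longrightarrow> even (\<psi> i (f oo g) - \<psi> i f - \<psi> i g)"
    and surj: "\<And>t. \<exists>h\<in>tangent (2 * d + 1). \<forall>i<r. \<psi> i h = t i"
    and local: "\<And>i f g. i < r \<Longrightarrow> agree n f g \<Longrightarrow> \<psi> i f = \<psi> i g"
    and lead: "\<And>N w. 2 * d < N \<Longrightarrow> even N \<Longrightarrow> w \<in> tangent N \<Longrightarrow> (\<And>i. i < r \<Longrightarrow> even (\<psi> i w))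
      \<Longrightarrow> even (w $ Suc N) \<or> (\<exists>h\<in>J_derived d. h \<in> tangent N \<and> odd (h $ Suc N))"
  shows "J_H1 (Suc d) \<cong> power_group integer_group (Suc d) \<times>\<times> power_group (integer_mod_group 2) r"
proof (rule J_H1_iso[where \<theta> = "\<lambda>f. \<lambda>i\<in>{..<r}. \<psi> i f mod 2" and n = n, OF d])
  let ?\<theta> = "\<lambda>f. \<lambda>i\<in>{..<r}. \<psi> i f mod 2"
  let ?T = "power_group (integer_mod_group 2) r"
  have eq_iff: "?\<theta> f = ?\<theta> g \<longleftrightarrow> (\<forall>i<r. even (\<psi> i f - \<psi> i g))" for f g
    by (auto simp: fun_eq_iff mod_eq_dvd_iff)
  have one_iff: "?\<theta> f = \<one>\<^bsub>?T\<^esub> \<longleftrightarrow> (\<forall>i<r. even (\<psi> i f))" for f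
    by (auto simp: fun_eq_iff power_group_def even_iff_mod_2_eq_zero)
  show "group ?T" by (simp add: group_power_group)
  show "?\<theta> (f oo g) = ?\<theta> (g oo f)" if "f \<in> tangent d" "g \<in> tangent d" for f g
    using comm that by (simp only: eq_iff) blast
  show "?\<theta> h = \<one>\<^bsub>?T\<^esub>" if "h \<in> tangent (2 * d + 1)" "f \<in> tangent d" "?\<theta> (h oo f) = ?\<theta> f" for h f
    using cancel[OF that(1,2)] that(3) by (simp only: eq_iff one_iff) blast
  show "?\<theta> (f oo g) = ?\<theta> f \<otimes>\<^bsub>?T\<^esub> ?\<theta> g"
    if "f \<in> tangent (2 * d + 1)" "g \<in> tangent (2 * d + 1)" for f g
  proof -
    have "\<psi> i (f oo g) mod 2 = (\<psi> i f mod 2 + \<psi> i g mod 2) mod 2" if "i < r" for i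
      using mult[OF that \<open>f \<in> _\<close> \<open>g \<in> _\<close>] by presburger
    then show ?thesis by (auto simp: fun_eq_iff power_group_def)
  qed
  show "?\<theta> ` tangent (2 * d + 1) = carrier ?T"
  proof (intro equalityI subsetI)
    fix t assume "t \<in> carrier ?T"
    then have t: "t \<in> (\<Pi>\<^sub>E i\<in>{..<r}. {0..<2})"
      by (simp add: power_group_def carrier_integer_mod_group)
    obtain h where h: "h \<in> tangent (2 * d + 1)" "\<forall>i<r. \<psi> i h = t i" using surj by blast
    have "?\<theta> h = t"
      by (rule extensionalityI[of _ "{..<r}"]) (use t h(2) in \<open>auto simp: PiE_def Pi_def\<close>)
    then show "t \<in> ?\<theta> ` tangent (2 * d + 1)" using h(1) by blast
  next
    fix t assume "t \<in> ?\<theta> ` tangent (2 * d + 1)"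
    then obtain h where "t = ?\<theta> h" by blast
    then show "t \<in> carrier ?T"
      by (simp add: power_group_def carrier_integer_mod_group restrict_PiE_iff)
  qed
  show "?\<theta> f = ?\<theta> g" if "agree n f g" for f g using local that by (auto simp: fun_eq_iff)
  show "\<exists>h\<in>J_derived d. h \<in> tangent N \<and> h $ Suc N = w $ Suc N"
    if "2 * d < N" "w \<in> tangent N" "?\<theta> w = \<one>\<^bsub>?T\<^esub>" for N w
    using lead[OF that(1) _ that(2)] that(3) unfolding one_iff
    by (intro derived_leading_exists[OF d that(1)]) blast
qed

text \<open>In the applications \<open>\<phi>\<close> accounts for two depths: an early coefficient
  determines its parity, and a late one enters with the factor 2.\<close>

lemma J_H1_iso_mod_4:
  fixes \<phi> :: "int fps \<Rightarrow> int" and \<psi> :: "nat \<Rightarrow> int fps \<Rightarrow> int"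
  assumes d: "d > 0"
    and comm: "\<And>f g. f \<in> tangent d \<Longrightarrow> g \<in> tangent d \<Longrightarrow> 4 dvd \<phi> (f oo g) - \<phi> (g oo f)"
      "\<And>i f g. i < r \<Longrightarrow> f \<in> tangent d \<Longrightarrow> g \<in> tangent d
      \<Longrightarrow> even (\<psi> i (f oo g) - \<psi> i (g oo f))"
    and cancel: "\<And>h f i. h \<in> tangent (2 * d + 1) \<Longrightarrow> f \<in> tangent d
      \<Longrightarrow> 4 dvd \<phi> (h oo f) - \<phi> f \<Longrightarrow> (\<And>i. i < r \<Longrightarrow> even (\<psi> i (h oo f) - \<psi> i f))
      \<Longrightarrow> 4 dvd \<phi> h \<and> (\<forall>i<r. even (\<psi> i h))"
    and mult: "\<And>f g. f \<in> tangent (2 * d + 1) \<Longrightarrow> g \<in> tangent (2 * d + 1)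
      \<Longrightarrow> 4 dvd \<phi> (f oo g) - \<phi> f - \<phi> g"
      "\<And>i f g. i < r \<Longrightarrow> f \<in> tangent (2 * d + 1) \<Longrightarrow> g \<in> tangent (2 * d + 1)
      \<Longrightarrow> even (\<psi> i (f oo g) - \<psi> i f - \<psi> i g)"
    and surj: "\<And>s t. \<exists>h\<in>tangent (2 * d + 1). \<phi> h = s \<and> (\<forall>i<r. \<psi> i h = t i)"
    and local: "\<And>f g. agree n f g \<Longrightarrow> \<phi> f = \<phi> g" "\<And>i f g. i < r \<Longrightarrow> agree n f g \<Longrightarrow> \<psi> i f = \<psi> i g"
    and lead: "\<And>N w. 2 * d < N \<Longrightarrow> even N \<Longrightarrow> w \<in> tangent N \<Longrightarrow> 4 dvd \<phi> w
      \<Longrightarrow> (\<And>i. i < r \<Longrightarrow> even (\<psi> i w))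
      \<Longrightarrow> even (w $ Suc N) \<or> (\<exists>h\<in>J_derived d. h \<in> tangent N \<and> odd (h $ Suc N))"
  shows "J_H1 (Suc d) \<cong> power_group integer_group (Suc d)
    \<times>\<times> (integer_mod_group 4 \<times>\<times> power_group (integer_mod_group 2) r)"
proof (rule J_H1_iso[where \<theta> = "\<lambda>f. (\<phi> f mod 4, \<lambda>i\<in>{..<r}. \<psi> i f mod 2)" and n = n, OF d])
  let ?\<theta> = "\<lambda>f. (\<phi> f mod 4, \<lambda>i\<in>{..<r}. \<psi> i f mod 2)"
  let ?T = "integer_mod_group 4 \<times>\<times> power_group (integer_mod_group 2) r"
  have eq_iff: "?\<theta> f = ?\<theta> g \<longleftrightarrow> 4 dvd \<phi> f - \<phi> g \<and> (\<forall>i<r. even (\<psi> i f - \<psi> i g))" for f g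
    by (auto simp: fun_eq_iff mod_eq_dvd_iff)
  have one_iff: "?\<theta> f = \<one>\<^bsub>?T\<^esub> \<longleftrightarrow> 4 dvd \<phi> f \<and> (\<forall>i<r. even (\<psi> i f))" for f
    by (auto simp: fun_eq_iff power_group_def even_iff_mod_2_eq_zero dvd_eq_mod_eq_0)
  show "group ?T" by (simp add: group_power_group DirProd_group)
  show "?\<theta> (f oo g) = ?\<theta> (g oo f)" if "f \<in> tangent d" "g \<in> tangent d" for f g
    using comm that by (simp only: eq_iff) blast
  show "?\<theta> h = \<one>\<^bsub>?T\<^esub>" if "h \<in> tangent (2 * d + 1)" "f \<in> tangent d" "?\<theta> (h oo f) = ?\<theta> f" for h f
    using cancel[OF that(1,2)] that(3) by (simp only: eq_iff one_iff) blast
  show "?\<theta> (f oo g) = ?\<theta> f \<otimes>\<^bsub>?T\<^esub> ?\<theta> g"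
    if "f \<in> tangent (2 * d + 1)" "g \<in> tangent (2 * d + 1)" for f g
  proof -
    have "\<phi> (f oo g) mod 4 = (\<phi> f + \<phi> g) mod 4"
      using mult(1)[OF that] by (simp add: mod_eq_dvd_iff algebra_simps)
    moreover have "\<psi> i (f oo g) mod 2 = (\<psi> i f mod 2 + \<psi> i g mod 2) mod 2" if "i < r" for i
      using mult(2)[OF that \<open>f \<in> _\<close> \<open>g \<in> _\<close>] by presburger
    then have "(\<lambda>i\<in>{..<r}. \<psi> i (f oo g) mod 2) =
        (\<lambda>i\<in>{..<r}. (\<psi> i f mod 2 + \<psi> i g mod 2) mod 2)"
      by (intro restrict_ext) simp
    ultimately show ?thesis by (simp add: power_group_def mod_add_eq cong: restrict_cong)
  qed
  show "?\<theta> ` tangent (2 * d + 1) = carrier ?T"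
  proof (intro equalityI subsetI)
    fix st assume "st \<in> carrier ?T"
    then obtain s t where st: "st = (s, t)" "s \<in> {0..<4}" "t \<in> (\<Pi>\<^sub>E i\<in>{..<r}. {0..<2})"
      by (auto simp: power_group_def carrier_integer_mod_group DirProd_def)
    obtain h where h: "h \<in> tangent (2 * d + 1)" "\<phi> h = s" "\<forall>i<r. \<psi> i h = t i" using surj by blast
    have "(\<lambda>i\<in>{..<r}. \<psi> i h mod 2) = t"
      by (rule extensionalityI[of _ "{..<r}"]) (use st(3) h(3) in \<open>auto simp: PiE_def Pi_def\<close>)
    then have "?\<theta> h = st" using h(2) st(1,2) by simp
    then show "st \<in> ?\<theta> ` tangent (2 * d + 1)" using h(1) by blast
  next
    fix st assume "st \<in> ?\<theta> ` tangent (2 * d + 1)"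
    then obtain h where "st = ?\<theta> h" by blast
    then show "st \<in> carrier ?T"
      by (simp add: power_group_def carrier_integer_mod_group DirProd_def restrict_PiE_iff)
  qed
  show "?\<theta> f = ?\<theta> g" if "agree n f g" for f g using local that by (auto simp: fun_eq_iff)
  show "\<exists>h\<in>J_derived d. h \<in> tangent N \<and> h $ Suc N = w $ Suc N"
    if "2 * d < N" "w \<in> tangent N" "?\<theta> w = \<one>\<^bsub>?T\<^esub>" for N w
    using lead[OF that(1) _ that(2)] that(3) unfolding one_iff
    by (intro derived_leading_exists[OF d that(1)]) blast
qed


section \<open>The torsion part\<close>

text \<open>For odd \<open>J\<close> the smaller depth is \<open>2 * j\<close>, which works from
  \<open>3 * j + 2\<close> on. For even \<open>J\<close> it is \<open>2 * j + 1\<close>, which works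
  only from \<open>3 * j + 3\<close> on, so \<open>J = 3 * j + 2\<close> needs the product of three
  commutators.\<close>

lemma derived_odd_even_depth:
  assumes "0 < j" "3 * j + 2 \<le> J"
  shows "\<exists>h\<in>J_derived (2 * j). h \<in> tangent (2 * J) \<and> odd (h $ Suc (2 * J))"
proof (cases "odd J")
  case True
  show ?thesis
    by (rule derived_odd_at_2_mod_4[of _ j "J - 2 * j"]) (use assms True in auto)
next
  case False
  show ?thesis
  proof (cases "J = 3 * j + 2")
    case True
    show ?thesis
      by (rule derived_odd_at_3d_plus_4) (use assms True False in auto)
  next
    case J: False
    show ?thesis
      by (rule derived_odd_at_0_mod_4[of _ j "J - 2 * j - 1"]) (use assms False J in auto)
  qed
qed

text \<open>Here the odd number \<open>d\<close> itself is the smaller depth for even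
  \<open>J\<close>, so there is no exceptional depth. For odd \<open>J\<close> the smaller depth is
  \<open>2 * j = d + 1\<close>, and the range starts later.\<close>

lemma derived_odd_odd_depth:
  assumes "0 < j" "3 * j \<le> J" "odd J \<Longrightarrow> 3 * j + 2 \<le> J"
  shows "\<exists>h\<in>J_derived (2 * j - 1). h \<in> tangent (2 * J) \<and> odd (h $ Suc (2 * J))"
proof (cases "odd J")
  case True
  show ?thesis
    by (rule derived_odd_at_2_mod_4[of _ j "J - 2 * j"]) (use assms True in auto)
next
  case False
  show ?thesis
    by (rule derived_odd_at_0_mod_4[of _ "j - 1" "J - 2 * j + 1"]) (use assms False in auto)
qed

lemma nth_compose_depth_2d_plus_1:
  assumes "f \<in> tangent d" "g \<in> tangent d" "2 \<le> d"
  shows "(f oo g) $ Suc (2 * d + 1) = f $ Suc (2 * d + 1) + g $ Suc (2 * d + 1)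
    + (int (Suc d) * f $ Suc d * g $ Suc (Suc d) + int (Suc (Suc d)) * f $ Suc (Suc d) * g $ Suc d)"
proof -
  have "2 * d + 1 - d = Suc d" by simp
  then show ?thesis
    using nth_compose_quadratic[OF assms(1,2), of "2 * d + 1"] assms(3)
    by (simp add: sum.cl_ivl_Suc)
qed

text \<open>The coordinates belong to the \<open>j + 1\<close> even depths \<open>2 * J\<close> with
  \<open>d < J \<le> 3 * j + 1\<close>, those not reached by \<open>derived_odd_even_depth\<close>.
  As \<open>j\<close> is odd, exchanging \<open>f\<close> and \<open>g\<close> changes the last one
  by \<open>f_{2j+1} g_{2j+2} - g_{2j+1} f_{2j+2}\<close> modulo 2. The coefficient at depth
  \<open>2 * d + 1\<close> has the same defect and is therefore added in
  \<open>\<psi> j\<close>.\<close>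

lemma J_H1_2_mod_4:
  assumes j: "odd j"
  shows "J_H1 (Suc (2 * j)) \<cong>
    power_group integer_group (Suc (2 * j)) \<times>\<times> power_group (integer_mod_group 2) (j + 1)"
proof -
  define d where "d = 2 * j"
  have j0: "0 < j" using j by (cases j) auto
  have d: "d = 2 * j \<or> d = 2 * j - 1" "2 \<le> d" "0 < d" using j0 by (auto simp: d_def)
  define \<psi> :: "nat \<Rightarrow> int fps \<Rightarrow> int"
    where "\<psi> i f = f $ (2 * (d + 1 + i) + 1) + (if i = j then f $ Suc (2 * d + 1) else 0)" for i f
  have deep: "(h oo f) $ Suc (2 * d + 1) = h $ Suc (2 * d + 1) + f $ Suc (2 * d + 1)"
    if "h \<in> tangent (2 * d + 1)" "f \<in> tangent d" for h f
    using nth_compose_deep[OF that, of "2 * d + 1"] d by simp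
  have comm: "even (\<psi> i (f oo g) - \<psi> i (g oo f))"
    if i: "i < j + 1" and f: "f \<in> tangent d" and g: "g \<in> tangent d" for i f g
  proof -
    consider "i < j - 1" | "i = j - 1" | "i = j" using i by linarith
    then show ?thesis
    proof cases
      case 1
      then have "i \<noteq> j" by simp
      then show ?thesis
        using nth_commute_mod_2_zero[OF f g d(1,2), of "d + 1 + i"] 1 j0 by (simp add: \<psi>_def d_def)
    next
      case 2
      \<comment> \<open>At \<open>J = 3 * j\<close> the only first-order term is
        \<open>j f_{2j+1} g_{2j+1}\<close>, which is symmetric.\<close>
      have "d + 1 + i = 3 * j" "3 * j - d = j" "Suc (3 * j - j) = 2 * j + 1" "i \<noteq> j"
        using 2 j0 by (auto simp: d_def)
      then show ?thesis
        using nth_commute_mod_2[OF f g d(1,2), of "3 * j"] j0 by (simp add: \<psi>_def mult.commute)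
    next
      case 3
      have idx: "d + 1 + i = 3 * j + 1" "3 * j + 1 - d = Suc j" "3 * j + 1 - j = 2 * j + 1"
        "3 * j + 1 - Suc j = 2 * j" using 3 by (auto simp: d_def)
      have R: "(\<Sum>i=j..3*j+1-d. int i * f $ (2 * i + 1) * g $ Suc (3 * j + 1 - i))
          = int j * f $ (2 * j + 1) * g $ Suc (2 * j + 1)
            + int (Suc j) * f $ (2 * Suc j + 1) * g $ Suc (2 * j)" for f g :: "int fps"
        unfolding idx(2) by (simp only: sum.cl_ivl_Suc idx) simp
      have "\<psi> i (f oo g) - \<psi> i (g oo f) = ((f oo g) $ (2 * (3 * j + 1) + 1) - (g oo f) $ (2 * (3 * j + 1) + 1))
          + ((f oo g) $ Suc (2 * d + 1) - (g oo f) $ Suc (2 * d + 1))"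
        using 3 idx by (simp add: \<psi>_def)
      moreover have "even ((f oo g) $ Suc (2 * d + 1) - (g oo f) $ Suc (2 * d + 1)
          - (f $ (2 * j + 1) * g $ Suc (2 * j + 1) - g $ (2 * j + 1) * f $ Suc (2 * j + 1)))"
        unfolding nth_compose_depth_2d_plus_1[OF f g d(2)] nth_compose_depth_2d_plus_1[OF g f d(2)]
        by (simp add: d_def)
      moreover have "even ((f oo g) $ (2 * (3 * j + 1) + 1) - (g oo f) $ (2 * (3 * j + 1) + 1)
          - (f $ (2 * j + 1) * g $ Suc (2 * j + 1) - g $ (2 * j + 1) * f $ Suc (2 * j + 1)))"
        using nth_commute_mod_2[OF f g d(1,2), of "3 * j + 1", unfolded R] j by simp
      moreover have "even (u - z) \<Longrightarrow> even (v - z) \<Longrightarrow> even (u + v)" for u v z :: int by presburger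
      ultimately show ?thesis by metis
    qed
  qed
  \<comment> \<open>The only cross term is \<open>h $ (2 * (d + 1) + 1) * f $ (2 * j + 1)\<close>,
    at \<open>i = j\<close>; its first factor is the coordinate \<open>\<psi> 0 h\<close>.\<close>
  have low: "even ((h oo f) $ (2 * (d + 1 + i) + 1) - h $ (2 * (d + 1 + i) + 1) - f $ (2 * (d + 1 + i) + 1))"
    if "h \<in> tangent (2 * d + 1)" "f \<in> tangent d" "i < j \<or> i = j \<and> even (h $ (2 * (d + 1) + 1))" for h f i
  proof (rule nth_compose_deep_mod_2[OF that(1,2) d(1,2)])
    fix i' assume "d < i'" "i' + j \<le> d + 1 + i"
    then have "i' = d + 1 \<and> i = j" using that(3) by (auto simp: d_def)
    then show "even (h $ (2 * i' + 1)) \<or> f $ (2 * (d + 1 + i - i') + 1) = 0" using that(3) by auto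
  qed (use that(3) in \<open>auto simp: d_def\<close>)
  have "J_H1 (Suc d) \<cong> power_group integer_group (Suc d) \<times>\<times> power_group (integer_mod_group 2) (j + 1)"
  proof (rule J_H1_iso_mod_2[where \<psi> = \<psi> and n = "6 * j + 6", OF d(3) comm])
    fix h f i assume h: "h \<in> tangent (2 * d + 1)" and f: "f \<in> tangent d"
      and ev: "\<And>i. i < j + 1 \<Longrightarrow> even (\<psi> i (h oo f) - \<psi> i f)" and i: "i < j + 1"
    have eq: "\<psi> i h = (\<psi> i (h oo f) - \<psi> i f) - ((h oo f) $ (2 * (d + 1 + i) + 1)
        - h $ (2 * (d + 1 + i) + 1) - f $ (2 * (d + 1 + i) + 1))" for i
      using deep[OF h f] by (simp add: \<psi>_def)
    have base: "even (\<psi> i h)" if "i < j" for i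
      unfolding eq[of i] by (rule dvd_diff[OF ev low[OF h f]]) (use that in auto)
    then have "even (h $ (2 * (d + 1) + 1))" using base[OF j0] j0 by (simp add: \<psi>_def)
    then show "even (\<psi> i h)"
      unfolding eq[of i] by (intro dvd_diff[OF ev low[OF h f]]) (use i in auto)
  next
    fix i f g assume i: "i < j + 1" and f: "f \<in> tangent (2 * d + 1)" and g: "g \<in> tangent (2 * d + 1)"
    have "g \<in> tangent d" by (rule tangent_mono[OF g]) simp
    then have "\<psi> i (f oo g) - \<psi> i f - \<psi> i g = (f oo g) $ (2 * (d + 1 + i) + 1)
        - f $ (2 * (d + 1 + i) + 1) - g $ (2 * (d + 1 + i) + 1)"
      using deep[OF f, of g] by (simp add: \<psi>_def)
    also have "even \<dots>"
      by (rule nth_compose_deep_mod_2'[OF f g d(1,2)]) (use i in \<open>auto simp: d_def\<close>)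
    finally show "even (\<psi> i (f oo g) - \<psi> i f - \<psi> i g)" .
  next
    fix t :: "nat \<Rightarrow> int"
    obtain h where h: "h \<in> tangent (2 * d + 1)"
      "\<And>n. 2 * d + 1 < n \<Longrightarrow> h $ n = (if odd n then t (n div 2 - (d + 1)) else 0)"
      using tangent_with_coefficients[of "2 * d + 1" "\<lambda>n. if odd n then t (n div 2 - (d + 1)) else 0"]
      by blast
    have "\<psi> i h = t i" for i using h(2) by (simp add: \<psi>_def)
    then show "\<exists>h\<in>tangent (2 * d + 1). \<forall>i<j + 1. \<psi> i h = t i" using h(1) by blast
  next
    fix i and f g :: "int fps" assume "i < j + 1" "agree (6 * j + 6) f g"
    then show "\<psi> i f = \<psi> i g" by (auto simp: \<psi>_def agree_def d_def)
  next
    fix N w assume N: "2 * d < N" "even N" and w: "w \<in> tangent N"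
      and ev: "\<And>i. i < j + 1 \<Longrightarrow> even (\<psi> i w)"
    obtain J where J: "N = 2 * J" using N(2) by (elim evenE)
    show "even (w $ Suc N) \<or> (\<exists>h\<in>J_derived d. h \<in> tangent N \<and> odd (h $ Suc N))"
    proof (cases "3 * j + 2 \<le> J")
      case True
      then show ?thesis using derived_odd_even_depth[OF j0 True] by (simp add: J d_def)
    next
      case False
      \<comment> \<open>An even \<open>N\<close> above \<open>2 * d\<close> is at least
        \<open>2 * d + 2\<close>, so the compensating coefficient of \<open>w\<close>
        vanishes.\<close>
      have w0: "w $ Suc (2 * d + 1) = 0" using w N by (auto simp: tangent_nth J)
      have idx: "2 * (d + 1 + (J - (d + 1))) + 1 = Suc N" using N by (auto simp: J)
      have "\<psi> (J - (d + 1)) w = w $ Suc N" unfolding \<psi>_def idx w0 by simp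
      then show ?thesis using ev[of "J - (d + 1)"] False by (simp add: d_def)
    qed
  qed
  then show ?thesis by (simp add: d_def)
qed


text \<open>For odd \<open>d\<close> the defect sits at \<open>J = 3 * j - 1\<close>, where the
  single first-order term \<open>j f_{2j+1} g_{2j}\<close> is left; again the coefficient at depth
  \<open>2 * d + 1\<close> has the same defect. At \<open>J = 3 * j\<close> one first-order term is
  symmetric and the other has the even factor \<open>j + 1\<close>. For \<open>j = 1\<close> cubic
  terms would interfere.\<close>

lemma J_H1_1_mod_4:
  assumes j: "odd j" "2 \<le> j"
  shows "J_H1 (2 * j) \<cong>
    power_group integer_group (2 * j) \<times>\<times> power_group (integer_mod_group 2) (j + 1)"
proof -
  define d where "d = 2 * j - 1"
  have j3: "3 \<le> j" using j by (cases "j = 2") auto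
  have d: "d = 2 * j \<or> d = 2 * j - 1" "2 \<le> d" "0 < d" and Suc_d: "Suc d = 2 * j"
    using j3 by (auto simp: d_def)
  define \<psi> :: "nat \<Rightarrow> int fps \<Rightarrow> int"
    where "\<psi> i f = f $ (2 * (2 * j + i) + 1) + (if i = j - 1 then f $ Suc (2 * d + 1) else 0)" for i f
  have deep: "(h oo f) $ Suc (2 * d + 1) = h $ Suc (2 * d + 1) + f $ Suc (2 * d + 1)"
    if "h \<in> tangent (2 * d + 1)" "f \<in> tangent d" for h f
    using nth_compose_deep[OF that, of "2 * d + 1"] d by simp
  have comm: "even (\<psi> i (f oo g) - \<psi> i (g oo f))"
    if i: "i < j + 1" and f: "f \<in> tangent d" and g: "g \<in> tangent d" for i f g
  proof -
    consider "i < j - 1" | "i = j - 1" | "i = j" using i by linarith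
    then show ?thesis
    proof cases
      case 1
      then have "i \<noteq> j - 1" by simp
      moreover have "even ((f oo g) $ (2 * (2 * j + i) + 1) - (g oo f) $ (2 * (2 * j + i) + 1))"
        by (rule nth_commute_mod_2_zero[OF f g d(1,2)]) (use 1 j3 in \<open>auto simp: d_def\<close>)
      ultimately show ?thesis by (simp add: \<psi>_def)
    next
      case 2
      define J where "J = 3 * j - 1"
      have idx: "2 * j + i = J" "J - d = j" "Suc (J - j) = 2 * j" "0 < J" "J \<le> 3 * j + 1"
        using 2 j3 by (auto simp: d_def J_def)
      have "\<psi> i (f oo g) - \<psi> i (g oo f) = ((f oo g) $ (2 * J + 1) - (g oo f) $ (2 * J + 1))
          + ((f oo g) $ Suc (2 * d + 1) - (g oo f) $ Suc (2 * d + 1))"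
        unfolding \<psi>_def idx(1) using 2 by simp
      moreover have "even ((f oo g) $ Suc (2 * d + 1) - (g oo f) $ Suc (2 * d + 1)
          - (f $ (2 * j + 1) * g $ (2 * j) - g $ (2 * j + 1) * f $ (2 * j)))"
        unfolding nth_compose_depth_2d_plus_1[OF f g d(2)] nth_compose_depth_2d_plus_1[OF g f d(2)]
          Suc_d by simp
      moreover have "even ((f oo g) $ (2 * J + 1) - (g oo f) $ (2 * J + 1)
          - (f $ (2 * j + 1) * g $ (2 * j) - g $ (2 * j + 1) * f $ (2 * j)))"
        using nth_commute_mod_2[OF f g d(1,2) idx(4,5)] j(1) by (simp add: idx(2,3))
      moreover have "even (u - z) \<Longrightarrow> even (v - z) \<Longrightarrow> even (u + v)" for u v z :: int by presburger
      ultimately show ?thesis by metis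
    next
      case 3
      define J where "J = 3 * j"
      have idx: "2 * j + i = J" "J - d = Suc j" "J - j = 2 * j" "J - Suc j = d" "i \<noteq> j - 1"
        "0 < J" "J \<le> 3 * j + 1"
        using 3 j3 by (auto simp: d_def J_def)
      have R: "(\<Sum>i=j..J-d. int i * f $ (2 * i + 1) * g $ Suc (J - i))
          = int j * f $ (2 * j + 1) * g $ Suc (2 * j)
            + int (Suc j) * f $ (2 * Suc j + 1) * g $ Suc d" for f g :: "int fps"
        unfolding idx(2) by (simp add: sum.cl_ivl_Suc idx(3,4))
      have "even ((f oo g) $ (2 * J + 1) - (g oo f) $ (2 * J + 1))"
        using nth_commute_mod_2[OF f g d(1,2) idx(6,7), unfolded R] j(1) by (simp add: mult.commute)
      then show ?thesis unfolding \<psi>_def idx(1) using idx(5) by simp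
    qed
  qed
  have low: "even ((h oo f) $ (2 * (2 * j + i) + 1) - h $ (2 * (2 * j + i) + 1) - f $ (2 * (2 * j + i) + 1))"
    if "h \<in> tangent (2 * d + 1)" "f \<in> tangent d" "i < j \<or> i = j \<and> even (h $ (2 * (2 * j) + 1))" for h f i
  proof (rule nth_compose_deep_mod_2[OF that(1,2) d(1,2)])
    fix i' assume "d < i'" "i' + j \<le> 2 * j + i"
    then have "i' = 2 * j \<and> i = j" using that(3) by (auto simp: d_def)
    then show "even (h $ (2 * i' + 1)) \<or> f $ (2 * (2 * j + i - i') + 1) = 0" using that(3) by auto
  qed (use that(3) j3 in auto)
  have "J_H1 (Suc d) \<cong> power_group integer_group (Suc d) \<times>\<times> power_group (integer_mod_group 2) (j + 1)"
  proof (rule J_H1_iso_mod_2[where \<psi> = \<psi> and n = "6 * j + 6", OF d(3) comm])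
    fix h f i assume h: "h \<in> tangent (2 * d + 1)" and f: "f \<in> tangent d"
      and ev: "\<And>i. i < j + 1 \<Longrightarrow> even (\<psi> i (h oo f) - \<psi> i f)" and i: "i < j + 1"
    have eq: "\<psi> i h = (\<psi> i (h oo f) - \<psi> i f) - ((h oo f) $ (2 * (2 * j + i) + 1)
        - h $ (2 * (2 * j + i) + 1) - f $ (2 * (2 * j + i) + 1))" for i
      using deep[OF h f] by (simp add: \<psi>_def)
    have base: "even (\<psi> i h)" if "i < j" for i
      unfolding eq[of i] by (rule dvd_diff[OF ev low[OF h f]]) (use that in auto)
    have "0 < j" "0 \<noteq> j - 1" using j3 by auto
    then have "even (h $ (2 * (2 * j) + 1))" using base[of 0] by (simp add: \<psi>_def)
    then show "even (\<psi> i h)"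
      unfolding eq[of i] by (intro dvd_diff[OF ev low[OF h f]]) (use i in auto)
  next
    fix i f g assume i: "i < j + 1" and f: "f \<in> tangent (2 * d + 1)" and g: "g \<in> tangent (2 * d + 1)"
    have "g \<in> tangent d" by (rule tangent_mono[OF g]) simp
    then have "\<psi> i (f oo g) - \<psi> i f - \<psi> i g = (f oo g) $ (2 * (2 * j + i) + 1)
        - f $ (2 * (2 * j + i) + 1) - g $ (2 * (2 * j + i) + 1)"
      using deep[OF f, of g] by (simp add: \<psi>_def)
    also have "even \<dots>"
      by (rule nth_compose_deep_mod_2'[OF f g d(1,2)]) (use i j3 in auto)
    finally show "even (\<psi> i (f oo g) - \<psi> i f - \<psi> i g)" .
  next
    fix t :: "nat \<Rightarrow> int"
    obtain h where h: "h \<in> tangent (2 * d + 1)"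
      "\<And>n. 2 * d + 1 < n \<Longrightarrow> h $ n = (if odd n then t (n div 2 - 2 * j) else 0)"
      using tangent_with_coefficients[of "2 * d + 1" "\<lambda>n. if odd n then t (n div 2 - 2 * j) else 0"]
      by blast
    have "2 * d + 1 < 2 * (2 * j + i) + 1" for i using j3 by (simp add: d_def)
    moreover have "(2 * (2 * j + i) + 1) div 2 - 2 * j = i" for i by simp
    moreover have "h $ Suc (2 * d + 1) = 0" using h(2) by simp
    ultimately have "\<psi> i h = t i" for i by (simp only: \<psi>_def h(2)) simp
    then show "\<exists>h\<in>tangent (2 * d + 1). \<forall>i<j + 1. \<psi> i h = t i" using h(1) by blast
  next
    fix i and f g :: "int fps" assume "i < j + 1" "agree (6 * j + 6) f g"
    then show "\<psi> i f = \<psi> i g" by (auto simp: \<psi>_def agree_def d_def)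
  next
    fix N w assume N: "2 * d < N" "even N" and w: "w \<in> tangent N"
      and ev: "\<And>i. i < j + 1 \<Longrightarrow> even (\<psi> i w)"
    obtain J where J: "N = 2 * J" using N(2) by (elim evenE)
    show "even (w $ Suc N) \<or> (\<exists>h\<in>J_derived d. h \<in> tangent N \<and> odd (h $ Suc N))"
    proof (cases "3 * j + 1 \<le> J")
      case True
      have "0 < j" "3 * j \<le> J" using True j3 by auto
      \<comment> \<open>As \<open>j\<close> is odd, \<open>3 * j + 1\<close> is even, so an odd
        \<open>J\<close> in this range starts at \<open>3 * j + 2\<close>.\<close>
      moreover have "3 * j + 2 \<le> J" if "odd J"
        using True j(1) that by (cases "J = 3 * j + 1") auto
      ultimately show ?thesis using derived_odd_odd_depth[of j J] by (simp add: J d_def)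
    next
      case False
      have w0: "w $ Suc (2 * d + 1) = 0" using w N by (auto simp: tangent_nth J)
      have idx: "2 * (2 * j + (J - 2 * j)) + 1 = Suc N" using N by (auto simp: J d_def)
      have "\<psi> (J - 2 * j) w = w $ Suc N" unfolding \<psi>_def idx w0 by simp
      then show ?thesis using ev[of "J - 2 * j"] False by simp
    qed
  qed
  then show ?thesis by (simp only: Suc_d)
qed

section \<open>The case \<open>k = 2\<close>\<close>

lemma J_H1_k_2:
  "J_H1 2 \<cong> power_group integer_group 2 \<times>\<times> power_group (integer_mod_group 2) 2"
proof -
  \<comment> \<open>Modulo 2, exchanging \<open>f\<close> and \<open>g\<close> changes the
    coefficients 4 and 5 by the same amount \<open>f_3 g_2 + g_3 f_2\<close>, and the coefficient 7
    by the cubic \<open>f_3 g_3 (f_2 + g_2)\<close>. The product \<open>f $ 3 * f $ 5\<close>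
    changes by this cubic plus \<open>f_3 g_2 + g_3 f_2\<close>, and \<open>f $ 4\<close> cancels
    the latter.\<close>
  define \<psi> :: "nat \<Rightarrow> int fps \<Rightarrow> int"
    where "\<psi> i f = (if i = 0 then f $ 5 + f $ 4 else f $ 7 + f $ 3 * f $ 5 + f $ 4)" for i f
  have coeff: "(f oo g) $ 3 = f $ 3 + g $ 3 + 2 * f $ 2 * g $ 2"
    "(f oo g) $ 4 = f $ 4 + g $ 4 + f $ 2 * (2 * g $ 3 + g $ 2 * g $ 2) + 3 * f $ 3 * g $ 2"
    "even ((f oo g) $ 5 - (f $ 5 + g $ 5 + f $ 3 * g $ 2 + f $ 3 * g $ 3))"
    "even ((f oo g) $ 7 - (f $ 7 + g $ 7 + f $ 3 * (g $ 3 + g $ 3 * g $ 2 + g $ 5) + f $ 5 * g $ 3))"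
    if f: "f \<in> tangent 1" and g: "g \<in> tangent 1" for f g
  proof -
    have g01: "g $ 0 = 0" "g $ 1 = 1" "g $ Suc 0 = 1" and f01: "f $ 1 = 1" "f $ Suc 0 = 1"
      using f g by (simp_all add: tangent_nth)
    have pow: "(g ^ i) $ (i + 1) = int i * g $ 2" for i
      using nth_power_second_order[OF g, of 1 i] by (simp add: numeral_2_eq_2)
    have pow': "(g ^ i) $ (i + 2) = int i * g $ 3 + int (i choose 2) * (g $ 2 * g $ 2)" for i
      using nth_power_second_order[OF g, of 2 i] by (simp add: numeral_2_eq_2 numeral_3_eq_3)
    have p: "(g ^ 2) $ 2 = 1" "(g ^ 3) $ 3 = 1" "(g ^ 2) $ 1 = 0" "(g ^ 2) $ 0 = 0"
      "(g ^ 3) $ 0 = 0" "(g ^ 3) $ 1 = 0" "(g ^ 3) $ 2 = 0"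
      using nth_power_tangent(1)[OF g, of 2] nth_power_tangent(1)[OF g, of 3]
        nth_power_tangent(2)[OF g, of _ 2] nth_power_tangent(2)[OF g, of _ 3] by simp_all
    have p3: "(g ^ 2) $ 3 = 2 * g $ 2" using pow[of 2] by simp
    have p4: "(g ^ 2) $ 4 = 2 * g $ 3 + g $ 2 * g $ 2" using pow'[of 2] by simp
    have p5: "(g ^ 3) $ 4 = 3 * g $ 2" using pow[of 3] by simp
    have sets: "{0..2} = {0, 1, 2::nat}" "{0..3} = {0, 1, 2, 3::nat}" "{1..2} = {1, 2::nat}" by auto
    show "(f oo g) $ 3 = f $ 3 + g $ 3 + 2 * f $ 2 * g $ 2"
      using nth_compose_tangent[OF f g, of 2] p3 by (simp del: power_Suc flip: numeral_2_eq_2)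
    show "(f oo g) $ 4 = f $ 4 + g $ 4 + f $ 2 * (2 * g $ 3 + g $ 2 * g $ 2) + 3 * f $ 3 * g $ 2"
      using nth_compose_tangent[OF f g, of 3] p4 p5 sets by (simp del: power_Suc flip: numeral_2_eq_2)
    show "even ((f oo g) $ 5 - (f $ 5 + g $ 5 + f $ 3 * g $ 2 + f $ 3 * g $ 3))"
      using nth_compose_mod_2[of f g 2] p g01 f01 unfolding sets by simp blast
    show "even ((f oo g) $ 7 - (f $ 7 + g $ 7 + f $ 3 * (g $ 3 + g $ 3 * g $ 2 + g $ 5) + f $ 5 * g $ 3))"
      using nth_compose_mod_2[of f g 3] p p3 g01 f01 unfolding sets by simp blast
  qed
  have "J_H1 (Suc 1) \<cong> power_group integer_group (Suc 1) \<times>\<times> power_group (integer_mod_group 2) 2"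
  proof (rule J_H1_iso_mod_2[where \<psi> = \<psi> and n = 8, OF zero_less_one])
    fix i f g assume "i < (2::nat)" and f: "f \<in> tangent 1" and g: "g \<in> tangent 1"
    then show "even (\<psi> i (f oo g) - \<psi> i (g oo f))"
      using coeff(3,4)[OF f g] coeff(3,4)[OF g f]
      by (simp add: \<psi>_def coeff(1,2)[OF f g] coeff(1,2)[OF g f]) argo
  next
    fix h f i assume h: "h \<in> tangent (2 * 1 + 1)" and f: "f \<in> tangent 1" and i: "i < (2::nat)"
      and ev: "\<And>i. i < 2 \<Longrightarrow> even (\<psi> i (h oo f) - \<psi> i f)"
    have h1: "h \<in> tangent 1" by (rule tangent_mono[OF h]) simp
    have h23: "h $ 2 = 0" "h $ 3 = 0" using h by (simp_all add: tangent_nth)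
    show "even (\<psi> i h)"
      using ev[of 0] ev[of 1] coeff(3,4)[OF h1 f] i
      by (simp add: \<psi>_def coeff(1,2)[OF h1 f] h23) argo
  next
    fix i f g assume "i < (2::nat)" and f: "f \<in> tangent (2 * 1 + 1)" and g: "g \<in> tangent (2 * 1 + 1)"
    have f1: "f \<in> tangent 1" by (rule tangent_mono[OF f]) simp
    have g1: "g \<in> tangent 1" by (rule tangent_mono[OF g]) simp
    have "f $ 2 = 0" "f $ 3 = 0" "g $ 2 = 0" "g $ 3 = 0" using f g by (simp_all add: tangent_nth)
    then show "even (\<psi> i (f oo g) - \<psi> i f - \<psi> i g)"
      using coeff(3,4)[OF f1 g1] by (simp add: \<psi>_def coeff(1,2)[OF f1 g1]) argo
  next
    fix t :: "nat \<Rightarrow> int"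
    obtain h where h: "h \<in> tangent (2 * 1 + 1)"
      "\<And>n. 2 * 1 + 1 < n \<Longrightarrow> h $ n = (if odd n then t (n div 2 - 2) else 0)"
      using tangent_with_coefficients[of "2 * 1 + 1" "\<lambda>n. if odd n then t (n div 2 - 2) else 0"]
      by blast
    have "h $ 3 = 0" using h(1) by (simp add: tangent_nth)
    then have "\<psi> i h = t i" if "i < 2" for i
      using that h(2)[of 4] h(2)[of 5] h(2)[of 7] by (auto simp: \<psi>_def less_2_cases_iff)
    then show "\<exists>h\<in>tangent (2 * 1 + 1). \<forall>i<2. \<psi> i h = t i" using h(1) by blast
  next
    fix i and f g :: "int fps" assume "i < (2::nat)" "agree 8 f g"
    then show "\<psi> i f = \<psi> i g" by (auto simp: \<psi>_def agree_def)
  next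
    fix N w assume N: "2 * 1 < N" "even N" and w: "w \<in> tangent N"
      and ev: "\<And>i. i < 2 \<Longrightarrow> even (\<psi> i w)"
    obtain J where J: "N = 2 * J" using N(2) by (elim evenE)
    consider "J = 2" | "J = 3" | "4 \<le> J" using N J by linarith
    then show "even (w $ Suc N) \<or> (\<exists>h\<in>J_derived 1. h \<in> tangent N \<and> odd (h $ Suc N))"
    proof cases
      case 1
      then have "w $ 4 = 0" using w J by (simp add: tangent_nth)
      then show ?thesis using ev[of 0] J 1 by (simp add: \<psi>_def)
    next
      case 2
      then have "w $ 3 = 0" "w $ 4 = 0" using w J by (simp_all add: tangent_nth)
      then show ?thesis using ev[of 1] J 2 by (simp add: \<psi>_def)
    next
      case 3
      have "3 * 1 + 2 \<le> J" if "odd J" using 3 that by (cases "J = 4") auto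
      then show ?thesis using derived_odd_odd_depth[of 1 J] 3 J by simp
    qed
  qed
  then show ?thesis by (simp add: numeral_2_eq_2)
qed


section \<open>The cases with a summand Z/4\<close>

lemma four_dvd_add_twice:
  fixes x y z :: int
  assumes "4 dvd x + 2 * z" "even (y + z)"
  shows "4 dvd x + 2 * y"
proof -
  obtain u v where "x + 2 * z = 4 * u" "y + z = 2 * v" using assms by (metis dvdE)
  then have "x + 2 * y = 4 * (u + v - z)" by simp
  then show ?thesis by simp
qed

text \<open>For even \<open>j\<close> the defect at \<open>J = 3 * j + 1\<close> comes from
  \<open>f_{2j+3} g_{2j+1}\<close>. At depth \<open>2 * d + 2\<close> the products
  \<open>f_{2j+1} g_{2j+3}\<close> and \<open>f_{2j+3} g_{2j+1}\<close> have the weights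
  \<open>2 * j + 1\<close> and \<open>2 * j + 3\<close>, which differ by 2, so the defect there is
  exactly \<open>-2 z\<close>. Thus \<open>\<phi>\<close> joins the depths \<open>J = d + 1\<close>
  and \<open>J = 3 * j + 1\<close>, and \<open>j - 1\<close> depths remain for
  \<open>\<psi>\<close>.\<close>

lemma J_H1_0_mod_4_even_depth:
  assumes j: "even j" "2 \<le> j"
  shows "J_H1 (Suc (2 * j)) \<cong> power_group integer_group (Suc (2 * j))
    \<times>\<times> (integer_mod_group 4 \<times>\<times> power_group (integer_mod_group 2) (j - 1))"
proof -
  define d where "d = 2 * j"
  have d: "d = 2 * j \<or> d = 2 * j - 1" "2 \<le> d" "0 < d" using j by (auto simp: d_def)
  define \<phi> :: "int fps \<Rightarrow> int" where "\<phi> f = f $ Suc (2 * d + 2) + 2 * f $ (2 * (3 * j + 1) + 1)" for f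
  define \<psi> :: "nat \<Rightarrow> int fps \<Rightarrow> int" where "\<psi> i f = f $ (2 * (d + 2 + i) + 1)" for i f
  have deep: "(h oo f) $ Suc (2 * d + 2) = h $ Suc (2 * d + 2) + f $ Suc (2 * d + 2)"
    if "h \<in> tangent (2 * d + 1)" "f \<in> tangent d" for h f
    using nth_compose_deep[OF that, of "2 * d + 2"] d by simp
  have Q: "(f oo g) $ Suc (2 * d + 2) = f $ Suc (2 * d + 2) + g $ Suc (2 * d + 2)
      + (int (2 * j + 1) * f $ (2 * j + 1) * g $ (2 * j + 3)
        + int (2 * j + 2) * f $ (2 * j + 2) * g $ (2 * j + 2)
        + int (2 * j + 3) * f $ (2 * j + 3) * g $ (2 * j + 1))"
    if "f \<in> tangent d" "g \<in> tangent d" for f g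
  proof -
    have "2 * d + 2 - d = Suc (Suc d)" by simp
    then show ?thesis
      using nth_compose_quadratic[OF that, of "2 * d + 2"] j
      by (simp add: sum.cl_ivl_Suc d_def eval_nat_numeral)
  qed
  have commf: "4 dvd \<phi> (f oo g) - \<phi> (g oo f)" if f: "f \<in> tangent d" and g: "g \<in> tangent d" for f g
  proof -
    define J where "J = 3 * j + 1"
    define z where "z = f $ (2 * j + 1) * g $ (2 * j + 3) - g $ (2 * j + 1) * f $ (2 * j + 3)"
    have idx: "J - d = Suc j" "J - j = 2 * j + 1" "J - Suc j = 2 * j" "0 < J" "J \<le> 3 * j + 1"
      by (auto simp: d_def J_def)
    have R: "(\<Sum>i=j..J-d. int i * f $ (2 * i + 1) * g $ Suc (J - i))
        = int j * f $ (2 * j + 1) * g $ (2 * j + 2) + int (Suc j) * f $ (2 * j + 3) * g $ (2 * j + 1)"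
      for f g :: "int fps"
      unfolding idx(1) by (simp add: sum.cl_ivl_Suc idx(2,3) eval_nat_numeral)
    have A: "even ((f oo g) $ (2 * J + 1) - (g oo f) $ (2 * J + 1) + z)"
      using nth_commute_mod_2[OF f g d(1,2) idx(4,5), unfolded R] j(1) by (simp add: z_def) argo
    have "((f oo g) $ Suc (2 * d + 2) - (g oo f) $ Suc (2 * d + 2)) + 2 * z = 0"
      unfolding Q[OF f g] Q[OF g f] by (simp add: z_def algebra_simps)
    then have "4 dvd ((f oo g) $ Suc (2 * d + 2) - (g oo f) $ Suc (2 * d + 2)) + 2 * z"
      by (simp only: dvd_0_right)
    from four_dvd_add_twice[OF this A] show ?thesis by (simp add: \<phi>_def J_def algebra_simps)
  qed
  have comm: "even (\<psi> i (f oo g) - \<psi> i (g oo f))"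
    if i: "i < j - 1" and f: "f \<in> tangent d" and g: "g \<in> tangent d" for i f g
  proof (cases "i = j - 2")
    case True
    have "d + 2 + i = 3 * j" "3 * j - d = j" "Suc (3 * j - j) = 2 * j + 1"
      using True j by (auto simp: d_def)
    then show ?thesis
      using nth_commute_mod_2[OF f g d(1,2), of "3 * j"] j by (simp add: \<psi>_def mult.commute)
  next
    case False
    show ?thesis unfolding \<psi>_def
      by (rule nth_commute_mod_2_zero[OF f g d(1,2)]) (use False i in \<open>auto simp: d_def\<close>)
  qed
  have low: "even ((h oo f) $ (2 * J + 1) - h $ (2 * J + 1) - f $ (2 * J + 1))"
    if "h \<in> tangent (2 * d + 1)" "f \<in> tangent d" "0 < J"
      "J \<le> 3 * j \<or> J = 3 * j + 1 \<and> even (h $ (2 * (d + 1) + 1))" for h f J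
  proof (rule nth_compose_deep_mod_2[OF that(1,2) d(1,2) that(3)])
    fix i' assume "d < i'" "i' + j \<le> J"
    then have "i' = d + 1 \<and> J = 3 * j + 1" using that(4) by (auto simp: d_def)
    then show "even (h $ (2 * i' + 1)) \<or> f $ (2 * (J - i') + 1) = 0" using that(4) by auto
  qed (use that(4) in auto)
  have "J_H1 (Suc d) \<cong> power_group integer_group (Suc d)
    \<times>\<times> (integer_mod_group 4 \<times>\<times> power_group (integer_mod_group 2) (j - 1))"
  proof (rule J_H1_iso_mod_4[where \<phi> = \<phi> and \<psi> = \<psi> and n = "6 * j + 6", OF d(3) commf comm])
    fix h f assume h: "h \<in> tangent (2 * d + 1)" and f: "f \<in> tangent d"
      and ev4: "4 dvd \<phi> (h oo f) - \<phi> f"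
      and ev: "\<And>i. i < j - 1 \<Longrightarrow> even (\<psi> i (h oo f) - \<psi> i f)"
    have "even (\<psi> i h)" if i: "i < j - 1" for i
    proof -
      have "even ((h oo f) $ (2 * (d + 2 + i) + 1) - h $ (2 * (d + 2 + i) + 1)
          - f $ (2 * (d + 2 + i) + 1))"
        by (rule low[OF h f]) (use i in \<open>auto simp: d_def\<close>)
      from dvd_diff[OF ev[OF i] this] show ?thesis by (simp add: \<psi>_def)
    qed
    moreover have "4 dvd \<phi> h"
    proof -
      \<comment> \<open>The parity of \<open>\<phi>\<close> sees only the early coefficient. Once
        that one is even for \<open>h\<close>, the cross term in the late coefficient is even, and
        divisibility by 4 can be read off.\<close>
      have "even (\<phi> (h oo f) - \<phi> f)" using dvd_trans[OF _ ev4, of 2] by simp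
      then have "even (h $ (2 * (d + 1) + 1))" using deep[OF h f] by (simp add: \<phi>_def) argo
      then have "even ((h oo f) $ (2 * (3 * j + 1) + 1) - h $ (2 * (3 * j + 1) + 1)
          - f $ (2 * (3 * j + 1) + 1))" using low[OF h f, of "3 * j + 1"] by simp
      then obtain v where "(h oo f) $ (2 * (3 * j + 1) + 1) - h $ (2 * (3 * j + 1) + 1)
          - f $ (2 * (3 * j + 1) + 1) = 2 * v" by (elim dvdE)
      then have "\<phi> h = (\<phi> (h oo f) - \<phi> f) - 4 * v" unfolding \<phi>_def deep[OF h f] by linarith
      then show ?thesis using ev4 by simp
    qed
    ultimately show "4 dvd \<phi> h \<and> (\<forall>i<j - 1. even (\<psi> i h))" by blast
  next
    fix f g assume f: "f \<in> tangent (2 * d + 1)" and g: "g \<in> tangent (2 * d + 1)"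
    have g': "g \<in> tangent d" by (rule tangent_mono[OF g]) simp
    have "even ((f oo g) $ (2 * (3 * j + 1) + 1) - f $ (2 * (3 * j + 1) + 1)
        - g $ (2 * (3 * j + 1) + 1))"
      by (rule nth_compose_deep_mod_2'[OF f g d(1,2)]) auto
    then obtain v where "(f oo g) $ (2 * (3 * j + 1) + 1) - f $ (2 * (3 * j + 1) + 1)
        - g $ (2 * (3 * j + 1) + 1) = 2 * v" by (elim dvdE)
    then have "\<phi> (f oo g) - \<phi> f - \<phi> g = 4 * v" unfolding \<phi>_def deep[OF f g'] by linarith
    then show "4 dvd \<phi> (f oo g) - \<phi> f - \<phi> g" by simp
    fix i assume "i < j - 1"
    then show "even (\<psi> i (f oo g) - \<psi> i f - \<psi> i g)"
      unfolding \<psi>_def by (intro nth_compose_deep_mod_2'[OF f g d(1,2)]) (auto simp: d_def)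
  next
    fix s :: int and t :: "nat \<Rightarrow> int"
    \<comment> \<open>The late coefficient, at index \<open>6 * j + 3\<close>, is set to 0, so that
      \<open>\<phi> h\<close> is just \<open>s\<close>.\<close>
    define c where "c n = (if n = Suc (2 * d + 2) then s else if n \<le> 6 * j + 1 then t (n div 2 - (d + 2)) else 0)" for n
    obtain h where h: "h \<in> tangent (2 * d + 1)" "\<And>n. 2 * d + 1 < n \<Longrightarrow> h $ n = c n"
      using tangent_with_coefficients[of "2 * d + 1" c] by blast
    have "\<phi> h = s" using h(2) j by (simp add: \<phi>_def c_def d_def)
    moreover have "\<psi> i h = t i" if "i < j - 1" for i using h(2) that by (simp add: \<psi>_def c_def d_def)
    ultimately show "\<exists>h\<in>tangent (2 * d + 1). \<phi> h = s \<and> (\<forall>i<j - 1. \<psi> i h = t i)" using h(1) by blast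
  next
    fix f g :: "int fps" assume ag: "agree (6 * j + 6) f g"
    then show "\<phi> f = \<phi> g" using j by (auto simp: \<phi>_def agree_def d_def)
    fix i assume "i < j - 1"
    then show "\<psi> i f = \<psi> i g" using ag by (auto simp: \<psi>_def agree_def d_def)
  next
    fix N w assume N: "2 * d < N" "even N" and w: "w \<in> tangent N"
      and ev4: "4 dvd \<phi> w" and ev: "\<And>i. i < j - 1 \<Longrightarrow> even (\<psi> i w)"
    obtain J where J: "N = 2 * J" using N(2) by (elim evenE)
    have ev2: "even (\<phi> w)" using dvd_trans[OF _ ev4, of 2] by simp
    consider "J = d + 1" | "d + 2 \<le> J" "J \<le> 3 * j" | "J = 3 * j + 1" | "3 * j + 2 \<le> J"
      using N(1) J by linarith
    then show "even (w $ Suc N) \<or> (\<exists>h\<in>J_derived d. h \<in> tangent N \<and> odd (h $ Suc N))"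
    proof cases
      case 1
      then show ?thesis using ev2 by (simp add: \<phi>_def J)
    next
      case 2
      have idx: "2 * (d + 2 + (J - (d + 2))) + 1 = Suc N" using 2 by (auto simp: J)
      have "J - (d + 2) < j - 1" using 2 by (auto simp: d_def)
      from ev[OF this] show ?thesis unfolding \<psi>_def idx by blast
    next
      case 3
      have "w $ Suc (2 * d + 2) = 0" using w 3 j by (auto simp: tangent_nth J d_def)
      then have "\<phi> w = 2 * w $ Suc N" using 3 by (simp add: \<phi>_def J)
      then have "2 * 2 dvd 2 * w $ Suc N" using ev4 by simp
      then show ?thesis unfolding dvd_mult_cancel_left by simp
    next
      case 4
      then show ?thesis using derived_odd_even_depth[of j J] j by (simp add: J d_def)
    qed
  qed
  then show ?thesis by (simp add: d_def)
qed


text \<open>The bound on \<open>d\<close> puts depth \<open>2 * d + 4\<close> below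
  \<open>3 * d\<close>, into the bilinear range.\<close>

lemma nth_compose_depth_2d_plus_4:
  assumes f: "f \<in> tangent d" and g: "g \<in> tangent d" and d: "5 \<le> d"
  shows "(f oo g) $ (2 * d + 5) = f $ (2 * d + 5) + g $ (2 * d + 5)
    + (int (d + 1) * f $ (d + 1) * g $ (d + 5) + int (d + 2) * f $ (d + 2) * g $ (d + 4)
      + int (d + 3) * f $ (d + 3) * g $ (d + 3) + int (d + 4) * f $ (d + 4) * g $ (d + 2)
      + int (d + 5) * f $ (d + 5) * g $ (d + 1))"
proof -
  have "2 * d + 4 - d = Suc (Suc (Suc (Suc d)))" by simp
  then show ?thesis
    using nth_compose_quadratic[OF f g, of "2 * d + 4"] d
    by (simp add: sum.cl_ivl_Suc eval_nat_numeral)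
qed

text \<open>Depth 10 exceeds \<open>3 * d = 9\<close>, so the fourth and fifth powers of
  \<open>g\<close> have to be expanded to second order.\<close>

lemma nth_compose_depth_3:
  assumes f: "f \<in> tangent 3" and g: "g \<in> tangent 3"
  shows "(f oo g) $ 8 = f $ 8 + g $ 8 + (4 * f $ 4 * g $ 5 + 5 * f $ 5 * g $ 4)"
    and "(f oo g) $ 11 = f $ 11 + g $ 11 + (f $ 4 * (4 * g $ 8 + 12 * g $ 4 * g $ 5)
      + f $ 5 * (5 * g $ 7 + 10 * g $ 4 * g $ 4) + 6 * f $ 6 * g $ 6 + 7 * f $ 7 * g $ 5
      + 8 * f $ 8 * g $ 4)"
proof -
  have sets: "{3..4} = {3, 4::nat}" "{3..9} = {3, 4, 5, 6, 7, 8, 9::nat}" by auto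
  have g23: "g $ 2 = 0" "g $ 3 = 0" using g by (simp_all add: tangent_nth)
  show "(f oo g) $ 8 = f $ 8 + g $ 8 + (4 * f $ 4 * g $ 5 + 5 * f $ 5 * g $ 4)"
    using nth_compose_quadratic[OF f g, of 7] sets by simp
  have "4 choose 2 = (6::nat)" "5 choose 2 = (10::nat)" by (simp_all add: choose_two)
  then have "(g ^ 4) $ 11 = 4 * g $ 8 + 12 * g $ 4 * g $ 5"
    "(g ^ 5) $ 11 = 5 * g $ 7 + 10 * g $ 4 * g $ 4"
    using nth_power_second_order[OF g, of 7 4] nth_power_second_order[OF g, of 6 5] sets by simp_all
  moreover have "(g ^ 6) $ 11 = 6 * g $ 6" "(g ^ 7) $ 11 = 7 * g $ 5" "(g ^ 8) $ 11 = 8 * g $ 4"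
    "(g ^ 9) $ 11 = 0" "(g ^ 10) $ 11 = 0"
    using nth_power_first_order[OF g, of 5 6] nth_power_first_order[OF g, of 4 7]
      nth_power_first_order[OF g, of 3 8] nth_power_first_order[OF g, of 2 9]
      nth_power_first_order[OF g, of 1 10] g23 by (simp_all flip: numeral_2_eq_2)
  ultimately show "(f oo g) $ 11 = f $ 11 + g $ 11 + (f $ 4 * (4 * g $ 8 + 12 * g $ 4 * g $ 5)
      + f $ 5 * (5 * g $ 7 + 10 * g $ 4 * g $ 4) + 6 * f $ 6 * g $ 6 + 7 * f $ 7 * g $ 5
      + 8 * f $ 8 * g $ 4)"
    using nth_compose_tangent[OF f g, of 10] sets by (simp del: power_Suc)
qed

text \<open>For \<open>k = 4\<close> the cubic terms of the composition already enter at depth \<open>2d + 4\<close>; the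
  coefficient at \<open>x\<^sup>8\<close> compensates for them.\<close>

definition mod_4_coord :: "nat \<Rightarrow> int fps \<Rightarrow> int" where
  "mod_4_coord j f = f $ (4 * j + 3) + (if j = 2 then 2 * f $ 8 else 0)"

text \<open>For \<open>j > 2\<close> and \<open>d = 2 * j - 1\<close> there are five bilinear terms:
  the outer weights \<open>d + 1\<close> and \<open>d + 5\<close> are divisible by 4, the middle
  term is symmetric, and the weights \<open>d + 2\<close> and \<open>d + 4\<close> are 1 and 3
  modulo 4, which yields \<open>-2 z\<close>. For \<open>j = 2\<close> a cubic term
  \<open>10 f_5 g_4^2\<close> appears, and \<open>2 * f $ 8\<close> adds \<open>10 f_5 g_4\<close>;
  since \<open>g_4^2 + g_4\<close> is even, the sum is divisible by 4.\<close>

lemma mod_4_coord_commute: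
  assumes j: "even j" "2 \<le> j" and f: "f \<in> tangent (2 * j - 1)" and g: "g \<in> tangent (2 * j - 1)"
  defines "z \<equiv> f $ (2 * j + 1) * g $ (2 * j + 3) - g $ (2 * j + 1) * f $ (2 * j + 3)"
  shows "4 dvd (mod_4_coord j (f oo g) - mod_4_coord j (g oo f)) + 2 * z"
proof (cases "j = 2")
  case True
  have f3: "f \<in> tangent 3" and g3: "g \<in> tangent 3" using f g True by simp_all
  have "even (g $ 4 * g $ 4 + g $ 4)" "even (f $ 4 * f $ 4 + f $ 4)" by simp_all
  then obtain u v where u: "g $ 4 * g $ 4 = 2 * u - g $ 4" and v: "f $ 4 * f $ 4 = 2 * v - f $ 4"
    by (metis add_diff_cancel_right' dvdE)
  have "(mod_4_coord j (f oo g) - mod_4_coord j (g oo f)) + 2 * z =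
      4 * (f $ 4 * g $ 8 - g $ 4 * f $ 8 + 2 * (f $ 8 * g $ 4 - g $ 8 * f $ 4)
        + 3 * f $ 4 * g $ 4 * (g $ 5 - f $ 5) + 2 * (f $ 4 * g $ 5 - g $ 4 * f $ 5))
      + 10 * (f $ 5 * (g $ 4 * g $ 4 + g $ 4) - g $ 5 * (f $ 4 * f $ 4 + f $ 4))"
    unfolding mod_4_coord_def z_def using True
    by (simp add: nth_compose_depth_3[OF f3 g3] nth_compose_depth_3[OF g3 f3] algebra_simps)
  also have "\<dots> = 4 * (f $ 4 * g $ 8 - g $ 4 * f $ 8 + 2 * (f $ 8 * g $ 4 - g $ 8 * f $ 4)
        + 3 * f $ 4 * g $ 4 * (g $ 5 - f $ 5) + 2 * (f $ 4 * g $ 5 - g $ 4 * f $ 5)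
        + 5 * (f $ 5 * u - g $ 5 * v))"
    unfolding u v by (simp add: algebra_simps)
  finally show ?thesis by simp
next
  case False
  define d where "d = 2 * j - 1"
  have "4 \<le> j" using j False by (cases "j = 3") auto
  then have d: "5 \<le> d" by (simp add: d_def)
  have idx: "2 * d + 5 = 4 * j + 3" "d + 1 = 2 * j" "d + 2 = 2 * j + 1" "d + 4 = 2 * j + 3"
    using j by (auto simp: d_def)
  obtain m where "j = 2 * m" using j(1) by (elim evenE)
  then have m: "int (d + 1) = 4 * int m" "int (d + 2) = 4 * int m + 1" "int (d + 3) = 4 * int m + 2"
    "int (d + 4) = 4 * int m + 3" "int (d + 5) = 4 * int m + 4"
    using idx(2) by linarith+
  note Q = nth_compose_depth_2d_plus_4[OF f[folded d_def] g[folded d_def] d]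
    nth_compose_depth_2d_plus_4[OF g[folded d_def] f[folded d_def] d]
  have "((f oo g) $ (2 * d + 5) - (g oo f) $ (2 * d + 5))
      + 2 * (f $ (d + 2) * g $ (d + 4) - g $ (d + 2) * f $ (d + 4)) =
      4 * (int m * (f $ (d + 1) * g $ (d + 5) - g $ (d + 1) * f $ (d + 5))
        + (int m + 1) * (f $ (d + 5) * g $ (d + 1) - g $ (d + 5) * f $ (d + 1)))"
    unfolding Q m by (simp only: algebra_simps)
  then show ?thesis unfolding mod_4_coord_def z_def idx using False by simp
qed

lemma mod_4_coord_deep:
  assumes j: "2 \<le> j" and h: "h \<in> tangent (4 * j - 1)" and f: "f \<in> tangent (2 * j - 1)"
  shows "4 dvd mod_4_coord j (h oo f) - mod_4_coord j h - mod_4_coord j f"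
proof (cases "j = 2")
  case True
  have h3: "h \<in> tangent 3" and f3: "f \<in> tangent 3"
    using h f True by (auto intro: tangent_mono)
  have "h $ 4 = 0" "h $ 5 = 0" "h $ 6 = 0" "h $ 7 = 0" using h True by (simp_all add: tangent_nth)
  then have "mod_4_coord j (h oo f) - mod_4_coord j h - mod_4_coord j f = 4 * (2 * h $ 8 * f $ 4)"
    using True by (simp add: mod_4_coord_def nth_compose_depth_3[OF h3 f3])
  then show ?thesis by simp
next
  case False
  have "(h oo f) $ Suc (4 * j + 2) = h $ Suc (4 * j + 2) + f $ Suc (4 * j + 2)"
    by (rule nth_compose_deep[of _ "2 * j - 1"]) (use h f j False in \<open>auto intro: tangent_mono\<close>)
  then show ?thesis using False by (simp add: mod_4_coord_def eval_nat_numeral)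
qed

text \<open>The products \<open>f_{2j+1} g_{2j+3}\<close> in the defect at
  \<open>J = 3 * j + 1\<close> have total depth \<open>4 * j + 2\<close>, which for this
  \<open>d\<close> is \<open>2 * d + 4\<close>; so the early partner is
  \<open>J = 2 * j + 1\<close>, not the first even depth above \<open>2 * d\<close>. The depth
  \<open>J = 3 * j\<close> needs no coordinate, as it is reached by products of commutators.\<close>

lemma J_H1_0_mod_4:
  assumes j: "even j" "2 \<le> j"
  shows "J_H1 (2 * j) \<cong> power_group integer_group (2 * j)
    \<times>\<times> (integer_mod_group 4 \<times>\<times> power_group (integer_mod_group 2) (j - 1))"
proof -
  define d where "d = 2 * j - 1"
  have d: "d = 2 * j \<or> d = 2 * j - 1" "2 \<le> d" "0 < d" and Suc_d: "Suc d = 2 * j"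
    and d2: "2 * d + 1 = 4 * j - 1" using j by (auto simp: d_def)
  \<comment> \<open>Skips \<open>J = 2 * j + 1\<close>, whose coefficient is part of
    \<open>\<phi>\<close>: the values are \<open>2 * j\<close> and then \<open>2 * j + 2\<close> up
    to \<open>3 * j - 1\<close>.\<close>
  define K where "K i = (if i = 0 then 2 * j else 2 * j + 1 + i)" for i
  have K: "0 < K i" "K i \<le> 3 * j - 1" if "i < j - 1" for i using that by (auto simp: K_def)
  define \<phi> :: "int fps \<Rightarrow> int" where "\<phi> f = mod_4_coord j f + 2 * f $ (2 * (3 * j + 1) + 1)" for f
  define \<psi> :: "nat \<Rightarrow> int fps \<Rightarrow> int" where "\<psi> i f = f $ (2 * K i + 1)" for i f
  have deep: "4 dvd mod_4_coord j (h oo f) - mod_4_coord j h - mod_4_coord j f"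
    if "h \<in> tangent (2 * d + 1)" "f \<in> tangent d" for h f
    using mod_4_coord_deep[OF j(2), of h f, folded d2, folded d_def] that by blast
  have \<phi>_even: "even (\<phi> f - f $ (4 * j + 3))" for f by (simp add: \<phi>_def mod_4_coord_def)
  have commf: "4 dvd \<phi> (f oo g) - \<phi> (g oo f)" if f: "f \<in> tangent d" and g: "g \<in> tangent d" for f g
  proof -
    define J where "J = 3 * j + 1"
    define z where "z = f $ (2 * j + 1) * g $ (2 * j + 3) - g $ (2 * j + 1) * f $ (2 * j + 3)"
    have idx: "J - d = Suc (Suc j)" "J - j = 2 * j + 1" "J - Suc j = 2 * j" "0 < J" "J \<le> 3 * j + 1"
      using j by (auto simp: d_def J_def)
    have R: "(\<Sum>i=j..J-d. int i * f $ (2 * i + 1) * g $ Suc (J - i))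
        = int j * f $ (2 * j + 1) * g $ (2 * j + 2) + int (Suc j) * f $ (2 * j + 3) * g $ (2 * j + 1)
          + int (j + 2) * f $ (2 * j + 5) * g $ Suc (J - (j + 2))" for f g :: "int fps"
      unfolding idx(1) by (simp add: sum.cl_ivl_Suc idx(2,3) eval_nat_numeral)
    have A: "even ((f oo g) $ (2 * J + 1) - (g oo f) $ (2 * J + 1) + z)"
      using nth_commute_mod_2[OF f g d(1,2) idx(4,5), unfolded R] j(1) by (simp add: z_def) argo
    have "4 dvd (mod_4_coord j (f oo g) - mod_4_coord j (g oo f)) + 2 * z"
      unfolding z_def by (rule mod_4_coord_commute[OF j f[unfolded d_def] g[unfolded d_def]])
    from four_dvd_add_twice[OF this A] show ?thesis by (simp add: \<phi>_def J_def algebra_simps)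
  qed
  have comm: "even (\<psi> i (f oo g) - \<psi> i (g oo f))"
    if i: "i < j - 1" and f: "f \<in> tangent d" and g: "g \<in> tangent d" for i f g
  proof (cases "K i = 3 * j - 1")
    case True
    have "3 * j - 1 - d = j" "0 < 3 * j - 1" "3 * j - 1 \<le> 3 * j + 1" using j by (auto simp: d_def)
    then show ?thesis
      using nth_commute_mod_2[OF f g d(1,2), of "3 * j - 1"] j(1) unfolding \<psi>_def True by simp
  next
    case False
    show ?thesis unfolding \<psi>_def
      by (rule nth_commute_mod_2_zero[OF f g d(1,2)]) (use False K[OF i] j in \<open>auto simp: d_def\<close>)
  qed
  \<comment> \<open>At \<open>J = 3 * j + 1\<close> two cross terms occur, with the coefficients of
    \<open>h\<close> at \<open>4 * j + 1\<close> and \<open>4 * j + 3\<close>. The first is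
    \<open>\<psi> 0 h\<close>, the second has the parity of \<open>\<phi> h\<close>.\<close>
  have low: "even ((h oo f) $ (2 * J + 1) - h $ (2 * J + 1) - f $ (2 * J + 1))"
    if "h \<in> tangent (2 * d + 1)" "f \<in> tangent d" "0 < J"
      "J \<le> 3 * j - 1 \<or> J = 3 * j + 1 \<and> even (h $ (2 * (2 * j) + 1)) \<and> even (h $ (2 * (2 * j + 1) + 1))"
    for h f J
  proof (rule nth_compose_deep_mod_2[OF that(1,2) d(1,2) that(3)])
    fix i' assume "d < i'" "i' + j \<le> J"
    then have "(i' = 2 * j \<or> i' = 2 * j + 1) \<and> J = 3 * j + 1" using that(4) j by (auto simp: d_def)
    then show "even (h $ (2 * i' + 1)) \<or> f $ (2 * (J - i') + 1) = 0" using that(4) j by auto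
  qed (use that(4) in auto)
  have "J_H1 (Suc d) \<cong> power_group integer_group (Suc d)
    \<times>\<times> (integer_mod_group 4 \<times>\<times> power_group (integer_mod_group 2) (j - 1))"
  proof (rule J_H1_iso_mod_4[where \<phi> = \<phi> and \<psi> = \<psi> and n = "6 * j + 6", OF d(3) commf comm])
    fix h f assume h: "h \<in> tangent (2 * d + 1)" and f: "f \<in> tangent d"
      and ev4: "4 dvd \<phi> (h oo f) - \<phi> f"
      and ev: "\<And>i. i < j - 1 \<Longrightarrow> even (\<psi> i (h oo f) - \<psi> i f)"
    have \<psi>: "even (\<psi> i h)" if i: "i < j - 1" for i
    proof -
      have "even ((h oo f) $ (2 * K i + 1) - h $ (2 * K i + 1) - f $ (2 * K i + 1))"
        by (rule low[OF h f]) (use K[OF i] in auto)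
      from dvd_diff[OF ev[OF i] this] show ?thesis by (simp add: \<psi>_def)
    qed
    moreover have "4 dvd \<phi> h"
    proof -
      obtain v where v: "mod_4_coord j (h oo f) - mod_4_coord j h - mod_4_coord j f = 4 * v"
        using deep[OF h f] by (elim dvdE)
      obtain u where u: "\<phi> (h oo f) - \<phi> f = 4 * u" using ev4 by (elim dvdE)
      have "even (mod_4_coord j h)" using u v unfolding \<phi>_def by presburger
      moreover have "2 * (2 * j + 1) + 1 = 4 * j + 3" by simp
      ultimately have "even (h $ (2 * (2 * j + 1) + 1))"
        by (simp only: mod_4_coord_def) (simp split: if_splits)
      moreover have "even (h $ (2 * (2 * j) + 1))" using \<psi>[of 0] j by (simp add: \<psi>_def K_def)
      ultimately have "even ((h oo f) $ (2 * (3 * j + 1) + 1) - h $ (2 * (3 * j + 1) + 1)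
          - f $ (2 * (3 * j + 1) + 1))" using low[OF h f, of "3 * j + 1"] by simp
      then obtain w where "(h oo f) $ (2 * (3 * j + 1) + 1) - h $ (2 * (3 * j + 1) + 1)
          - f $ (2 * (3 * j + 1) + 1) = 2 * w" by (elim dvdE)
      then show ?thesis using u v unfolding \<phi>_def by presburger
    qed
    ultimately show "4 dvd \<phi> h \<and> (\<forall>i<j - 1. even (\<psi> i h))" by blast
  next
    fix f g assume f: "f \<in> tangent (2 * d + 1)" and g: "g \<in> tangent (2 * d + 1)"
    have g': "g \<in> tangent d" by (rule tangent_mono[OF g]) simp
    have "even ((f oo g) $ (2 * (3 * j + 1) + 1) - f $ (2 * (3 * j + 1) + 1)
        - g $ (2 * (3 * j + 1) + 1))"
      by (rule nth_compose_deep_mod_2'[OF f g d(1,2)]) auto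
    then obtain w where w: "(f oo g) $ (2 * (3 * j + 1) + 1) - f $ (2 * (3 * j + 1) + 1)
        - g $ (2 * (3 * j + 1) + 1) = 2 * w" by (elim dvdE)
    obtain v where v: "mod_4_coord j (f oo g) - mod_4_coord j f - mod_4_coord j g = 4 * v"
      using deep[OF f g'] by (elim dvdE)
    show "4 dvd \<phi> (f oo g) - \<phi> f - \<phi> g" using v w unfolding \<phi>_def by presburger
    fix i assume i: "i < j - 1"
    show "even (\<psi> i (f oo g) - \<psi> i f - \<psi> i g)"
      unfolding \<psi>_def by (rule nth_compose_deep_mod_2'[OF f g d(1,2)]) (use K[OF i] in auto)
  next
    fix s :: int and t :: "nat \<Rightarrow> int"
    define c where "c n = (if n = 4 * j + 3 then s else if n = 4 * j + 1 then t 0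
      else if odd n \<and> n \<le> 6 * j then t (n div 2 - (2 * j + 1)) else 0)" for n
    obtain h where h: "h \<in> tangent (2 * d + 1)" "\<And>n. 2 * d + 1 < n \<Longrightarrow> h $ n = c n"
      using tangent_with_coefficients[of "2 * d + 1" c] by blast
    have "c (4 * j + 3) = s" "c (2 * (3 * j + 1) + 1) = 0" using j by (auto simp: c_def)
    moreover have "h $ (4 * j + 3) = c (4 * j + 3)"
      "h $ (2 * (3 * j + 1) + 1) = c (2 * (3 * j + 1) + 1)" using h(2) j by (auto simp: d_def)
    moreover have "h $ 8 = 0" if "j = 2" using h(2)[of 8] that by (simp add: c_def d_def)
    ultimately have "\<phi> h = s" by (simp only: \<phi>_def mod_4_coord_def) simp
    moreover have "\<psi> i h = t i" if i: "i < j - 1" for i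
    proof -
      have "2 * d + 1 < 2 * K i + 1" using j by (auto simp: d_def K_def)
      then have "\<psi> i h = c (2 * K i + 1)" using h(2) by (simp add: \<psi>_def)
      also have "\<dots> = t i" using i by (cases "i = 0") (auto simp: c_def K_def)
      finally show ?thesis .
    qed
    ultimately show "\<exists>h\<in>tangent (2 * d + 1). \<phi> h = s \<and> (\<forall>i<j - 1. \<psi> i h = t i)" using h(1) by blast
  next
    fix f g :: "int fps" assume ag: "agree (6 * j + 6) f g"
    then show "\<phi> f = \<phi> g" using j by (auto simp: \<phi>_def mod_4_coord_def agree_def)
    fix i assume "i < j - 1"
    then show "\<psi> i f = \<psi> i g" using ag K[of i] by (auto simp: \<psi>_def agree_def)
  next
    fix N w assume N: "2 * d < N" "even N" and w: "w \<in> tangent N"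
      and ev4: "4 dvd \<phi> w" and ev: "\<And>i. i < j - 1 \<Longrightarrow> even (\<psi> i w)"
    obtain J where J: "N = 2 * J" using N(2) by (elim evenE)
    have ev2: "even (\<phi> w)" using dvd_trans[OF _ ev4, of 2] by simp
    consider "J = 2 * j" | "J = 2 * j + 1" | "2 * j + 2 \<le> J" "J \<le> 3 * j - 1" | "J = 3 * j"
      | "J = 3 * j + 1" | "3 * j + 2 \<le> J"
      using N(1) J j unfolding d_def by linarith
    then show "even (w $ Suc N) \<or> (\<exists>h\<in>J_derived d. h \<in> tangent N \<and> odd (h $ Suc N))"
    proof cases
      case 1
      then show ?thesis using ev[of 0] j by (simp add: \<psi>_def K_def J)
    next
      case 2
      then have idx: "Suc N = 4 * j + 3" by (simp add: J)
      have "even (w $ (4 * j + 3))" using ev2 \<phi>_even[of w] by simp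
      then show ?thesis unfolding idx by blast
    next
      case 3
      have idx: "2 * K (J - (2 * j + 1)) + 1 = Suc N" using 3 by (auto simp: J K_def)
      have "J - (2 * j + 1) < j - 1" using 3 by auto
      from ev[OF this] show ?thesis unfolding \<psi>_def idx by blast
    next
      case 4
      then show ?thesis using derived_odd_odd_depth[of j J] j by (simp add: J d_def)
    next
      case 5
      have "w $ (4 * j + 3) = 0" "w $ 8 = 0" using w 5 j by (auto simp: tangent_nth J)
      then have "\<phi> w = 2 * w $ Suc N" using 5 by (simp add: \<phi>_def mod_4_coord_def J)
      then have "2 * 2 dvd 2 * w $ Suc N" using ev4 by simp
      then show ?thesis unfolding dvd_mult_cancel_left by simp
    next
      case 6
      then show ?thesis using derived_odd_odd_depth[of j J] j by (simp add: J d_def)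
    qed
  qed
  then show ?thesis by (simp only: Suc_d)
qed

theorem theorem1p0p2:
  fixes k :: nat
  assumes "k \<ge> 2"
  shows
    "(k mod 4 = 3 \<longrightarrow>
        J_H1 k \<cong> power_group integer_group k
          \<times>\<times> power_group (integer_mod_group 2) ((k + 1) div 2)) \<and>
     (k mod 4 = 2 \<longrightarrow>
        J_H1 k \<cong> power_group integer_group k
          \<times>\<times> power_group (integer_mod_group 2) ((k + 2) div 2)) \<and>
     (k mod 4 = 1 \<longrightarrow>
        J_H1 k \<cong> power_group integer_group k
          \<times>\<times> (integer_mod_group 4 \<times>\<times> power_group (integer_mod_group 2) ((k - 3) div 2))) \<and>
     (k mod 4 = 0 \<longrightarrow>
        J_H1 k \<cong> power_group integer_group k
          \<times>\<times> (integer_mod_group 4 \<times>\<times> power_group (integer_mod_group 2) ((k - 2) div 2)))"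
proof (intro conjI impI)
  assume k: "k mod 4 = 3"
  define j where "j = (k - 1) div 2"
  have "k = Suc (2 * j)" "odd j" "(k + 1) div 2 = j + 1" using k unfolding j_def by presburger+
  then show "J_H1 k \<cong> power_group integer_group k
      \<times>\<times> power_group (integer_mod_group 2) ((k + 1) div 2)"
    using J_H1_2_mod_4 by metis
next
  assume k: "k mod 4 = 2"
  define j where "j = k div 2"
  have j: "k = 2 * j" "odd j" "(k + 2) div 2 = j + 1" using k unfolding j_def by presburger+
  show "J_H1 k \<cong> power_group integer_group k
      \<times>\<times> power_group (integer_mod_group 2) ((k + 2) div 2)"
  proof (cases "k = 2")
    case True
    then show ?thesis using J_H1_k_2 by simp
  next
    case False
    then have "2 \<le> j" using j(1) assms by simp
    then show ?thesis using J_H1_1_mod_4 j by metis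
  qed
next
  assume k: "k mod 4 = 1"
  define j where "j = (k - 1) div 2"
  have "k = Suc (2 * j)" "even j" "(k - 3) div 2 = j - 1" "2 \<le> j"
    using k assms unfolding j_def by presburger+
  then show "J_H1 k \<cong> power_group integer_group k
      \<times>\<times> (integer_mod_group 4 \<times>\<times> power_group (integer_mod_group 2) ((k - 3) div 2))"
    using J_H1_0_mod_4_even_depth by metis
next
  assume k: "k mod 4 = 0"
  define j where "j = k div 2"
  have "k = 2 * j" "even j" "(k - 2) div 2 = j - 1" "2 \<le> j"
    using k assms unfolding j_def by presburger+
  then show "J_H1 k \<cong> power_group integer_group k
      \<times>\<times> (integer_mod_group 4 \<times>\<times> power_group (integer_mod_group 2) ((k - 2) div 2))"
    using J_H1_0_mod_4 by metis
qed

end
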